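(* Let $d\ge1$, $s\in(0,1)$, $\beta>0$. Let $v_O$ be the unique minimizer of $$\mathscr{E}(v)=\frac12\int_{\mathbb{R}^d}|(-\Delta)^{s/2}v|^2dy+\int_{\mathbb{R}^d}\Big(\frac\beta2|y|^2-1\Big)v\,dy$$ over $$\mathscr{K}=\Big\{v\in H^s(\mathbb{R}^d):\ \big(\tfrac\beta2|y|^2-1\big)v\in L^1(\mathbb{R}^d),\ v\ge0\Big\},$$ and let $$v_D(y)=\frac1{\lambda^{2s}\kappa_{s,d}}\big(1-\lambda^2|y|^2\big)_+^{1+s},\qquad \lambda=\sqrt{\frac{\beta}{2\gamma_{s,d}}},$$ with $\gamma_{s,d}=1+\frac{2s}d$ and $\kappa_{s,d}=2^{2s}\Gamma(s+2)\Gamma(s+\frac d2)\Gamma(\frac d2)^{-1}$. Then $v_O=v_D$.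
   Context: $(-\Delta)^{s/2}$ is the Fourier multiplier with symbol $|\xi|^s$ on $\mathbb{R}^d$, $\Gamma$ is the Euler Gamma function, $(\cdot)_+$ is the positive part. *)

theory Defs
  imports "HOL-Analysis.Analysis"
begin

definition square_integrable :: "('a::euclidean_space \<Rightarrow> complex) \<Rightarrow> bool" where
  "square_integrable f \<longleftrightarrow>
     f \<in> borel_measurable lebesgue \<and> integrable lebesgue (\<lambda>x. (cmod (f x))\<^sup>2)"

text \<open>The convention without \<open>2 * pi\<close> in the exponent: it is the one for which the symbol of
  minus the Laplacian is \<open>(norm \<xi>)\<^sup>2\<close>.\<close>

definition fourier_L1 :: "('a::euclidean_space \<Rightarrow> complex) \<Rightarrow> 'a \<Rightarrow> complex" where
  "fourier_L1 f \<xi> = (\<integral>x. exp (- \<i> * complex_of_real (x \<bullet> \<xi>)) * f x \<partial>lebesgue)"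

text \<open>The Plancherel extension to square integrable functions: \<open>g\<close> is the limit in mean of
  the transforms of the (integrable) truncations of \<open>f\<close> to balls.  The distance is a
  nonnegative integral, so that it is \<open>\<infinity>\<close> and not \<open>0\<close> where the integrand is not integrable.\<close>

definition is_fourier_L2 :: "('a::euclidean_space \<Rightarrow> complex) \<Rightarrow> ('a \<Rightarrow> complex) \<Rightarrow> bool" where
  "is_fourier_L2 f g \<longleftrightarrow> square_integrable g \<and>
     ((\<lambda>R::real. \<integral>\<^sup>+\<xi>. ennreal ((cmod (fourier_L1 (\<lambda>x. indicator (ball 0 R) x * f x) \<xi> - g \<xi>))\<^sup>2)
        \<partial>lebesgue) \<longlongrightarrow> 0) at_top"

text \<open>The choice is between functions that agree almost everywhere.\<close>

definition fourier_L2 :: "('a::euclidean_space \<Rightarrow> complex) \<Rightarrow> 'a \<Rightarrow> complex" where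
  "fourier_L2 f = (SOME g. is_fourier_L2 f g)"

definition inv_fourier_L2 :: "('a::euclidean_space \<Rightarrow> complex) \<Rightarrow> 'a \<Rightarrow> complex" where
  "inv_fourier_L2 g x = fourier_L2 g (- x) / complex_of_real ((2 * pi) ^ DIM('a))"

definition fourier_multiplier ::
  "('a::euclidean_space \<Rightarrow> real) \<Rightarrow> ('a \<Rightarrow> complex) \<Rightarrow> 'a \<Rightarrow> complex" where
  "fourier_multiplier m f = inv_fourier_L2 (\<lambda>\<xi>. complex_of_real (m \<xi>) * fourier_L2 f \<xi>)"

text \<open>\<open>frac_laplacian \<sigma>\<close> is the power \<open>\<sigma> / 2\<close> of minus the Laplacian.\<close>

definition frac_laplacian :: "real \<Rightarrow> ('a::euclidean_space \<Rightarrow> complex) \<Rightarrow> 'a \<Rightarrow> complex" where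
  "frac_laplacian \<sigma> = fourier_multiplier (\<lambda>\<xi>. norm \<xi> powr \<sigma>)"

definition sobolev_space :: "real \<Rightarrow> ('a::euclidean_space \<Rightarrow> complex) set" where
  "sobolev_space s = {f. square_integrable f \<and>
     square_integrable (\<lambda>\<xi>. complex_of_real ((1 + (norm \<xi>)\<^sup>2) powr (s / 2)) * fourier_L2 f \<xi>)}"

definition energy :: "real \<Rightarrow> real \<Rightarrow> ('a::euclidean_space \<Rightarrow> real) \<Rightarrow> real" where
  "energy s \<beta> v =
     1 / 2 * (\<integral>y. (cmod (frac_laplacian s (\<lambda>x. complex_of_real (v x)) y))\<^sup>2 \<partial>lebesgue)
     + (\<integral>y. (\<beta> / 2 * (norm y)\<^sup>2 - 1) * v y \<partial>lebesgue)"

text \<open>Elements are functions, not classes modulo null sets, so the sign condition is imposed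
  almost everywhere.\<close>

definition admissible :: "real \<Rightarrow> real \<Rightarrow> ('a::euclidean_space \<Rightarrow> real) set" where
  "admissible s \<beta> = {v. (\<lambda>x. complex_of_real (v x)) \<in> sobolev_space s \<and>
     integrable lebesgue (\<lambda>y. (\<beta> / 2 * (norm y)\<^sup>2 - 1) * v y) \<and>
     (AE y in lebesgue. 0 \<le> v y)}"

definition gamma_const :: "real \<Rightarrow> nat \<Rightarrow> real" where
  "gamma_const s d = 1 + 2 * s / real d"

definition kappa_const :: "real \<Rightarrow> nat \<Rightarrow> real" where
  "kappa_const s d = 2 powr (2 * s) * Gamma (s + 2) * Gamma (s + real d / 2) / Gamma (real d / 2)"

definition lambda_const :: "real \<Rightarrow> real \<Rightarrow> nat \<Rightarrow> real" where
  "lambda_const s \<beta> d = sqrt (\<beta> / (2 * gamma_const s d))"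

definition v_D :: "real \<Rightarrow> real \<Rightarrow> 'a::euclidean_space \<Rightarrow> real" where
  "v_D s \<beta> y = (let l = lambda_const s \<beta> DIM('a) in
     1 / (l powr (2 * s) * kappa_const s DIM('a)) * (max 0 (1 - l\<^sup>2 * (norm y)\<^sup>2)) powr (1 + s))"

end

theory Submission imports Defs "HOL-Probability.Characteristic_Functions" begin

text \<open>As a function of the level \<open>t\<close>, the profile \<open>max 0 (t - |x|^2) powr (1 + s)\<close> has a multiple of a Gaussian
  in \<open>x\<close> as its Laplace transform, and \<open>|\<xi>| powr (2 * s)\<close> acts on Gaussians through the subordination formula
  \<open>s * \<integral>r>0. (1 - exp (- \<eta> * r)) * r powr (- 1 - s) = Gamma (1 - s) * \<eta> powr s\<close>.
  Hence, by injectivity of the Laplace transform, the fractional Laplacian of the profile is a multiple of the integral over \<open>r\<close>,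
  against \<open>r powr (- 1 - s)\<close>, of the difference between \<open>max 0 (t - |x|^2)\<close> and its dilation
  by \<open>sqrt (1 + r)\<close> of equal mass.  Where \<open>|x|^2 \<le> t\<close> both positive parts are inactive and the integral is a
  quadratic polynomial; elsewhere the same polynomial is a lower bound.  These are the
  Euler-Lagrange conditions of the obstacle problem, and since by Plancherel the energy is convex with a
  quadratic gap, they characterise the minimiser.\<close>

subsection \<open>Gaussians and Lebesgue measure\<close>

text \<open>The exponent \<open>1 + s\<close> is tied to the method. With \<eta> = |\<xi>|^2 / (4 *
  p), the Laplace transform of |\<xi>|^(2 * s) times the Fourier transform of the profile carries
  the factor p^(- 2 - s) * |\<xi>|^(2 * s) = 4^s * p^(- 2) * \<eta>^s, and p^(- 2) is the Laplace
  transform of a plain positive part. A factor exp (- \<eta> * r) from the subordination formula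
  changes the Gaussian parameter p into p / (1 + r), which is a dilation of the quadratic. At a
  fixed level the transform of the profile is a Bessel function; the Laplace transform in
  \<open>t\<close> replaces it by a Gaussian. The obstacle is the meaning of the energy:
  \<open>fourier_L2\<close> is a choice among limits in mean, so the existence of such a limit, its
  uniqueness almost everywhere and Plancherel's identity come before any computation. The profile
  and its fractional Laplacian are integrable and bounded, so their chosen transforms agree almost
  everywhere with the integrals, for which the identity is proved pointwise in \<xi>.\<close>

abbreviation fourier_char :: "'a::euclidean_space \<Rightarrow> 'a \<Rightarrow> complex" where
  "fourier_char \<xi> x \<equiv> exp (- \<i> * complex_of_real (x \<bullet> \<xi>))"

abbreviation sq_norm :: "('a::euclidean_space \<Rightarrow> complex) \<Rightarrow> real" where
  "sq_norm f \<equiv> \<integral>x. (cmod (f x))\<^sup>2 \<partial>lebesgue"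

abbreviation sq_ennorm :: "('a::euclidean_space \<Rightarrow> complex) \<Rightarrow> ennreal" where
  "sq_ennorm f \<equiv> \<integral>\<^sup>+x. ennreal ((cmod (f x))\<^sup>2) \<partial>lebesgue"

lemma integrable_pair_mult:
  fixes f g :: "_ \<Rightarrow> 'c::{banach,second_countable_topology,real_normed_field}"
  assumes "sigma_finite_measure M" "sigma_finite_measure N" 
    and f: "integrable M f" and g: "integrable N g"
  shows "integrable (M \<Otimes>\<^sub>M N) (\<lambda>(x,y). f x * g y)"
proof -
  interpret pair_sigma_finite M N using assms by (simp add: pair_sigma_finite_def)
  have [measurable]: "f \<in> borel_measurable M" "g \<in> borel_measurable N" using f g by auto
  show ?thesis
  proof (rule Fubini_integrable)
    show "integrable M (\<lambda>x. \<integral>y. norm (case (x, y) of (x, y) \<Rightarrow> f x * g y) \<partial>N)"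
      using f by (simp add: norm_mult)
    show "AE x in M. integrable N (\<lambda>y. case (x, y) of (x, y) \<Rightarrow> f x * g y)"
      using g by simp
  qed measurable
qed

lemma lborel_integral_affine:
  fixes f :: "'a::euclidean_space \<Rightarrow> 'b::{banach, second_countable_topology}"
  assumes c: "c \<noteq> 0" and f[measurable]: "f \<in> borel_measurable borel"
  shows "(\<integral>x. f x \<partial>lborel) = \<bar>c\<bar> ^ DIM('a) *\<^sub>R (\<integral>x. f (t + c *\<^sub>R x) \<partial>lborel)"
  by (subst lborel_affine[OF c, of t]) (simp add: integral_density integral_distr)

lemma lborel_integrable_affine:
  fixes f :: "'a::euclidean_space \<Rightarrow> 'b::{banach, second_countable_topology}"
  assumes c: "c \<noteq> 0" and f: "integrable lborel f"
  shows "integrable lborel (\<lambda>x. f (t + c *\<^sub>R x))"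
proof -
  have [measurable]: "f \<in> borel_measurable borel" using f by auto
  from f have "integrable (density (distr lborel borel (\<lambda>x. t + c *\<^sub>R x)) (\<lambda>_. \<bar>c\<bar>^DIM('a))) f"
    by (subst (asm) lborel_affine[OF c, of t]) simp
  then have "integrable lborel (\<lambda>x. \<bar>c\<bar> ^ DIM('a) *\<^sub>R f (t + c *\<^sub>R x))"
    by (simp add: integrable_density integrable_distr_eq)
  then have "integrable lborel (\<lambda>x. inverse (\<bar>c\<bar> ^ DIM('a)) *\<^sub>R \<bar>c\<bar> ^ DIM('a) *\<^sub>R f (t + c *\<^sub>R x))"
    by (rule integrable_scaleR_right)
  then show ?thesis using c by simp
qed

lemma
  fixes f :: "'b::euclidean_space \<Rightarrow> real \<Rightarrow> complex"
  assumes f: "\<And>b. b \<in> Basis \<Longrightarrow> integrable lborel (f b)"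
  shows integrable_lborel_prod: "integrable lborel (\<lambda>x. \<Prod>b\<in>Basis. f b (x \<bullet> b))"
    and integral_lborel_prod: "(\<integral>x. (\<Prod>b\<in>Basis. f b (x \<bullet> b)) \<partial>lborel) = (\<Prod>b\<in>Basis. \<integral>x. f b x \<partial>lborel)"
proof -
  interpret product_sigma_finite "\<lambda>_::'b. lborel::real measure" ..
  have [measurable]: "f b \<in> borel_measurable borel" if "b \<in> Basis" for b
    using f[OF that] by auto
  have eq: "(\<Prod>b\<in>Basis. f b ((\<Sum>c\<in>Basis. y c *\<^sub>R c) \<bullet> b)) = (\<Prod>b\<in>Basis. f b (y b))" for y
    by (intro prod.cong) auto
  show "integrable lborel (\<lambda>x. \<Prod>b\<in>Basis. f b (x \<bullet> b))"
    by (subst lborel_eq) (simp add: integrable_distr_eq eq product_integrable_prod f)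
  show "(\<integral>x. (\<Prod>b\<in>Basis. f b (x \<bullet> b)) \<partial>lborel) = (\<Prod>b\<in>Basis. \<integral>x. f b x \<partial>lborel)"
    by (subst lborel_eq) (simp add: integral_distr eq product_integral_prod f)
qed

text \<open>The characteristic function of the standard normal distribution is known; substituting
  \<open>c * x\<close> with c^2 = 2 * p turns its density into exp (- p * x^2) / sqrt (2 *
  pi).\<close>

lemma gaussian_fourier_real:
  fixes p y :: real
  assumes p: "p > 0"
  shows "integrable lborel (\<lambda>x. exp (- \<i> * complex_of_real (x * y)) * complex_of_real (exp (- p * x\<^sup>2)))"
    and "(\<integral>x. exp (- \<i> * complex_of_real (x * y)) * complex_of_real (exp (- p * x\<^sup>2)) \<partial>lborel)
       = complex_of_real (sqrt (pi / p) * exp (- y\<^sup>2 / (4 * p)))"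
proof -
  define c where "c = sqrt (2 * p)"
  have c: "c > 0" "c\<^sup>2 = 2 * p" using p by (auto simp: c_def)
  let ?f = "\<lambda>x. std_normal_density x *\<^sub>R iexp ((- y / c) * x)"
  let ?g = "\<lambda>x. exp (- \<i> * complex_of_real (x * y)) * complex_of_real (exp (- p * x\<^sup>2))"
  have int: "integrable lborel ?f"
    by (rule Bochner_Integration.integrable_bound[OF integrable_normal_density[of 1 0]]) (auto simp: normal_density_nonneg)
  have val: "(\<integral>x. ?f x \<partial>lborel) = exp (- ((- y / c)\<^sup>2) / 2)"
    using fun_cong[OF char_std_normal_distribution, of "- y / c"] unfolding char_def
    by (subst (asm) integral_density) (auto simp: normal_density_nonneg)
  have eq: "?f (c * x) = complex_of_real (1 / sqrt (2 * pi)) * ?g x" for x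
    using c by (simp add: normal_density_def power_mult_distrib scaleR_conv_of_real mult_ac)
  have "integrable lborel (\<lambda>x. ?f (0 + c * x))"
    using int c by (intro lborel_integrable_real_affine) auto
  then have "integrable lborel (\<lambda>x. complex_of_real (1 / sqrt (2 * pi)) * ?g x)"
    unfolding add_0_left eq .
  then have "integrable lborel (\<lambda>x. complex_of_real (sqrt (2 * pi)) * (complex_of_real (1 / sqrt (2 * pi)) * ?g x))"
    by (rule integrable_mult_right)
  moreover have "complex_of_real (sqrt (2 * pi)) * complex_of_real (1 / sqrt (2 * pi)) = 1"
    by (simp flip: of_real_mult)
  then have inv: "complex_of_real (sqrt (2 * pi)) * (complex_of_real (1 / sqrt (2 * pi)) * z) = z" for z
    by (metis mult.assoc mult_1)
  ultimately show "integrable lborel ?g"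
    unfolding inv by simp
  have "complex_of_real (exp (- ((- y / c)\<^sup>2) / 2)) = \<bar>c\<bar> *\<^sub>R (\<integral>x. ?f (0 + c * x) \<partial>lborel)"
    using lborel_integral_real_affine[of c ?f 0] c val by auto
  also have "\<dots> = complex_of_real (c / sqrt (2 * pi)) * (\<integral>x. ?g x \<partial>lborel)"
    unfolding add_0_left eq using c by (simp add: scaleR_conv_of_real)
  finally have *: "complex_of_real (exp (- ((- y / c)\<^sup>2) / 2)) = complex_of_real (c / sqrt (2 * pi)) * (\<integral>x. ?g x \<partial>lborel)" .
  have "- ((- y / c)\<^sup>2) / 2 = - y\<^sup>2 / (4 * p)" using c by (simp add: power_divide)
  moreover have k: "sqrt (pi / p) * (c / sqrt (2 * pi)) = 1"
    using p by (simp add: c_def real_sqrt_mult real_sqrt_divide)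
  define I where "I = (\<integral>x. ?g x \<partial>lborel)"
  ultimately have "complex_of_real (exp (- y\<^sup>2 / (4 * p))) = complex_of_real (c / sqrt (2 * pi)) * I"
    using * by simp
  then have "complex_of_real (sqrt (pi / p) * exp (- y\<^sup>2 / (4 * p))) = complex_of_real (sqrt (pi / p) * (c / sqrt (2 * pi))) * I"
    by simp
  also have "\<dots> = (\<integral>x. ?g x \<partial>lborel)"
    unfolding k I_def by simp
  finally show "(\<integral>x. ?g x \<partial>lborel) = complex_of_real (sqrt (pi / p) * exp (- y\<^sup>2 / (4 * p)))" ..
qed

text \<open>Character and Gaussian are both products over the coordinates, so the integral is the
  product of the one-dimensional ones.\<close>

lemma
  fixes y :: "'a::euclidean_space"
  assumes p: "p > 0"
  shows gaussian_fourier_integrable: "integrable lborel (\<lambda>x. fourier_char y x * complex_of_real (exp (- p * (norm x)\<^sup>2)))" (is ?A)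
    and gaussian_fourier: "(\<integral>x. fourier_char y x * complex_of_real (exp (- p * (norm x)\<^sup>2)) \<partial>lborel)
       = complex_of_real ((pi / p) powr (real DIM('a) / 2) * exp (- (norm y)\<^sup>2 / (4 * p)))" (is ?B)
proof -
  have sq: "(norm x)\<^sup>2 = (\<Sum>b\<in>Basis. (x \<bullet> b)\<^sup>2)" for x :: 'a
    unfolding power2_norm_eq_inner by (subst euclidean_inner) (simp add: power2_eq_square)
  have eq: "fourier_char y x * complex_of_real (exp (- p * (norm x)\<^sup>2)) =
      (\<Prod>b\<in>Basis. exp (- \<i> * complex_of_real ((x \<bullet> b) * (y \<bullet> b))) * complex_of_real (exp (- p * (x \<bullet> b)\<^sup>2)))" for x
  proof -
    have 1: "fourier_char y x = (\<Prod>b\<in>Basis. exp (- \<i> * complex_of_real ((x \<bullet> b) * (y \<bullet> b))))"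
      by (subst exp_sum[symmetric]) (auto simp: euclidean_inner[of x y] sum_distrib_left sum_negf)
    have 2: "exp (- p * (norm x)\<^sup>2) = (\<Prod>b\<in>Basis. exp (- p * (x \<bullet> b)\<^sup>2))"
      by (subst exp_sum[symmetric]) (auto simp: sq sum_distrib_left sum_negf)
    show ?thesis unfolding 1 2 by (simp add: prod.distrib)
  qed
  show ?A unfolding eq
    by (rule integrable_lborel_prod, rule gaussian_fourier_real) (use p in auto)
  have "(pi / p) powr (real DIM('a) / 2) = ((pi / p) powr (1/2)) powr real DIM('a)"
    by (subst powr_powr) simp
  also have "\<dots> = sqrt (pi / p) ^ DIM('a)"
    using p by (subst powr_realpow) (auto simp: powr_half_sqrt)
  finally have pw: "(pi / p) powr (real DIM('a) / 2) = (\<Prod>b\<in>(Basis::'a set). sqrt (pi / p))" by simp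
  have ex: "exp (- (norm y)\<^sup>2 / (4 * p)) = (\<Prod>b\<in>Basis. exp (- (y \<bullet> b)\<^sup>2 / (4 * p)))"
    by (subst exp_sum[symmetric]) (auto simp: sq sum_negf sum_divide_distrib)
  have "(\<integral>x. (\<Prod>b\<in>Basis. exp (- \<i> * complex_of_real ((x \<bullet> b) * (y \<bullet> b))) * complex_of_real (exp (- p * (x \<bullet> b)\<^sup>2))) \<partial>lborel)
      = (\<Prod>b\<in>Basis. complex_of_real (sqrt (pi / p) * exp (- (y \<bullet> b)\<^sup>2 / (4 * p))))"
    using gaussian_fourier_real[OF p]
    by (subst integral_lborel_prod[where f = "\<lambda>b x. exp (- \<i> * complex_of_real (x * (y \<bullet> b))) * complex_of_real (exp (- p * x\<^sup>2))"])
      (auto intro!: prod.cong)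
  then show ?B unfolding eq pw ex by (simp add: prod.distrib)
qed

subsection \<open>Continuity of translations in the mean\<close>

text \<open>Translations preserve the L1 norm, so replacing \<open>f\<close> by \<open>g\<close>
  costs twice the distance of \<open>f\<close> and \<open>g\<close>, uniformly in \<open>z\<close>:
  the property is closed under L1 limits.\<close>

lemma translation_L1_continuous_closure:
  fixes f :: "'a::euclidean_space \<Rightarrow> 'b::{banach,second_countable_topology}"
  assumes f: "integrable lborel f"
    and approx: "\<And>e. e > 0 \<Longrightarrow> \<exists>g. integrable lborel g \<and> (\<integral>x. norm (f x - g x) \<partial>lborel) < e
           \<and> ((\<lambda>z. \<integral>x. norm (g (x + z) - g x) \<partial>lborel) \<longlongrightarrow> 0) (at 0)"
  shows "((\<lambda>z. \<integral>x. norm (f (x + z) - f x) \<partial>lborel) \<longlongrightarrow> 0) (at 0)"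
proof (rule tendstoI)
  fix e :: real assume "e > 0"
  then obtain g where g: "integrable lborel g" "(\<integral>x. norm (f x - g x) \<partial>lborel) < e / 4"
      and lim: "((\<lambda>z. \<integral>x. norm (g (x + z) - g x) \<partial>lborel) \<longlongrightarrow> 0) (at 0)"
    using approx[of "e / 4"] by auto
  have tr: "integrable lborel (\<lambda>x. h (x + z))" if "integrable lborel h" for h :: "'a \<Rightarrow> 'c::{banach,second_countable_topology}" and z
    using lborel_integrable_affine[of 1 h z] that by (simp add: add.commute)
  have tr_int: "(\<integral>x. h (x + z) \<partial>lborel) = (\<integral>x. h x \<partial>lborel)" if "integrable lborel h" for h :: "'a \<Rightarrow> real" and z
    using lborel_integral_affine[of 1 h z] that by (simp add: add.commute borel_measurable_integrable[of lborel, simplified])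
  have "eventually (\<lambda>z. dist (\<integral>x. norm (g (x + z) - g x) \<partial>lborel) 0 < e / 2) (at 0)"
    using lim \<open>e > 0\<close> by (intro tendstoD) auto
  then show "eventually (\<lambda>z. dist (\<integral>x. norm (f (x + z) - f x) \<partial>lborel) 0 < e) (at 0)"
  proof eventually_elim
    case (elim z)
    have "(\<integral>x. norm (f (x + z) - f x) \<partial>lborel)
        \<le> (\<integral>x. norm (f (x + z) - g (x + z)) + norm (g (x + z) - g x) + norm (f x - g x) \<partial>lborel)"
    proof (rule integral_mono)
      show "integrable lborel (\<lambda>x. norm (f (x + z) - f x))" using f tr[OF f] by auto
      show "integrable lborel (\<lambda>x. norm (f (x + z) - g (x + z)) + norm (g (x + z) - g x) + norm (f x - g x))"
        using f g tr[OF f] tr[OF g(1)] by auto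
    qed norm
    also have "\<dots> = (\<integral>x. norm (f (x + z) - g (x + z)) \<partial>lborel) + (\<integral>x. norm (g (x + z) - g x) \<partial>lborel) + (\<integral>x. norm (f x - g x) \<partial>lborel)"
      using f g tr[OF f] tr[OF g(1)] by simp
    also have "(\<integral>x. norm (f (x + z) - g (x + z)) \<partial>lborel) = (\<integral>x. norm (f x - g x) \<partial>lborel)"
      using f g by (intro tr_int) auto
    also have "(\<integral>x. norm (f x - g x) \<partial>lborel) + (\<integral>x. norm (g (x + z) - g x) \<partial>lborel) + (\<integral>x. norm (f x - g x) \<partial>lborel) < e"
      using g elim by (simp add: dist_real_def)
    finally show ?case by (simp add: dist_real_def)
  qed
qed

text \<open>A translate of \<open>U\<close> has the same measure, so both halves of the symmetric
  difference weigh the same and only the lost part of \<open>U\<close> counts. A point of an open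
  set stays inside for all small \<open>z\<close>, so dominated convergence applies to that
  part.\<close>

lemma translation_L1_continuous_open:
  fixes U :: "'a::euclidean_space set" and c :: "'b::{banach,second_countable_topology}"
  assumes U: "open U" "emeasure lborel U < \<infinity>"
  shows "((\<lambda>z. \<integral>x. norm (indicator U (x + z) *\<^sub>R c - indicator U x *\<^sub>R c) \<partial>lborel) \<longlongrightarrow> 0) (at 0)"
proof -
  let ?u = "indicator U :: 'a \<Rightarrow> real"
  have int: "integrable lborel ?u" using U by (simp add: less_top[symmetric])
  have tr: "integrable lborel (\<lambda>x. ?u (x + z))" for z
    using lborel_integrable_affine[of 1 ?u z] int by (simp add: add.commute)
  have tr_int: "(\<integral>x. ?u (x + z) \<partial>lborel) = (\<integral>x. ?u x \<partial>lborel)" for z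
    using lborel_integral_affine[of 1 ?u z] int U by (simp add: add.commute)
  have eq: "(\<integral>x. norm (?u (x + z) *\<^sub>R c - ?u x *\<^sub>R c) \<partial>lborel) = 2 * norm c * (\<integral>x. max 0 (?u x - ?u (x + z)) \<partial>lborel)" for z
  proof -
    have "norm (?u (x + z) *\<^sub>R c - ?u x *\<^sub>R c) = norm c * (2 * max 0 (?u x - ?u (x + z)) + (?u (x + z) - ?u x))" for x
      by (auto simp: indicator_def)
    then have "(\<integral>x. norm (?u (x + z) *\<^sub>R c - ?u x *\<^sub>R c) \<partial>lborel)
        = (\<integral>x. norm c * (2 * max 0 (?u x - ?u (x + z)) + (?u (x + z) - ?u x)) \<partial>lborel)" by presburger
    also have "\<dots> = 2 * norm c * (\<integral>x. max 0 (?u x - ?u (x + z)) \<partial>lborel)"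
      using int tr[of z] tr_int[of z] by (simp del: integral_indicator)
    finally show ?thesis .
  qed
  have "((\<lambda>z. \<integral>x. max 0 (?u x - ?u (x + z)) \<partial>lborel) \<longlongrightarrow> 0) (at 0)"
    unfolding tendsto_at_iff_sequentially
  proof safe
    fix X :: "nat \<Rightarrow> 'a" assume X: "X \<longlonglongrightarrow> 0"
    have "(\<lambda>n. \<integral>x. max 0 (?u x - ?u (x + X n)) \<partial>lborel) \<longlonglongrightarrow> (\<integral>x. 0 \<partial>(lborel :: 'a measure))"
    proof (rule integral_dominated_convergence[where w = ?u])
      have [measurable]: "U \<in> sets borel" using U by auto
      show "(\<lambda>x. max 0 (?u x - ?u (x + X n))) \<in> borel_measurable lborel" for n by measurable
      show "AE x in lborel. (\<lambda>n. max 0 (?u x - ?u (x + X n))) \<longlonglongrightarrow> 0"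
      proof (rule AE_I2, rule tendsto_eventually)
        fix x :: 'a
        show "\<forall>\<^sub>F n in sequentially. max 0 (?u x - ?u (x + X n)) = 0"
        proof (cases "x \<in> U")
          case True
          have "(\<lambda>n. x + X n) \<longlonglongrightarrow> x + 0" using X by (intro tendsto_intros)
          then have "\<forall>\<^sub>F n in sequentially. x + X n \<in> U"
            using True U by (simp add: topological_tendstoD)
          then show ?thesis by eventually_elim (simp add: True)
        qed simp
      qed
    qed (use int in \<open>auto split: split_indicator\<close>)
    then show "((\<lambda>z. \<integral>x. max 0 (?u x - ?u (x + z)) \<partial>lborel) \<circ> X) \<longlonglongrightarrow> 0"
      by (simp add: o_def)
  qed
  then show ?thesis unfolding eq by (rule tendsto_mult_right_zero)
qed

text \<open>Induction over integrable functions: outer regularity reduces a measurable set to an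
  open one, and closure under L1 limits handles both this reduction and the limit step.\<close>

lemma translation_L1_continuous:
  fixes f :: "'a::euclidean_space \<Rightarrow> 'b::{banach,second_countable_topology}"
  assumes "integrable lborel f"
  shows "((\<lambda>z. \<integral>x. norm (f (x + z) - f x) \<partial>lborel) \<longlongrightarrow> 0) (at 0)"
  using assms
proof (induction rule: integrable_induct)
  case (base A c)
  then have [measurable]: "A \<in> sets borel" by simp
  show ?case
  proof (rule translation_L1_continuous_closure)
    show "integrable lborel (\<lambda>x. indicator A x *\<^sub>R c)" using base by simp
    fix e :: real assume "e > 0"
    \<comment> \<open>The summand 1 keeps \<open>e'\<close> positive when
      \<open>c = 0\<close>.\<close>
    define e' where "e' = e / (norm c + 1)"
    have "e' > 0" using \<open>e > 0\<close> by (simp add: e'_def add_nonneg_pos)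
    then obtain U where U: "open U" "A \<subseteq> U" "emeasure lborel (U - A) < e'"
      using outer_regular_lborel[of A e'] by auto
    then have [measurable]: "U \<in> sets borel" by auto
    have "emeasure lborel U = emeasure lborel A + emeasure lborel (U - A)"
      using U by (subst plus_emeasure) (auto simp: Un_absorb1)
    then have fin: "emeasure lborel U < \<infinity>"
      using base U by (simp add: less_top) (metis ennreal_less_top order_less_trans top.not_eq_extremum)
    show "\<exists>g. integrable lborel g \<and> (\<integral>x. norm (indicator A x *\<^sub>R c - g x) \<partial>lborel) < e
           \<and> ((\<lambda>z. \<integral>x. norm (g (x + z) - g x) \<partial>lborel) \<longlongrightarrow> 0) (at 0)"
    proof (intro exI conjI)
      show "integrable lborel (\<lambda>x. indicator U x *\<^sub>R c)" using fin by simp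
      have "norm (indicator A x *\<^sub>R c - indicator U x *\<^sub>R c) = norm c * indicator (U - A) x" for x
        using U by (auto simp: indicator_def)
      then have "(\<integral>x. norm (indicator A x *\<^sub>R c - indicator U x *\<^sub>R c) \<partial>lborel) = norm c * measure lborel (U - A)"
        by simp
      also have "\<dots> \<le> norm c * e'"
        using U \<open>e' > 0\<close> unfolding measure_def
        by (intro mult_left_mono enn2real_leI) (auto intro: order_less_imp_le)
      also have "\<dots> < e" using \<open>e > 0\<close> norm_ge_zero[of c] unfolding e'_def times_divide_eq_right
        by (subst pos_divide_less_eq) (linarith, simp add: algebra_simps)
      finally show "(\<integral>x. norm (indicator A x *\<^sub>R c - indicator U x *\<^sub>R c) \<partial>lborel) < e" .
    qed (rule translation_L1_continuous_open[OF U(1) fin])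
  qed
next
  case (add f g)
  have tr: "integrable lborel (\<lambda>x. h (x + z))" if "integrable lborel h" for h :: "'a \<Rightarrow> 'b" and z
    using lborel_integrable_affine[of 1 h z] that by (simp add: add.commute)
  show ?case
  proof (rule tendsto_sandwich[OF _ _ tendsto_const])
    show "((\<lambda>z. (\<integral>x. norm (f (x + z) - f x) \<partial>lborel) + (\<integral>x. norm (g (x + z) - g x) \<partial>lborel)) \<longlongrightarrow> 0) (at 0)"
      using tendsto_add[OF add.IH] by simp
    show "\<forall>\<^sub>F z in at 0. (\<integral>x. norm (f (x + z) + g (x + z) - (f x + g x)) \<partial>lborel)
        \<le> (\<integral>x. norm (f (x + z) - f x) \<partial>lborel) + (\<integral>x. norm (g (x + z) - g x) \<partial>lborel)"
    proof (rule always_eventually, rule allI)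
      fix z
      have "(\<integral>x. norm (f (x + z) + g (x + z) - (f x + g x)) \<partial>lborel)
        \<le> (\<integral>x. norm (f (x + z) - f x) + norm (g (x + z) - g x) \<partial>lborel)"
      proof (rule integral_mono)
        show "norm (f (x + z) + g (x + z) - (f x + g x)) \<le> norm (f (x + z) - f x) + norm (g (x + z) - g x)" for x
          by (simp add: norm_diff_triangle_ineq)
      qed (use add.hyps tr in auto)
      also have "\<dots> = (\<integral>x. norm (f (x + z) - f x) \<partial>lborel) + (\<integral>x. norm (g (x + z) - g x) \<partial>lborel)"
        using add.hyps tr by simp
      finally show "(\<integral>x. norm (f (x + z) + g (x + z) - (f x + g x)) \<partial>lborel) \<le> \<dots>" .
    qed
  qed auto
next
  case (lim f s)
  show ?case
  proof (rule translation_L1_continuous_closure[OF lim.hyps(4)])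
    fix e :: real assume "e > 0"
    have "(\<lambda>i. \<integral>x. norm (f x - s i x) \<partial>lborel) \<longlonglongrightarrow> (\<integral>x. 0 \<partial>(lborel :: 'a measure))"
    \<comment> \<open>The approximants satisfy norm (s i x) \<le> 2 * norm (f x), whence the
      3.\<close>
    proof (rule integral_dominated_convergence[where w = "\<lambda>x. 3 * norm (f x)"])
      have [measurable]: "f \<in> borel_measurable borel" "s i \<in> borel_measurable borel" for i
        using lim.hyps(1)[of i] lim.hyps(4) by auto
      show "(\<lambda>x. norm (f x - s i x)) \<in> borel_measurable lborel" for i by measurable
      show "AE x in lborel. (\<lambda>i. norm (f x - s i x)) \<longlonglongrightarrow> 0"
      proof (rule AE_I2)
        fix x :: 'a assume "x \<in> space lborel"
        then have "(\<lambda>i. f x - s i x) \<longlonglongrightarrow> f x - f x"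
          using lim.hyps(2) by (intro tendsto_diff tendsto_const) auto
        then show "(\<lambda>i. norm (f x - s i x)) \<longlonglongrightarrow> 0"
          by (simp add: tendsto_norm_zero)
      qed
      show "AE x in lborel. norm (norm (f x - s i x)) \<le> 3 * norm (f x)" for i
      proof (rule AE_I2)
        fix x :: 'a assume "x \<in> space lborel"
        then have "norm (s i x) \<le> 2 * norm (f x)" using lim.hyps(3) by auto
        then show "norm (norm (f x - s i x)) \<le> 3 * norm (f x)" using norm_triangle_ineq4[of "f x" "s i x"] by simp
      qed
    qed (use lim in auto)
    then have "\<forall>\<^sub>F i in sequentially. dist (\<integral>x. norm (f x - s i x) \<partial>lborel) 0 < e"
      using \<open>e > 0\<close> by (intro tendstoD) auto
    then obtain i where "dist (\<integral>x. norm (f x - s i x) \<partial>lborel) 0 < e"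
      by (auto simp: eventually_sequentially)
    then show "\<exists>g. integrable lborel g \<and> (\<integral>x. norm (f x - g x) \<partial>lborel) < e
           \<and> ((\<lambda>z. \<integral>x. norm (g (x + z) - g x) \<partial>lborel) \<longlongrightarrow> 0) (at 0)"
      using lim.hyps lim.IH by (intro exI[of _ "s i"]) (auto simp: dist_real_def)
  qed
qed

subsection \<open>Plancherel for bounded integrable functions\<close>

lemma borel_measurable_cnj [measurable]:
  "f \<in> borel_measurable M \<Longrightarrow> (\<lambda>x. cnj (f x)) \<in> borel_measurable M"
  by (rule measurable_compose[OF _ borel_measurable_continuous_onI]) (auto intro: continuous_intros)

lemma fourier_L1_borel:
  assumes [measurable]: "f \<in> borel_measurable borel"
  shows "fourier_L1 f \<xi> = (\<integral>x. fourier_char \<xi> x * f x \<partial>lborel)"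
  unfolding fourier_L1_def by (rule integral_completion) measurable

lemma fourier_L1_borel_measurable [measurable]:
  fixes f :: "'a::euclidean_space \<Rightarrow> complex"
  assumes [measurable]: "f \<in> borel_measurable borel"
  shows "fourier_L1 f \<in> borel_measurable borel"
proof -
  have "(\<lambda>\<xi>. \<integral>x. fourier_char \<xi> x * f x \<partial>lborel) \<in> borel_measurable lborel"
    by measurable
  moreover have "fourier_L1 f = (\<lambda>\<xi>. \<integral>x. fourier_char \<xi> x * f x \<partial>lborel)"
    by (rule ext, rule fourier_L1_borel, rule assms)
  ultimately show ?thesis by simp
qed

lemma norm_fourier_kernel [simp]: "cmod (exp (- \<i> * complex_of_real t)) = 1" "cmod (exp (- (\<i> * complex_of_real t))) = 1"
  by (simp_all add: norm_exp_eq_Re)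

lemma norm_fourier_L1_le:
  assumes f: "integrable lborel f"
  shows "cmod (fourier_L1 f \<xi>) \<le> (\<integral>x. cmod (f x) \<partial>lborel)"
proof -
  have "f \<in> borel_measurable borel" using f by auto
  then have "cmod (fourier_L1 f \<xi>) \<le> (\<integral>x. cmod (fourier_char \<xi> x * f x) \<partial>lborel)"
    by (simp add: fourier_L1_borel del: mult_minus_left)
  then show ?thesis by (simp add: norm_mult)
qed

text \<open>The squared modulus is the transform times its conjugate. The Gaussian factor and the
  boundedness of the transform make the double integrals absolutely convergent, so Fubini opens both
  transforms, and the remaining integral over \<xi> is the Fourier transform of a Gaussian at
  \<open>x - y\<close>.\<close>

lemma gaussian_regularised_energy:
  fixes f :: "'a::euclidean_space \<Rightarrow> complex"
  assumes f: "integrable lborel f" and e: "\<epsilon> > 0"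
  shows "(\<integral>\<xi>. complex_of_real ((cmod (fourier_L1 f \<xi>))\<^sup>2 * exp (- \<epsilon> * (norm \<xi>)\<^sup>2)) \<partial>lborel)
    = (\<integral>x. f x * (\<integral>y. cnj (f y) * complex_of_real ((pi / \<epsilon>) powr (real DIM('a) / 2) * exp (- (norm (x - y))\<^sup>2 / (4 * \<epsilon>))) \<partial>lborel) \<partial>lborel)"
proof -
  let ?E = "\<lambda>x \<xi>. fourier_char \<xi> x :: complex"
  let ?g = "\<lambda>\<xi>. complex_of_real (exp (- \<epsilon> * (norm \<xi>)\<^sup>2))"
  have [measurable]: "f \<in> borel_measurable borel" using f by auto
  define F where "F = fourier_L1 f"
  have F: "F \<xi> = (\<integral>x. ?E x \<xi> * f x \<partial>lborel)" for \<xi> by (simp add: F_def fourier_L1_borel)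
  have cF: "cnj (F \<xi>) = (\<integral>x. cnj (?E x \<xi> * f x) \<partial>lborel)" for \<xi>
    unfolding F by (rule Bochner_Integration.integral_cnj[symmetric])
  have [measurable]: "F \<in> borel_measurable borel" unfolding F_def by measurable
  define B where "B = (\<integral>x. cmod (f x) \<partial>lborel)"
  have FB: "cmod (F \<xi>) \<le> B" for \<xi> unfolding F_def B_def by (rule norm_fourier_L1_le[OF f])
  have g: "integrable lborel (?g :: 'a \<Rightarrow> complex)"
    using gaussian_fourier_integrable[OF e, of "0 :: 'a"] by simp
  have gB: "integrable lborel (\<lambda>\<xi> :: 'a. ?g \<xi> * complex_of_real B)"
    using g by (rule integrable_mult_left)
  have sf: "sigma_finite_measure (lborel :: 'a measure)" by (rule sigma_finite_lborel)
  have int1: "integrable (lborel \<Otimes>\<^sub>M lborel) (\<lambda>(x, \<xi>). ?E x \<xi> * f x * (cnj (F \<xi>) * ?g \<xi>))"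
  proof (rule Bochner_Integration.integrable_bound[OF integrable_pair_mult[OF sf sf f gB]])
    have *: "cmod (f x * cnj (F \<xi>) * exp (- (\<epsilon> * (norm \<xi>)\<^sup>2))) \<le> cmod (f x) * (exp (- (\<epsilon> * (norm \<xi>)\<^sup>2)) * B)" for x \<xi>
      using FB[of \<xi>] by (auto simp: norm_mult mult_ac intro!: mult_right_mono)
    show "AE p in lborel \<Otimes>\<^sub>M lborel. norm (case p of (x, \<xi>) \<Rightarrow> ?E x \<xi> * f x * (cnj (F \<xi>) * ?g \<xi>))
        \<le> norm (case p of (x, \<xi>) \<Rightarrow> f x * (?g \<xi> * complex_of_real B))"
      using * FB[of 0] by (auto intro!: AE_I2 simp: norm_mult mult_ac abs_of_nonneg order_trans[OF norm_ge_zero])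
  qed measurable
  have int2: "integrable (lborel \<Otimes>\<^sub>M lborel) (\<lambda>(\<xi>, y). ?E x \<xi> * ?g \<xi> * cnj (?E y \<xi> * f y))" for x
  proof (rule Bochner_Integration.integrable_bound[OF integrable_pair_mult[OF sf sf g f]])
    show "AE p in lborel \<Otimes>\<^sub>M lborel. norm (case p of (\<xi>, y) \<Rightarrow> ?E x \<xi> * ?g \<xi> * cnj (?E y \<xi> * f y))
        \<le> norm (case p of (\<xi>, y) \<Rightarrow> ?g \<xi> * f y)"
      by (auto intro!: AE_I2 simp: norm_mult)
  qed measurable
  have "(\<integral>\<xi>. complex_of_real ((cmod (fourier_L1 f \<xi>))\<^sup>2 * exp (- \<epsilon> * (norm \<xi>)\<^sup>2)) \<partial>lborel)
      = (\<integral>\<xi>. F \<xi> * (cnj (F \<xi>) * ?g \<xi>) \<partial>lborel)"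
    by (intro Bochner_Integration.integral_cong) (simp_all add: F_def complex_norm_square[symmetric] flip: mult.assoc)
  also have "\<dots> = (\<integral>\<xi>. (\<integral>x. ?E x \<xi> * f x * (cnj (F \<xi>) * ?g \<xi>) \<partial>lborel) \<partial>lborel)"
    unfolding F[of "_"] by (subst integral_mult_left_zero) (simp add: F)
  also have "\<dots> = (\<integral>x. (\<integral>\<xi>. ?E x \<xi> * f x * (cnj (F \<xi>) * ?g \<xi>) \<partial>lborel) \<partial>lborel)"
    using lborel_pair.Fubini_integral[of "\<lambda>x \<xi>. ?E x \<xi> * f x * (cnj (F \<xi>) * ?g \<xi>)"] int1 by simp
  also have "\<dots> = (\<integral>x. f x * (\<integral>y. cnj (f y) * complex_of_real ((pi / \<epsilon>) powr (real DIM('a) / 2) * exp (- (norm (x - y))\<^sup>2 / (4 * \<epsilon>))) \<partial>lborel) \<partial>lborel)"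
  proof (rule Bochner_Integration.integral_cong[OF refl])
    fix x :: 'a
    have "(\<integral>\<xi>. ?E x \<xi> * f x * (cnj (F \<xi>) * ?g \<xi>) \<partial>lborel) = (\<integral>\<xi>. f x * (?E x \<xi> * ?g \<xi> * cnj (F \<xi>)) \<partial>lborel)"
      by (simp add: mult_ac)
    also have "\<dots> = f x * (\<integral>\<xi>. ?E x \<xi> * ?g \<xi> * cnj (F \<xi>) \<partial>lborel)"
      by (rule integral_mult_right_zero)
    also have "(\<integral>\<xi>. ?E x \<xi> * ?g \<xi> * cnj (F \<xi>) \<partial>lborel) = (\<integral>\<xi>. (\<integral>y. ?E x \<xi> * ?g \<xi> * cnj (?E y \<xi> * f y) \<partial>lborel) \<partial>lborel)"
      unfolding cF by (simp only: integral_mult_right_zero)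
    also have "\<dots> = (\<integral>y. (\<integral>\<xi>. ?E x \<xi> * ?g \<xi> * cnj (?E y \<xi> * f y) \<partial>lborel) \<partial>lborel)"
      using lborel_pair.Fubini_integral[of "\<lambda>\<xi> y. ?E x \<xi> * ?g \<xi> * cnj (?E y \<xi> * f y)"] int2[of x] by simp
    also have "\<dots> = (\<integral>y. cnj (f y) * complex_of_real ((pi / \<epsilon>) powr (real DIM('a) / 2) * exp (- (norm (x - y))\<^sup>2 / (4 * \<epsilon>))) \<partial>lborel)"
    proof (rule Bochner_Integration.integral_cong[OF refl])
      fix y :: 'a
      have "?E x \<xi> * ?g \<xi> * cnj (?E y \<xi> * f y) = cnj (f y) * (fourier_char (x - y) \<xi> * ?g \<xi>)" for \<xi>
      proof -
        have "?E x \<xi> * cnj (?E y \<xi>) = fourier_char (x - y) \<xi>"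
          by (simp add: exp_cnj mult_exp_exp inner_diff_right inner_commute algebra_simps)
        then show ?thesis by (simp add: mult_ac)
      qed
      then have "(\<integral>\<xi>. ?E x \<xi> * ?g \<xi> * cnj (?E y \<xi> * f y) \<partial>lborel)
          = (\<integral>\<xi>. cnj (f y) * (fourier_char (x - y) \<xi> * ?g \<xi>) \<partial>lborel)" by presburger
      then show "(\<integral>\<xi>. ?E x \<xi> * ?g \<xi> * cnj (?E y \<xi> * f y) \<partial>lborel) = cnj (f y) * complex_of_real ((pi / \<epsilon>) powr (real DIM('a) / 2) * exp (- (norm (x - y))\<^sup>2 / (4 * \<epsilon>)))"
        unfolding gaussian_fourier[OF e, of "x - y", symmetric] by (simp only: integral_mult_right_zero)
    qed
    finally show "(\<integral>\<xi>. ?E x \<xi> * f x * (cnj (F \<xi>) * ?g \<xi>) \<partial>lborel) = f x * (\<integral>y. cnj (f y) * complex_of_real ((pi / \<epsilon>) powr (real DIM('a) / 2) * exp (- (norm (x - y))\<^sup>2 / (4 * \<epsilon>))) \<partial>lborel)" .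
  qed
  finally show ?thesis .
qed

text \<open>The damped energy of the transform is an average of the autocorrelation of
  \<open>f\<close> against a Gaussian that concentrates at 0. Boundedness makes the autocorrelation
  finite everywhere and, by continuity of translations in the mean, continuous at 0, where it equals
  the squared norm.\<close>

lemma plancherel_bounded:
  fixes f :: "'a::euclidean_space \<Rightarrow> complex"
  assumes f: "integrable lborel f" and M: "\<And>x. cmod (f x) \<le> M"
  shows "(\<integral>\<^sup>+\<xi>. ennreal ((cmod (fourier_L1 f \<xi>))\<^sup>2) \<partial>lborel)
    = ennreal ((2 * pi) ^ DIM('a)) * (\<integral>\<^sup>+x. ennreal ((cmod (f x))\<^sup>2) \<partial>lborel)"
proof -
  have [measurable]: "f \<in> borel_measurable borel" using f by auto
  have M0: "0 \<le> M" using M[of 0] norm_ge_zero order_trans by blast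
  \<comment> \<open>The kernel of \<open>gaussian_regularised_energy\<close> in rescaled variables;
    its mass is the constant of the identity.\<close>
  define H where "H z = complex_of_real (pi powr (real DIM('a) / 2) * exp (- (norm z)\<^sup>2 / 4))" for z :: 'a
  have [measurable]: "H \<in> borel_measurable borel" unfolding H_def by measurable
  have H: "integrable lborel H" "(\<integral>z. H z \<partial>lborel) = complex_of_real ((2 * pi) ^ DIM('a))"
  proof -
    have "integrable lborel (\<lambda>z :: 'a. complex_of_real (exp (- (1 / 4) * (norm z)\<^sup>2)))"
      using gaussian_fourier_integrable[of "1 / 4" "0 :: 'a"] by simp
    then show "integrable lborel H" unfolding H_def of_real_mult by (intro integrable_mult_right) simp
    have "(\<integral>z. H z \<partial>lborel) = complex_of_real (pi powr (real DIM('a) / 2)) * (\<integral>z. complex_of_real (exp (- (1 / 4) * (norm z)\<^sup>2)) \<partial>(lborel :: 'a measure))"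
      unfolding H_def of_real_mult by (subst integral_mult_right_zero) simp
    also have "\<dots> = complex_of_real (pi powr (real DIM('a) / 2) * (pi / (1 / 4)) powr (real DIM('a) / 2))"
      using gaussian_fourier[of "1 / 4" "0 :: 'a"] by simp
    also have "pi powr (real DIM('a) / 2) * (pi / (1 / 4)) powr (real DIM('a) / 2) = (2 * pi) ^ DIM('a)"
    proof -
      have "pi powr (real DIM('a) / 2) * (pi / (1 / 4)) powr (real DIM('a) / 2) = ((2 * pi) powr 2) powr (real DIM('a) / 2)"
        by (subst powr_mult[symmetric]) (auto simp: power2_eq_square powr_numeral mult_ac)
      also have "\<dots> = (2 * pi) powr real DIM('a)" by (subst powr_powr) simp
      finally show ?thesis by (simp add: powr_realpow)
    qed
    finally show "(\<integral>z. H z \<partial>lborel) = complex_of_real ((2 * pi) ^ DIM('a))" .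
  qed
  \<comment> \<open>The autocorrelation of \<open>f\<close>.\<close>
  define A where "A z = (\<integral>x. f x * cnj (f (x + z)) \<partial>lborel)" for z
  have A_meas[measurable]: "A \<in> borel_measurable borel"
  proof -
    have "(\<lambda>z. \<integral>x. f x * cnj (f (x + z)) \<partial>lborel) \<in> borel_measurable lborel" by measurable
    then show ?thesis unfolding A_def[abs_def] by simp
  qed
  have intA: "integrable lborel (\<lambda>x. f x * cnj (f (x + z)))" for z
  proof (rule Bochner_Integration.integrable_bound[of _ "\<lambda>x. complex_of_real M * f x"])
    show "AE x in lborel. norm (f x * cnj (f (x + z))) \<le> norm (complex_of_real M * f x)"
      using M M0 by (auto simp: norm_mult mult.commute[of M] intro!: AE_I2 mult_left_mono)
  qed (use f in \<open>auto intro: integrable_mult_right\<close>)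
  define B where "B = (\<integral>x. cmod (f x) \<partial>lborel)"
  have A_bound: "cmod (A z) \<le> M * B" for z
  proof -
    have "cmod (A z) \<le> (\<integral>x. cmod (f x * cnj (f (x + z))) \<partial>lborel)" unfolding A_def by (rule integral_norm_bound)
    also have "\<dots> \<le> (\<integral>x. M * cmod (f x) \<partial>lborel)"
      using f integrable_norm[OF intA[of z]] M
      by (intro integral_mono) (auto simp: norm_mult mult.commute[of M] intro!: mult_left_mono)
    finally show ?thesis using f by (simp add: B_def)
  qed
  have A_cont: "(A \<longlongrightarrow> A 0) (at 0)"
  proof (rule Lim_null[THEN iffD2], rule tendsto_norm_zero_cancel, rule tendsto_sandwich[OF _ _ tendsto_const])
    show "((\<lambda>z. M * (\<integral>x. norm (f (x + z) - f x) \<partial>lborel)) \<longlongrightarrow> 0) (at 0)"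
      using translation_L1_continuous[OF f] by (rule tendsto_mult_right_zero)
    show "\<forall>\<^sub>F z in at 0. norm (A z - A 0) \<le> M * (\<integral>x. norm (f (x + z) - f x) \<partial>lborel)"
    proof (rule always_eventually, rule allI)
      fix z
      have ft: "integrable lborel (\<lambda>x. f (x + z))"
        using lborel_integrable_affine[of 1 f z] f by (simp add: add.commute)
      have "A z - A 0 = (\<integral>x. f x * cnj (f (x + z)) - f x * cnj (f (x + 0)) \<partial>lborel)"
        unfolding A_def by (rule Bochner_Integration.integral_diff[symmetric]) (rule intA)+
      then have "norm (A z - A 0) \<le> (\<integral>x. norm (f x * cnj (f (x + z)) - f x * cnj (f (x + 0))) \<partial>lborel)"
        by (metis integral_norm_bound)
      also have "\<dots> \<le> (\<integral>x. M * norm (f (x + z) - f x) \<partial>lborel)"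
      proof (rule integral_mono)
        show "integrable lborel (\<lambda>x. norm (f x * cnj (f (x + z)) - f x * cnj (f (x + 0))))"
          using intA[of z] intA[of 0] by (intro integrable_norm Bochner_Integration.integrable_diff)
        show "integrable lborel (\<lambda>x. M * norm (f (x + z) - f x))" using f ft by auto
        fix x
        have "f x * cnj (f (x + z)) - f x * cnj (f (x + 0)) = f x * cnj (f (x + z) - f x)"
          by (simp add: algebra_simps)
        then show "norm (f x * cnj (f (x + z)) - f x * cnj (f (x + 0))) \<le> M * norm (f (x + z) - f x)"
          using M[of x] by (simp add: norm_mult mult_right_mono del: complex_cnj_diff)
      qed
      also have "\<dots> = M * (\<integral>x. norm (f (x + z) - f x) \<partial>lborel)" by simp
      finally show "norm (A z - A 0) \<le> M * (\<integral>x. norm (f (x + z) - f x) \<partial>lborel)" .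
    qed
  qed auto
  \<comment> \<open>With \<epsilon> = c^2 and y = x + c * z the kernel no longer depends on
    \<open>c\<close>, which survives only in the argument of \<open>A\<close>.\<close>
  have reg: "(\<integral>\<xi>. complex_of_real ((cmod (fourier_L1 f \<xi>))\<^sup>2 * exp (- (c\<^sup>2) * (norm \<xi>)\<^sup>2)) \<partial>lborel)
      = (\<integral>z. H z * A (c *\<^sub>R z) \<partial>lborel)" if c: "c > 0" for c
  proof -
    let ?G = "\<lambda>x y. complex_of_real ((pi / c\<^sup>2) powr (real DIM('a) / 2) * exp (- (norm (x - y :: 'a))\<^sup>2 / (4 * c\<^sup>2)))"
    have scale: "c ^ DIM('a) * (pi / c\<^sup>2) powr (real DIM('a) / 2) = pi powr (real DIM('a) / 2)"
    proof -
      have "(c\<^sup>2) powr (real DIM('a) / 2) = (c powr 2) powr (real DIM('a) / 2)" using c by (simp add: powr_numeral)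
      also have "\<dots> = c ^ DIM('a)" using c by (subst powr_powr) (simp add: powr_realpow)
      finally show ?thesis using c by (simp add: powr_divide)
    qed
    have "(\<integral>\<xi>. complex_of_real ((cmod (fourier_L1 f \<xi>))\<^sup>2 * exp (- (c\<^sup>2) * (norm \<xi>)\<^sup>2)) \<partial>lborel)
      = (\<integral>x. f x * (\<integral>y. cnj (f y) * ?G x y \<partial>lborel) \<partial>lborel)"
      using c by (intro gaussian_regularised_energy f) auto
    also have "\<dots> = (\<integral>x. (\<integral>z. H z * (f x * cnj (f (x + c *\<^sub>R z))) \<partial>lborel) \<partial>lborel)"
    proof (rule Bochner_Integration.integral_cong[OF refl])
      fix x :: 'a
      have "(\<integral>y. cnj (f y) * ?G x y \<partial>lborel) = \<bar>c\<bar> ^ DIM('a) *\<^sub>R (\<integral>z. cnj (f (x + c *\<^sub>R z)) * ?G x (x + c *\<^sub>R z) \<partial>lborel)"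
        by (rule lborel_integral_affine) (use c in auto)
      also have "\<dots> = (\<integral>z. \<bar>c\<bar> ^ DIM('a) *\<^sub>R (cnj (f (x + c *\<^sub>R z)) * ?G x (x + c *\<^sub>R z)) \<partial>lborel)"
        by (rule integral_scaleR_right[symmetric])
      also have "\<dots> = (\<integral>z. H z * cnj (f (x + c *\<^sub>R z)) \<partial>lborel)"
      proof (rule Bochner_Integration.integral_cong[OF refl])
        fix z :: 'a
        have sc: "\<bar>c\<bar> ^ DIM('a) * ((pi / c\<^sup>2) powr (real DIM('a) / 2) * exp (- (norm (x - (x + c *\<^sub>R z)))\<^sup>2 / (4 * c\<^sup>2)))
          = pi powr (real DIM('a) / 2) * exp (- (norm z)\<^sup>2 / 4)"
          using c by (simp add: scale[symmetric] power_mult_distrib)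
        have "\<bar>c\<bar> ^ DIM('a) *\<^sub>R (cnj (f (x + c *\<^sub>R z)) * ?G x (x + c *\<^sub>R z))
           = complex_of_real (\<bar>c\<bar> ^ DIM('a) * ((pi / c\<^sup>2) powr (real DIM('a) / 2) * exp (- (norm (x - (x + c *\<^sub>R z)))\<^sup>2 / (4 * c\<^sup>2)))) * cnj (f (x + c *\<^sub>R z))"
          by (simp only: scaleR_conv_of_real of_real_mult mult_ac)
        then show "\<bar>c\<bar> ^ DIM('a) *\<^sub>R (cnj (f (x + c *\<^sub>R z)) * ?G x (x + c *\<^sub>R z)) = H z * cnj (f (x + c *\<^sub>R z))"
          unfolding sc H_def .
      qed
      finally show "f x * (\<integral>y. cnj (f y) * ?G x y \<partial>lborel) = (\<integral>z. H z * (f x * cnj (f (x + c *\<^sub>R z))) \<partial>lborel)"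
        by (subst mult.left_commute) (simp only: integral_mult_right_zero)
    qed
    also have "\<dots> = (\<integral>z. (\<integral>x. H z * (f x * cnj (f (x + c *\<^sub>R z))) \<partial>lborel) \<partial>lborel)"
    proof (rule lborel_pair.Fubini_integral)
      show "integrable (lborel \<Otimes>\<^sub>M lborel) (\<lambda>(z, x). H z * (f x * cnj (f (x + c *\<^sub>R z))))"
      proof (rule Bochner_Integration.integrable_bound)
        show "integrable (lborel \<Otimes>\<^sub>M lborel) (\<lambda>(z, x). H z * (complex_of_real M * f x))"
          by (rule integrable_pair_mult) (auto intro!: sigma_finite_lborel H f integrable_mult_right)
        show "AE p in lborel \<Otimes>\<^sub>M lborel. norm (case p of (z, x) \<Rightarrow> H z * (f x * cnj (f (x + c *\<^sub>R z)))) \<le> norm (case p of (z, x) \<Rightarrow> H z * (complex_of_real M * f x))"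
          using M M0 by (auto intro!: AE_I2 mult_left_mono mult_right_mono simp: norm_mult mult.commute[of M])
      qed measurable
    qed
    finally show ?thesis by (simp add: A_def)
  qed
  have lim: "(\<lambda>n. \<integral>z. H z * A (inverse (real (Suc n)) *\<^sub>R z) \<partial>lborel) \<longlonglongrightarrow> (\<integral>z. H z * A 0 \<partial>lborel)"
  proof (rule integral_dominated_convergence[where w = "\<lambda>z. norm (H z) * (M * B)"])
    show "integrable lborel (\<lambda>z. norm (H z) * (M * B))" using H by auto
    show "AE z in lborel. norm (H z * A (inverse (real (Suc n)) *\<^sub>R z)) \<le> norm (H z) * (M * B)" for n
      using A_bound by (auto simp: norm_mult intro!: mult_left_mono)
    show "AE z in lborel. (\<lambda>n. H z * A (inverse (real (Suc n)) *\<^sub>R z)) \<longlonglongrightarrow> H z * A 0"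
    proof (rule AE_I2)
      fix z :: 'a
      have "(\<lambda>n. inverse (real (Suc n)) *\<^sub>R z) \<longlonglongrightarrow> 0 *\<^sub>R z"
        by (intro tendsto_scaleR LIMSEQ_inverse_real_of_nat tendsto_const)
      then have "(\<lambda>n. A (inverse (real (Suc n)) *\<^sub>R z)) \<longlonglongrightarrow> A 0"
        using A_cont by (intro isCont_tendsto_compose[of 0 A]) (auto simp: isCont_def)
      then show "(\<lambda>n. H z * A (inverse (real (Suc n)) *\<^sub>R z)) \<longlonglongrightarrow> H z * A 0" by (intro tendsto_intros)
    qed
  qed measurable
  let ?u = "\<lambda>n \<xi>. (cmod (fourier_L1 f \<xi>))\<^sup>2 * exp (- ((inverse (real (Suc n)))\<^sup>2) * (norm \<xi>)\<^sup>2)"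
  define S where "S = (\<integral>x. (cmod (f x))\<^sup>2 \<partial>lborel)"
  have A0: "A 0 = complex_of_real S"
    unfolding A_def S_def by (simp add: complex_norm_square[symmetric] flip: of_real_power)
  have "(\<lambda>n. \<integral>\<xi>. complex_of_real (?u n \<xi>) \<partial>lborel) \<longlonglongrightarrow> complex_of_real ((2 * pi) ^ DIM('a) * S)"
    using lim H A0 by (subst reg) auto
  then have "(\<lambda>n. complex_of_real (\<integral>\<xi>. ?u n \<xi> \<partial>lborel)) \<longlonglongrightarrow> complex_of_real ((2 * pi) ^ DIM('a) * S)"
    by (simp only: integral_complex_of_real)
  then have "(\<lambda>n. \<integral>\<xi>. ?u n \<xi> \<partial>lborel) \<longlonglongrightarrow> (2 * pi) ^ DIM('a) * S"
    by (simp only: tendsto_of_real_iff)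
  then have lim1: "(\<lambda>n. ennreal (\<integral>\<xi>. ?u n \<xi> \<partial>lborel)) \<longlonglongrightarrow> ennreal ((2 * pi) ^ DIM('a) * S)"
    by (rule tendsto_ennrealI)
  have int_u: "integrable lborel (?u n)" for n
  proof (rule Bochner_Integration.integrable_bound)
    show "integrable lborel (\<lambda>\<xi> :: 'a. complex_of_real (exp (- ((inverse (real (Suc n)))\<^sup>2) * (norm \<xi>)\<^sup>2)) * complex_of_real (B\<^sup>2))"
      using gaussian_fourier_integrable[of "(inverse (real (Suc n)))\<^sup>2" "0 :: 'a"] by (intro integrable_mult_left) simp
    show "AE \<xi> in lborel. norm (?u n \<xi>) \<le> norm (complex_of_real (exp (- ((inverse (real (Suc n)))\<^sup>2) * (norm \<xi>)\<^sup>2)) * complex_of_real (B\<^sup>2))"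
      using norm_fourier_L1_le[OF f] by (auto simp: norm_mult norm_power B_def mult.commute intro!: AE_I2 mult_left_mono power_mono)
  qed measurable
  \<comment> \<open>Monotone convergence as the damping is removed: that the transform is square
    integrable comes out as a result.\<close>
  have "(\<lambda>n. \<integral>\<^sup>+\<xi>. ennreal (?u n \<xi>) \<partial>lborel) \<longlonglongrightarrow> (\<integral>\<^sup>+\<xi>. ennreal ((cmod (fourier_L1 f \<xi>))\<^sup>2) \<partial>lborel)"
  proof (rule nn_integral_LIMSEQ)
    show "incseq (\<lambda>n \<xi>. ennreal (?u n \<xi>))"
      by (auto simp: incseq_def le_fun_def field_simps intro!: ennreal_leI mult_left_mono divide_left_mono power_mono)
    fix \<xi> :: 'a
    have "(\<lambda>n. ?u n \<xi>) \<longlonglongrightarrow> (cmod (fourier_L1 f \<xi>))\<^sup>2 * exp (- (0\<^sup>2) * (norm \<xi>)\<^sup>2)"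
      by (intro tendsto_intros LIMSEQ_inverse_real_of_nat)
    then show "(\<lambda>n. ennreal (?u n \<xi>)) \<longlonglongrightarrow> ennreal ((cmod (fourier_L1 f \<xi>))\<^sup>2)"
      by (intro tendsto_ennrealI) simp
  qed measurable
  moreover have "(\<integral>\<^sup>+\<xi>. ennreal (?u n \<xi>) \<partial>lborel) = ennreal (\<integral>\<xi>. ?u n \<xi> \<partial>lborel)" for n
    by (rule nn_integral_eq_integral[OF int_u]) auto
  ultimately have eq: "(\<integral>\<^sup>+\<xi>. ennreal ((cmod (fourier_L1 f \<xi>))\<^sup>2) \<partial>lborel) = ennreal ((2 * pi) ^ DIM('a) * S)"
    using lim1 LIMSEQ_unique by simp
  have "integrable lborel (\<lambda>x. (cmod (f x))\<^sup>2)"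
  proof -
    have "integrable lborel (\<lambda>x. cmod (f x * cnj (f (x + 0))))" using intA[of 0] by (rule integrable_norm)
    then show ?thesis by (simp add: norm_mult power2_eq_square)
  qed
  then have "(\<integral>\<^sup>+x. ennreal ((cmod (f x))\<^sup>2) \<partial>lborel) = ennreal S"
    unfolding S_def by (intro nn_integral_eq_integral) auto
  then show ?thesis using eq by (simp add: ennreal_mult S_def)
qed

section \<open>Square integrable functions and convergence in mean\<close>

lemma lebesgue_complex_borel_representative:
  fixes f :: "'a::euclidean_space \<Rightarrow> complex"
  assumes f[measurable]: "f \<in> borel_measurable lebesgue"
  obtains g where "g \<in> borel_measurable borel" "AE x in lebesgue. f x = g x"
proof -
  have "(\<lambda>x. Re (f x)) \<in> borel_measurable lebesgue" "(\<lambda>x. Im (f x)) \<in> borel_measurable lebesgue"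
    by measurable
  from this[THEN completion_ex_borel_measurable_real] obtain a b
    where [measurable]: "a \<in> borel_measurable borel" "b \<in> borel_measurable borel"
      and ae: "AE x in lborel. Re (f x) = a x" "AE x in lborel. Im (f x) = b x"
    by auto
  show thesis
  proof
    show "(\<lambda>x. Complex (a x) (b x)) \<in> borel_measurable borel"
      unfolding Complex_eq by measurable
    have "AE x in lborel. f x = Complex (a x) (b x)"
      using ae by eventually_elim (simp add: complex_eq_iff)
    then show "AE x in lebesgue. f x = Complex (a x) (b x)"
      by (rule AE_completion)
  qed
qed

lemma square_integrable_measurable [measurable_dest]:
  "square_integrable f \<Longrightarrow> f \<in> borel_measurable lebesgue"
  by (simp add: square_integrable_def)

lemma square_integrable_iff_nn_integral:
  "square_integrable f \<longleftrightarrow> f \<in> borel_measurable lebesgue \<and> sq_ennorm f < \<infinity>"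
  unfolding square_integrable_def by (auto simp: integrable_iff_bounded)

lemma square_integrable_nn_integral:
  "square_integrable f \<Longrightarrow> sq_ennorm f = ennreal (sq_norm f)"
  unfolding square_integrable_def by (intro nn_integral_eq_integral) auto

lemma norm_add_square_le:
  fixes a b :: "'b::real_normed_vector"
  shows "(norm (a + b))\<^sup>2 \<le> 2 * (norm a)\<^sup>2 + 2 * (norm b)\<^sup>2"
proof -
  have "(norm (a + b))\<^sup>2 \<le> (norm a + norm b)\<^sup>2"
    by (intro power_mono norm_triangle_ineq) auto
  also have "\<dots> \<le> 2 * (norm a)\<^sup>2 + 2 * (norm b)\<^sup>2"
    using zero_le_power2[of "norm a - norm b"] unfolding power2_diff power2_sum by linarith
  finally show ?thesis .
qed

lemma square_integrable_bound:
  assumes g: "square_integrable g" and [measurable]: "f \<in> borel_measurable lebesgue"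
    and le: "AE x in lebesgue. cmod (f x) \<le> cmod (g x)"
  shows "square_integrable f"
  unfolding square_integrable_def
proof
  show "integrable lebesgue (\<lambda>x. (cmod (f x))\<^sup>2)"
  proof (rule Bochner_Integration.integrable_bound)
    show "integrable lebesgue (\<lambda>x. (cmod (g x))\<^sup>2)" using g by (simp add: square_integrable_def)
    show "AE x in lebesgue. norm ((cmod (f x))\<^sup>2) \<le> norm ((cmod (g x))\<^sup>2)"
      using le by eventually_elim (auto intro: power_mono)
  qed measurable
qed measurable

lemma square_integrable_add:
  assumes f: "square_integrable f" and g: "square_integrable g"
  shows "square_integrable (\<lambda>x. f x + g x)"
  unfolding square_integrable_def
proof
  have [measurable]: "f \<in> borel_measurable lebesgue" "g \<in> borel_measurable lebesgue" using f g by auto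
  show "integrable lebesgue (\<lambda>x. (cmod (f x + g x))\<^sup>2)"
  proof (rule Bochner_Integration.integrable_bound)
    show "integrable lebesgue (\<lambda>x. 2 * (cmod (f x))\<^sup>2 + 2 * (cmod (g x))\<^sup>2)"
      using f g by (simp add: square_integrable_def)
    show "AE x in lebesgue. norm ((cmod (f x + g x))\<^sup>2) \<le> norm (2 * (cmod (f x))\<^sup>2 + 2 * (cmod (g x))\<^sup>2)"
      using norm_add_square_le[of "f _" "g _"] by simp
  qed measurable
qed (use f g in measurable)

lemma square_integrable_cmult:
  assumes f: "square_integrable f"
  shows "square_integrable (\<lambda>x. c * f x)"
  using assms unfolding square_integrable_def by (auto simp: norm_mult power_mult_distrib)

lemma square_integrable_diff:
  assumes f: "square_integrable f" and g: "square_integrable g"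
  shows "square_integrable (\<lambda>x. f x - g x)"
  using square_integrable_add[OF f square_integrable_cmult[OF g, of "-1"]] by simp

lemma square_integrable_mult_integrable:
  assumes f: "square_integrable f" and g: "square_integrable g"
  shows "integrable lebesgue (\<lambda>x. f x * g x)"
proof (rule Bochner_Integration.integrable_bound)
  have [measurable]: "f \<in> borel_measurable lebesgue" "g \<in> borel_measurable lebesgue" using f g by auto
  show "integrable lebesgue (\<lambda>x. (cmod (f x))\<^sup>2 + (cmod (g x))\<^sup>2)"
    using f g by (simp add: square_integrable_def)
  have "cmod (f x) * cmod (g x) \<le> (cmod (f x))\<^sup>2 + (cmod (g x))\<^sup>2" for x
    using sum_squares_bound[of "cmod (f x)" "cmod (g x)", unfolded mult.assoc]
      mult_nonneg_nonneg[OF norm_ge_zero norm_ge_zero, of "f x" "g x"] by linarith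
  then show "AE x in lebesgue. norm (f x * g x) \<le> norm ((cmod (f x))\<^sup>2 + (cmod (g x))\<^sup>2)"
    by (auto simp: norm_mult)
  show "(\<lambda>x. f x * g x) \<in> borel_measurable lebesgue" by measurable
qed

lemma borel_imp_lebesgue_measurable: "f \<in> borel_measurable borel \<Longrightarrow> f \<in> borel_measurable lebesgue"
  by (simp add: measurable_completion)

text \<open>Lower semicontinuity of the squared norm. It carries a bound for differences of
  approximants over to the distance from their pointwise limit.\<close>

lemma fatou_square:
  fixes G :: "'a \<Rightarrow> complex"
  assumes [measurable]: "\<And>n. g n \<in> borel_measurable M"
    and lim: "AE x in M. (\<lambda>n. g n x) \<longlonglongrightarrow> G x"
    and le: "eventually (\<lambda>n. (\<integral>\<^sup>+x. ennreal ((cmod (g n x))\<^sup>2) \<partial>M) \<le> C) sequentially"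
  shows "(\<integral>\<^sup>+x. ennreal ((cmod (G x))\<^sup>2) \<partial>M) \<le> C"
proof -
  have "(\<integral>\<^sup>+x. ennreal ((cmod (G x))\<^sup>2) \<partial>M) = (\<integral>\<^sup>+x. liminf (\<lambda>n. ennreal ((cmod (g n x))\<^sup>2)) \<partial>M)"
  proof (rule nn_integral_cong_AE)
    show "AE x in M. ennreal ((cmod (G x))\<^sup>2) = liminf (\<lambda>n. ennreal ((cmod (g n x))\<^sup>2))"
      using lim
    proof eventually_elim
      case (elim x)
      have "(\<lambda>n. ennreal ((cmod (g n x))\<^sup>2)) \<longlonglongrightarrow> ennreal ((cmod (G x))\<^sup>2)"
        by (intro tendsto_ennrealI tendsto_intros elim)
      then show ?case by (rule lim_imp_Liminf[OF sequentially_bot, symmetric])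
    qed
  qed
  also have "\<dots> \<le> liminf (\<lambda>n. \<integral>\<^sup>+x. ennreal ((cmod (g n x))\<^sup>2) \<partial>M)"
    by (rule nn_integral_liminf) measurable
  also have "\<dots> \<le> limsup (\<lambda>n. \<integral>\<^sup>+x. ennreal ((cmod (g n x))\<^sup>2) \<partial>M)"
    by (rule Liminf_le_Limsup) simp
  also have "\<dots> \<le> C" by (rule Limsup_bounded[OF le])
  finally show ?thesis .
qed

text \<open>Pointwise, Young's inequality with a free weight \<delta> bounds the difference of the
  squares by (1 + 1 / \<delta>) times the squared distance plus \<delta> times the square of the
  limit. After integration the distance tends to 0 for fixed \<delta>, and \<delta> was
  arbitrary.\<close>

lemma square_integral_tendsto:
  assumes g: "square_integrable g" and u: "\<And>r. square_integrable (u r)"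
    and lim: "((\<lambda>r. sq_ennorm (\<lambda>x. u r x - g x)) \<longlongrightarrow> 0) F"
  shows "((\<lambda>r. sq_norm (u r)) \<longlongrightarrow> sq_norm g) F"
proof -
  define b where "b r = sq_norm (\<lambda>x. u r x - g x)" for r
  have sq: "square_integrable (\<lambda>x. u r x - g x)" for r by (rule square_integrable_diff[OF u g])
  have "((\<lambda>r. ennreal (b r)) \<longlongrightarrow> ennreal 0) F"
    using lim unfolding b_def square_integrable_nn_integral[OF sq] by simp
  moreover have b0: "b r \<ge> 0" for r unfolding b_def by simp
  ultimately have b: "(b \<longlongrightarrow> 0) F" by (subst (asm) tendsto_ennreal_iff) auto
  define S where "S = sq_norm g"
  have S0: "S \<ge> 0" by (simp add: S_def)
  have key: "\<bar>sq_norm (u r) - S\<bar> \<le> (1 + 1 / \<delta>) * b r + \<delta> * S" if \<delta>: "\<delta> > 0" for \<delta> r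
  proof -
    have pw: "\<bar>(cmod a)\<^sup>2 - (cmod c)\<^sup>2\<bar> \<le> (1 + 1 / \<delta>) * (cmod (a - c))\<^sup>2 + \<delta> * (cmod c)\<^sup>2" for a c
    proof -
      define p q where "p = cmod (a - c)" and "q = cmod c"
      have pq: "0 \<le> p" "0 \<le> q" "\<bar>cmod a - q\<bar> \<le> p" unfolding p_def q_def by (auto simp: norm_triangle_ineq3)
      have "\<bar>(cmod a)\<^sup>2 - q\<^sup>2\<bar> = \<bar>cmod a - q\<bar> * (cmod a + q)"
        using pq by (simp add: power2_eq_square square_diff_square_factored abs_mult)
      also have "\<dots> \<le> p * (p + 2 * q)" using pq by (intro mult_mono) auto
      also have "\<dots> = p\<^sup>2 + 2 * p * q" by (simp add: power2_eq_square algebra_simps)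
      also have "2 * p * q \<le> 1 / \<delta> * p\<^sup>2 + \<delta> * q\<^sup>2"
        using sum_squares_bound[of "p / sqrt \<delta>" "q * sqrt \<delta>"] \<delta>
        by (simp add: power_divide power_mult_distrib mult.commute)
      finally show ?thesis by (simp add: p_def q_def algebra_simps)
    qed
    have "\<bar>sq_norm (u r) - S\<bar> = \<bar>\<integral>x. (cmod (u r x))\<^sup>2 - (cmod (g x))\<^sup>2 \<partial>lebesgue\<bar>"
      unfolding S_def using g u[of r] by (simp add: square_integrable_def)
    also have "\<dots> \<le> (\<integral>x. \<bar>(cmod (u r x))\<^sup>2 - (cmod (g x))\<^sup>2\<bar> \<partial>lebesgue)" by (rule integral_abs_bound)
    also have "\<dots> \<le> (\<integral>x. (1 + 1 / \<delta>) * (cmod (u r x - g x))\<^sup>2 + \<delta> * (cmod (g x))\<^sup>2 \<partial>lebesgue)"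
      using g u[of r] sq[of r] by (intro integral_mono pw) (auto simp: square_integrable_def)
    also have "\<dots> = (1 + 1 / \<delta>) * b r + \<delta> * S"
      unfolding b_def S_def using g u[of r] sq[of r] by (simp add: square_integrable_def)
    finally show ?thesis .
  qed
  show ?thesis
  proof (rule tendstoI)
    fix e :: real assume e: "e > 0"
    \<comment> \<open>Half of \<open>e\<close> is reserved for \<delta> * S; the summand 1 covers
      the case that \<open>S\<close> is 0.\<close>
    define \<delta> where "\<delta> = e / (2 * (S + 1))"
    have \<delta>: "\<delta> > 0" using e S0 by (simp add: \<delta>_def)
    have "\<delta> * S < e / 2"
    proof -
      have "\<delta> * S < \<delta> * (S + 1)" using \<delta> by simp
      also have "\<dots> = e / 2" using S0 by (simp add: \<delta>_def field_simps)
      finally show ?thesis .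
    qed
    have "((\<lambda>r. (1 + 1 / \<delta>) * b r) \<longlongrightarrow> 0) F" using b by (rule tendsto_mult_right_zero)
    then have "\<forall>\<^sub>F r in F. (1 + 1 / \<delta>) * b r < e / 2" using e by (intro order_tendstoD) auto
    then show "\<forall>\<^sub>F r in F. dist (sq_norm (u r)) (sq_norm g) < e"
      unfolding S_def[symmetric] dist_real_def
    proof (elim eventually_mono)
      fix r assume "(1 + 1 / \<delta>) * b r < e / 2"
      with \<open>\<delta> * S < e / 2\<close> key[OF \<delta>, of r] show "\<bar>sq_norm (u r) - S\<bar> < e" by linarith
    qed
  qed
qed

section \<open>Plancherel for functions that are both integrable and square integrable\<close>

lemma fourier_kernel_integrable_lebesgue:
  fixes f :: "'a::euclidean_space \<Rightarrow> complex"
  assumes f: "integrable lebesgue f"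
  shows "integrable lebesgue (\<lambda>x. fourier_char \<xi> x * f x)"
proof (rule Bochner_Integration.integrable_bound[OF f])
  have "(\<lambda>x. fourier_char \<xi> x) \<in> borel_measurable lebesgue"
    by (rule borel_imp_lebesgue_measurable) measurable
  then show "(\<lambda>x. fourier_char \<xi> x * f x) \<in> borel_measurable lebesgue"
    using f by (intro borel_measurable_times) auto
qed (simp add: norm_mult)

lemma fourier_L1_diff:
  assumes "integrable lebesgue f" "integrable lebesgue g"
  shows "fourier_L1 (\<lambda>x. f x - g x) \<xi> = fourier_L1 f \<xi> - fourier_L1 g \<xi>"
  unfolding fourier_L1_def right_diff_distrib
  by (rule Bochner_Integration.integral_diff) (intro fourier_kernel_integrable_lebesgue assms)+

lemma fourier_L1_cong_AE:
  assumes f: "integrable lebesgue f" and g: "integrable lebesgue g" and ae: "AE x in lebesgue. f x = g x"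
  shows "fourier_L1 f = fourier_L1 g"
proof (rule ext, unfold fourier_L1_def, rule integral_cong_AE)
  fix \<xi>
  show "AE x in lebesgue. fourier_char \<xi> x * f x = fourier_char \<xi> x * g x"
    using ae by eventually_elim simp
qed (use fourier_kernel_integrable_lebesgue[OF f] fourier_kernel_integrable_lebesgue[OF g] in auto)

text \<open>Cutting off large values gives bounded functions that approximate \<open>f\<close> in
  both means. Their transforms converge pointwise by integrability and, by Plancherel for bounded
  functions, in square mean, so the norm identity passes to the limit.\<close>

lemma plancherel_borel:
  fixes f :: "'a::euclidean_space \<Rightarrow> complex"
  assumes f: "integrable lborel f" and f2: "square_integrable f"
  shows "square_integrable (fourier_L1 f)"
    and "sq_norm (fourier_L1 f) = (2 * pi) ^ DIM('a) * sq_norm f"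
proof -
  let ?K = "(2 * pi) ^ DIM('a)"
  have fm[measurable]: "f \<in> borel_measurable borel" using f by auto
  have f2': "integrable lborel (\<lambda>x. (cmod (f x))\<^sup>2)"
    using f2 unfolding square_integrable_def by (subst integrable_completion[symmetric]) auto
  \<comment> \<open>The cut is made in the values and not in space, because it is boundedness that
    \<open>plancherel_bounded\<close> asks for.\<close>
  define fn where "fn n x = (if cmod (f x) \<le> real n then f x else 0)" for n x
  have [measurable]: "fn n \<in> borel_measurable borel" for n unfolding fn_def by measurable
  have fn_le: "cmod (fn n x) \<le> cmod (f x)" for n x by (simp add: fn_def)
  have fn_diff_le: "cmod (fn n x - fn m x) \<le> cmod (f x - fn m x)" if "m \<le> n" for n m x
    using that by (auto simp: fn_def)
  have int_fn: "integrable lborel (fn n)" for n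
    by (rule Bochner_Integration.integrable_bound[OF f]) (auto simp: fn_le)
  have fn_ev: "\<forall>\<^sub>F n in sequentially. fn n x = f x" for x
  proof -
    obtain N :: nat where "cmod (f x) \<le> real N" using real_arch_simple by blast
    then show ?thesis unfolding eventually_sequentially fn_def by (intro exI[of _ N]) auto
  qed
  have Flim: "(\<lambda>n. fourier_L1 (fn n) \<xi>) \<longlonglongrightarrow> fourier_L1 f \<xi>" for \<xi>
    unfolding fourier_L1_borel[OF fm] fourier_L1_borel[OF \<open>\<And>n. fn n \<in> borel_measurable borel\<close>]
  proof (rule integral_dominated_convergence[where w = "\<lambda>x. cmod (f x)"])
    show "AE x in lborel. (\<lambda>n. fourier_char \<xi> x * fn n x) \<longlonglongrightarrow> fourier_char \<xi> x * f x"
      using fn_ev by (intro AE_I2 tendsto_intros tendsto_eventually)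
    show "AE x in lborel. norm (fourier_char \<xi> x * fn n x) \<le> cmod (f x)" for n
      using fn_le by (auto simp: norm_mult)
  qed (use f in auto)
  define T where "T m = (\<integral>\<^sup>+x. ennreal ((cmod (f x - fn m x))\<^sup>2) \<partial>lborel)" for m
  have T: "T \<longlonglongrightarrow> 0"
  proof -
    have "(\<lambda>m. \<integral>\<^sup>+x. ennreal ((cmod (f x - fn m x))\<^sup>2) \<partial>lborel) \<longlonglongrightarrow> (\<integral>\<^sup>+x. 0 \<partial>(lborel :: 'a measure))"
    proof (rule nn_integral_dominated_convergence[where w = "\<lambda>x. ennreal ((cmod (f x))\<^sup>2)"])
      show "AE x in lborel. (\<lambda>m. ennreal ((cmod (f x - fn m x))\<^sup>2)) \<longlonglongrightarrow> 0"
      proof (rule AE_I2)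
        fix x
        have "(\<lambda>m. (cmod (f x - fn m x))\<^sup>2) \<longlonglongrightarrow> 0"
          using fn_ev[of x] by (intro tendsto_eventually) (auto elim: eventually_mono)
        then show "(\<lambda>m. ennreal ((cmod (f x - fn m x))\<^sup>2)) \<longlonglongrightarrow> 0"
          using tendsto_ennrealI by fastforce
      qed
      show "AE x in lborel. ennreal ((cmod (f x - fn m x))\<^sup>2) \<le> ennreal ((cmod (f x))\<^sup>2)" for m
        by (auto intro!: AE_I2 ennreal_leI power_mono simp: fn_def)
      show "(\<integral>\<^sup>+x. ennreal ((cmod (f x))\<^sup>2) \<partial>lborel) < \<infinity>"
        using f2' by (auto simp: integrable_iff_bounded)
    qed measurable
    then show ?thesis by (simp add: T_def[abs_def])
  qed
  have fl: "integrable lebesgue f" "integrable lebesgue (fn n)" for n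
    using f int_fn by (auto simp: integrable_completion)
  \<comment> \<open>For m \<le> n the difference of two cut-offs is bounded by \<open>n\<close>, so
    Plancherel holds for it; Fatou then lets n tend to infinity.\<close>
  have FT: "(\<integral>\<^sup>+\<xi>. ennreal ((cmod (fourier_L1 f \<xi> - fourier_L1 (fn m) \<xi>))\<^sup>2) \<partial>lborel) \<le> ennreal ?K * T m" for m
  proof (rule fatou_square)
    show "(\<lambda>\<xi>. fourier_L1 (fn n) \<xi> - fourier_L1 (fn m) \<xi>) \<in> borel_measurable lborel" for n by simp
    show "AE \<xi> in lborel. (\<lambda>n. fourier_L1 (fn n) \<xi> - fourier_L1 (fn m) \<xi>) \<longlonglongrightarrow> fourier_L1 f \<xi> - fourier_L1 (fn m) \<xi>"
      by (intro AE_I2 tendsto_intros Flim)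
    show "\<forall>\<^sub>F n in sequentially. (\<integral>\<^sup>+\<xi>. ennreal ((cmod (fourier_L1 (fn n) \<xi> - fourier_L1 (fn m) \<xi>))\<^sup>2) \<partial>lborel) \<le> ennreal ?K * T m"
      using eventually_ge_at_top[of m]
    proof eventually_elim
      case (elim n)
      have "(\<integral>\<^sup>+\<xi>. ennreal ((cmod (fourier_L1 (fn n) \<xi> - fourier_L1 (fn m) \<xi>))\<^sup>2) \<partial>lborel)
         = (\<integral>\<^sup>+\<xi>. ennreal ((cmod (fourier_L1 (\<lambda>x. fn n x - fn m x) \<xi>))\<^sup>2) \<partial>lborel)"
        using fl by (simp add: fourier_L1_diff)
      also have "\<dots> = ennreal ?K * (\<integral>\<^sup>+x. ennreal ((cmod (fn n x - fn m x))\<^sup>2) \<partial>lborel)"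
      proof (rule plancherel_bounded)
        show "integrable lborel (\<lambda>x. fn n x - fn m x)" using int_fn by auto
        show "cmod (fn n x - fn m x) \<le> real n" for x using elim by (auto simp: fn_def)
      qed
      also have "\<dots> \<le> ennreal ?K * T m"
        unfolding T_def by (intro mult_left_mono nn_integral_mono ennreal_leI power_mono fn_diff_le elim) auto
      finally show ?case .
    qed
  qed
  have sqfn: "square_integrable (fn n)" for n
    using f2 by (rule square_integrable_bound) (auto simp: fn_le borel_imp_lebesgue_measurable)
  have Pl: "sq_ennorm (fourier_L1 (fn n)) = ennreal ?K * sq_ennorm (fn n)" for n
    unfolding nn_integral_completion by (rule plancherel_bounded[OF int_fn, where M = n]) (simp add: fn_def)
  have sqFn: "square_integrable (fourier_L1 (fn n))" for n
    unfolding square_integrable_iff_nn_integral Pl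
    using sqfn[of n] by (auto simp: square_integrable_iff_nn_integral ennreal_mult_less_top borel_imp_lebesgue_measurable)
  have Plr: "sq_norm (fourier_L1 (fn n)) = ?K * sq_norm (fn n)" for n
    using Pl[of n] unfolding square_integrable_nn_integral[OF sqfn] square_integrable_nn_integral[OF sqFn]
    by (simp add: ennreal_mult[symmetric])
  have KT: "(\<lambda>m. ennreal ?K * T m) \<longlonglongrightarrow> 0"
    using ennreal_tendsto_cmult[of "ennreal ?K", OF _ T] by simp
  have FT0: "(\<lambda>m. sq_ennorm (\<lambda>\<xi>. fourier_L1 (fn m) \<xi> - fourier_L1 f \<xi>)) \<longlonglongrightarrow> 0"
    unfolding nn_integral_completion
    by (rule tendsto_sandwich[OF _ _ tendsto_const KT])
      (use FT in \<open>auto simp: norm_minus_commute\<close>)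
  \<comment> \<open>A single cut-off at finite distance suffices: the transform of \<open>f\<close>
    is then a sum of two square integrable functions.\<close>
  have "\<forall>\<^sub>F m in sequentially. ennreal ?K * T m < 1" using KT by (rule order_tendstoD) simp
  then obtain m where "ennreal ?K * T m < 1" by (auto simp: eventually_sequentially)
  with FT[of m] have "sq_ennorm (\<lambda>\<xi>. fourier_L1 f \<xi> - fourier_L1 (fn m) \<xi>) < 1"
    unfolding nn_integral_completion by (rule le_less_trans)
  also have "(1 :: ennreal) < \<infinity>" by simp
  finally have "sq_ennorm (\<lambda>\<xi>. fourier_L1 f \<xi> - fourier_L1 (fn m) \<xi>) < \<infinity>" .
  then have "square_integrable (\<lambda>\<xi>. fourier_L1 f \<xi> - fourier_L1 (fn m) \<xi>)"
    by (auto simp: square_integrable_iff_nn_integral borel_imp_lebesgue_measurable)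
  from square_integrable_add[OF this sqFn[of m]] show sqF: "square_integrable (fourier_L1 f)" by simp
  have "(\<lambda>n. sq_norm (fourier_L1 (fn n))) \<longlonglongrightarrow> sq_norm (fourier_L1 f)"
    by (rule square_integral_tendsto[OF sqF sqFn FT0])
  moreover have "(\<lambda>n. sq_norm (fn n)) \<longlonglongrightarrow> sq_norm f"
    by (rule square_integral_tendsto[OF f2 sqfn])
      (use T in \<open>simp add: nn_integral_completion T_def[abs_def] norm_minus_commute\<close>)
  then have "(\<lambda>n. ?K * sq_norm (fn n)) \<longlonglongrightarrow> ?K * sq_norm f"
    by (rule tendsto_mult_left)
  ultimately show "sq_norm (fourier_L1 f) = ?K * sq_norm f"
    unfolding Plr by (rule LIMSEQ_unique)
qed

lemma plancherel_L1:
  fixes f :: "'a::euclidean_space \<Rightarrow> complex"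
  assumes f: "integrable lebesgue f" and f2: "square_integrable f"
  shows "square_integrable (fourier_L1 f)"
    and "sq_norm (fourier_L1 f) = (2 * pi) ^ DIM('a) * sq_norm f"
proof -
  have [measurable]: "f \<in> borel_measurable lebesgue" using f by auto
  obtain g where g[measurable]: "g \<in> borel_measurable borel" and ae: "AE x in lebesgue. f x = g x"
    using lebesgue_complex_borel_representative[of f] by auto
  have [measurable]: "g \<in> borel_measurable lebesgue" by (rule borel_imp_lebesgue_measurable[OF g])
  have ig: "integrable lebesgue g" using integrable_cong_AE[of f lebesgue g] f ae by auto
  then have ig': "integrable lborel g" by (simp add: integrable_completion)
  have sg: "square_integrable g"
    using f2 by (rule square_integrable_bound) (use ae in \<open>auto elim: eventually_mono\<close>)
  have eq: "fourier_L1 f = fourier_L1 g" by (rule fourier_L1_cong_AE[OF f ig ae])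
  have "sq_norm f = sq_norm g"
    by (rule integral_cong_AE) (use ae in \<open>auto elim: eventually_mono\<close>)
  then show "square_integrable (fourier_L1 f)"
     "sq_norm (fourier_L1 f) = (2 * pi) ^ DIM('a) * sq_norm f"
    using plancherel_borel[OF ig' sg] eq by auto
qed

subsection \<open>The Fourier transform of square integrable functions\<close>

text \<open>The core of the Riesz-Fischer theorem. The weights 2^k are small enough against (1 /
  4)^k for the weighted sum of squared increments to have a finite integral, and large enough for
  its finiteness at a point to make the increments decay like 2^(- k / 2), hence be
  summable.\<close>

lemma square_integral_AE_convergent:
  fixes u :: "nat \<Rightarrow> 'a::euclidean_space \<Rightarrow> complex"
  assumes u: "\<And>n. square_integrable (u n)"
    and fast: "\<And>k. sq_ennorm (\<lambda>x. u (Suc k) x - u k x) \<le> ennreal ((1 / 4) ^ k)"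
  shows "AE x in lebesgue. convergent (\<lambda>k. u k x)"
proof -
  have [measurable]: "u n \<in> borel_measurable lebesgue" for n using u[of n] by auto
  let ?S = "\<lambda>x. \<Sum>k. ennreal (2 ^ k * (cmod (u (Suc k) x - u k x))\<^sup>2)"
  have "(\<integral>\<^sup>+x. ?S x \<partial>lebesgue) = (\<Sum>k. \<integral>\<^sup>+x. ennreal (2 ^ k * (cmod (u (Suc k) x - u k x))\<^sup>2) \<partial>lebesgue)"
    by (rule nn_integral_suminf) measurable
  also have "\<dots> \<le> (\<Sum>k. ennreal ((1 / 2) ^ k))"
  proof (rule suminf_le)
    fix k
    have "(\<integral>\<^sup>+x. ennreal (2 ^ k * (cmod (u (Suc k) x - u k x))\<^sup>2) \<partial>lebesgue)
       = ennreal (2 ^ k) * sq_ennorm (\<lambda>x. u (Suc k) x - u k x)"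
      by (subst nn_integral_cmult[symmetric]) (auto simp: ennreal_mult)
    also have "\<dots> \<le> ennreal (2 ^ k) * ennreal ((1 / 4) ^ k)" by (intro mult_left_mono fast) auto
    also have "\<dots> = ennreal ((1 / 2) ^ k)"
      by (subst ennreal_mult[symmetric]) (auto simp flip: power_mult_distrib)
    finally show "(\<integral>\<^sup>+x. ennreal (2 ^ k * (cmod (u (Suc k) x - u k x))\<^sup>2) \<partial>lebesgue) \<le> ennreal ((1 / 2) ^ k)" .
  qed auto
  also have "\<dots> = ennreal 2"
    using geometric_sums[of "1 / 2 :: real"] by (intro suminf_ennreal_eq) auto
  finally have "(\<integral>\<^sup>+x. ?S x \<partial>lebesgue) < \<infinity>" by (simp add: le_less_trans)
  then have "AE x in lebesgue. ?S x \<noteq> \<infinity>"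
    by (intro nn_integral_PInf_AE) auto
  then show ?thesis
  proof eventually_elim
    case (elim x)
    let ?t = "\<lambda>k. 2 ^ k * (cmod (u (Suc k) x - u k x))\<^sup>2"
    have "summable ?t" using elim by (intro summable_suminf_not_top) auto
    then have "Bseq ?t" by (intro convergent_imp_Bseq summable_LIMSEQ_zero[THEN convergentI])
    then obtain K where K: "K > 0" "\<And>k. norm (?t k) \<le> K" by (auto elim: BseqE)
    have "norm (u (Suc k) x - u k x) \<le> sqrt K * (1 / sqrt 2) ^ k" for k
    proof -
      have "(cmod (u (Suc k) x - u k x))\<^sup>2 \<le> K / 2 ^ k" using K(2)[of k] by (simp add: field_simps)
      then have "cmod (u (Suc k) x - u k x) \<le> sqrt (K / 2 ^ k)" by (rule real_le_rsqrt)
      then show ?thesis by (simp add: real_sqrt_divide real_sqrt_power power_divide)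
    qed
    moreover have "summable (\<lambda>k. sqrt K * (1 / sqrt 2) ^ k)"
      by (intro summable_mult summable_geometric) auto
    ultimately have "summable (\<lambda>k. u (Suc k) x - u k x)"
      by (rule summable_comparison_test'[where N = 0, rotated]) 
    then have "convergent (\<lambda>n. \<Sum>k<n. u (Suc k) x - u k x)" by (simp add: summable_iff_convergent)
    then have conv: "convergent (\<lambda>n. u n x - u 0 x)" by (simp add: sum_lessThan_telescope[of "\<lambda>n. u n x"])
    from convergent_add[OF conv convergent_const[of "u 0 x"]] show ?case by simp
  qed
qed

text \<open>The indicator of a ball is itself square integrable, so the truncation is a product of
  two square integrable functions. This makes the transforms in \<open>is_fourier_L2\<close> genuine
  integrals.\<close>

lemma indicator_ball_truncation:
  fixes f :: "'a::euclidean_space \<Rightarrow> complex"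
  assumes f: "square_integrable f"
  shows "square_integrable (\<lambda>x. indicator (ball 0 R) x * f x)"
    and "integrable lebesgue (\<lambda>x. indicator (ball 0 R) x * f x)"
proof -
  have [measurable]: "f \<in> borel_measurable lebesgue" using f by auto
  have [measurable]: "(\<lambda>x. indicator (ball 0 R :: 'a set) x :: complex) \<in> borel_measurable lebesgue"
    by (intro borel_imp_lebesgue_measurable borel_measurable_indicator) auto
  have "(\<lambda>x. indicator (ball 0 R) x * f x) \<in> borel_measurable lebesgue" by measurable
  then show "square_integrable (\<lambda>x. indicator (ball 0 R) x * f x)"
    by (rule square_integrable_bound[OF f]) (auto simp: indicator_def)
  have "emeasure lborel (ball 0 R :: 'a set) < \<infinity>" by (rule emeasure_lborel_ball_finite)
  then have "integrable lborel (indicator (ball 0 R :: 'a set) :: 'a \<Rightarrow> real)" by simp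
  then have "integrable lebesgue (indicator (ball 0 R :: 'a set) :: 'a \<Rightarrow> real)"
    by (subst integrable_completion) auto
  moreover have "(cmod (indicator (ball 0 R :: 'a set) x))\<^sup>2 = indicator (ball 0 R) x" for x
    by (auto simp: indicator_def)
  ultimately have "square_integrable (indicator (ball 0 R :: 'a set) :: 'a \<Rightarrow> complex)"
    unfolding square_integrable_def by simp
  then show "integrable lebesgue (\<lambda>x. indicator (ball 0 R) x * f x)"
    by (rule square_integrable_mult_integrable) (rule f)
qed

lemma truncation_tendsto:
  fixes f :: "'a::euclidean_space \<Rightarrow> complex"
  assumes f: "square_integrable f"
  shows "((\<lambda>R::real. sq_norm (\<lambda>x. f x - indicator (ball 0 R) x * f x)) \<longlongrightarrow> 0) at_top"
proof -
  have [measurable]: "f \<in> borel_measurable lebesgue" using f by auto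
  have [measurable]: "(\<lambda>x. indicator (ball 0 R :: 'a set) x :: complex) \<in> borel_measurable lebesgue" for R
    by (intro borel_imp_lebesgue_measurable borel_measurable_indicator) auto
  have "((\<lambda>R::real. sq_norm (\<lambda>x. f x - indicator (ball 0 R) x * f x)) \<longlongrightarrow> (\<integral>x. 0 \<partial>(lebesgue :: 'a measure))) at_top"
  proof (rule integral_dominated_convergence_at_top[where w = "\<lambda>x. (cmod (f x))\<^sup>2"])
    show "integrable lebesgue (\<lambda>x. (cmod (f x))\<^sup>2)" using f by (simp add: square_integrable_def)
    show "\<forall>\<^sub>F R in at_top. AE x in lebesgue. norm ((cmod (f x - indicator (ball 0 R) x * f x))\<^sup>2) \<le> (cmod (f x))\<^sup>2"
      by (auto simp: indicator_def)
    show "AE x in lebesgue. ((\<lambda>R::real. (cmod (f x - indicator (ball 0 R) x * f x))\<^sup>2) \<longlongrightarrow> 0) at_top"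
    proof (rule AE_I2, rule tendsto_eventually)
      fix x :: 'a
      show "\<forall>\<^sub>F R :: real in at_top. (cmod (f x - indicator (ball 0 R) x * f x))\<^sup>2 = 0"
        using eventually_gt_at_top[of "norm x"] by eventually_elim simp
    qed
  qed measurable
  then show ?thesis by simp
qed

text \<open>By Plancherel the transforms of the truncations are Cauchy in mean, with distances
  controlled by the tails of \<open>f\<close>. Along fast growing radii they converge almost
  everywhere, and the pointwise limit is the witness.\<close>

lemma is_fourier_L2_exists:
  fixes f :: "'a::euclidean_space \<Rightarrow> complex"
  assumes f: "square_integrable f"
  shows "\<exists>g. is_fourier_L2 f g"
proof -
  let ?K = "(2 * pi) ^ DIM('a)"
  define tr where "tr R x = indicator (ball 0 R) x * f x" for R x
  define T where "T R = sq_norm (\<lambda>x. f x - tr R x)" for R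
  have T0: "(T \<longlongrightarrow> 0) at_top" unfolding T_def[abs_def] tr_def by (rule truncation_tendsto[OF f])
  have Tnn: "T R \<ge> 0" for R unfolding T_def by simp
  have tr: "square_integrable (tr R)" "integrable lebesgue (tr R)" for R
    unfolding tr_def[abs_def] using indicator_ball_truncation[OF f] by auto
  have trd: "square_integrable (\<lambda>x. tr R x - tr S x)" "integrable lebesgue (\<lambda>x. tr R x - tr S x)" for R S
    using tr[of R] tr[of S] by (auto intro: square_integrable_diff)
  have ftr: "square_integrable (\<lambda>x. f x - tr R x)" for R by (rule square_integrable_diff[OF f tr(1)])
  define F where "F R = fourier_L1 (tr R)" for R
  have sF: "square_integrable (F R)" for R unfolding F_def by (rule plancherel_L1[OF tr(2,1)])
  have [measurable]: "F R \<in> borel_measurable lebesgue" for R using sF[of R] by auto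
  have FF: "sq_ennorm (\<lambda>\<xi>. F R \<xi> - F S \<xi>) = ennreal (?K * sq_norm (\<lambda>x. tr R x - tr S x))" for R S
    unfolding F_def fourier_L1_diff[OF tr(2) tr(2), symmetric]
    unfolding square_integrable_nn_integral[OF plancherel_L1(1)[OF trd(2,1)]] plancherel_L1(2)[OF trd(2,1)] ..
  have FFsum: "sq_ennorm (\<lambda>\<xi>. F R \<xi> - F S \<xi>) \<le> ennreal (?K * (T R + T S))" for R S
  proof -
    have "sq_norm (\<lambda>x. tr R x - tr S x) \<le> (\<integral>x. (cmod (f x - tr R x))\<^sup>2 + (cmod (f x - tr S x))\<^sup>2 \<partial>lebesgue)"
    proof (rule integral_mono)
      show "(cmod (tr R x - tr S x))\<^sup>2 \<le> (cmod (f x - tr R x))\<^sup>2 + (cmod (f x - tr S x))\<^sup>2" for x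
        by (auto simp: tr_def indicator_def)
    qed (use trd(1)[of R S] ftr[of R] ftr[of S] in \<open>auto simp: square_integrable_def\<close>)
    also have "\<dots> = T R + T S" unfolding T_def using ftr[of R] ftr[of S] by (simp add: square_integrable_def)
    finally show ?thesis unfolding FF by (intro ennreal_leI mult_left_mono) auto
  qed
  have FFle: "sq_ennorm (\<lambda>\<xi>. F S \<xi> - F R \<xi>) \<le> ennreal (?K * T R)" if "R \<le> S" for R S
  proof -
    have "sq_norm (\<lambda>x. tr S x - tr R x) \<le> T R"
      unfolding T_def
    proof (rule integral_mono)
      show "(cmod (tr S x - tr R x))\<^sup>2 \<le> (cmod (f x - tr R x))\<^sup>2" for x
        using that by (auto simp: tr_def indicator_def)
    qed (use trd(1)[of S R] ftr[of R] in \<open>auto simp: square_integrable_def\<close>)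
    then show ?thesis unfolding FF by (intro ennreal_leI mult_left_mono) auto
  qed
  \<comment> \<open>The first bound sends the radii to infinity; the half leaves room for two
    consecutive tails below (1 / 4)^k.\<close>
  have "\<exists>r. real k \<le> r \<and> ?K * T r \<le> (1 / 4) ^ k / 2" for k
  proof -
    have "((\<lambda>R. ?K * T R) \<longlongrightarrow> 0) at_top" using T0 by (rule tendsto_mult_right_zero)
    then have "\<forall>\<^sub>F R in at_top. ?K * T R < (1 / 4) ^ k / 2" by (rule order_tendstoD) simp
    then have "\<forall>\<^sub>F R in at_top. real k \<le> R \<and> ?K * T R < (1 / 4) ^ k / 2"
      using eventually_ge_at_top by (rule eventually_conj[rotated])
    then have "\<exists>R. real k \<le> R \<and> ?K * T R < (1 / 4) ^ k / 2"
      by (intro eventually_happens'[of at_top]) auto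
    then show ?thesis by (auto intro: less_imp_le)
  qed
  then obtain r where r: "\<And>k. real k \<le> r k" "\<And>k. ?K * T (r k) \<le> (1 / 4) ^ k / 2" by metis
  have conv: "AE \<xi> in lebesgue. convergent (\<lambda>k. F (r k) \<xi>)"
  proof (rule square_integral_AE_convergent[OF sF])
    fix k
    have "?K * (T (r (Suc k)) + T (r k)) \<le> (1 / 4) ^ k"
      using r(2)[of k] r(2)[of "Suc k"] zero_le_power[of "1 / 4 :: real" k]
      unfolding distrib_left power_Suc by linarith
    then show "sq_ennorm (\<lambda>\<xi>. F (r (Suc k)) \<xi> - F (r k) \<xi>) \<le> ennreal ((1 / 4) ^ k)"
      using FFsum[of "r (Suc k)" "r k"] ennreal_leI order_trans by blast
  qed
  define g where "g \<xi> = lim (\<lambda>k. F (r k) \<xi>)" for \<xi>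
  have g[measurable]: "g \<in> borel_measurable lebesgue" unfolding g_def[abs_def] by measurable
  have lim: "AE \<xi> in lebesgue. (\<lambda>k. F (r k) \<xi>) \<longlonglongrightarrow> g \<xi>"
    using conv by eventually_elim (simp add: g_def convergent_LIMSEQ_iff)
  \<comment> \<open>Fatou along the chosen radii bounds the distance of \<open>g\<close> from every
    \<open>F R\<close>, so the limit holds for all radii and not only along the sequence.\<close>
  have gF: "sq_ennorm (\<lambda>\<xi>. g \<xi> - F R \<xi>) \<le> ennreal (?K * T R)" for R
  proof (rule fatou_square)
    show "AE \<xi> in lebesgue. (\<lambda>k. F (r k) \<xi> - F R \<xi>) \<longlonglongrightarrow> g \<xi> - F R \<xi>"
      using lim by eventually_elim (intro tendsto_intros)
    obtain N :: nat where N: "R \<le> real N" using real_arch_simple by blast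
    show "\<forall>\<^sub>F k in sequentially. sq_ennorm (\<lambda>\<xi>. F (r k) \<xi> - F R \<xi>) \<le> ennreal (?K * T R)"
      using eventually_ge_at_top[of N]
    proof eventually_elim
      case (elim k)
      then have "R \<le> r k" using N r(1)[of k] by simp
      then show ?case by (rule FFle)
    qed
  qed measurable
  have "sq_ennorm (\<lambda>\<xi>. g \<xi> - F 0 \<xi>) < \<infinity>"
    by (rule le_less_trans[OF gF]) simp
  then have "square_integrable (\<lambda>\<xi>. g \<xi> - F 0 \<xi>)" by (simp add: square_integrable_iff_nn_integral)
  from square_integrable_add[OF this sF[of 0]] have "square_integrable g" by simp
  moreover have "((\<lambda>R. sq_ennorm (\<lambda>\<xi>. F R \<xi> - g \<xi>)) \<longlongrightarrow> 0) at_top"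
  proof (rule tendsto_sandwich[OF _ _ tendsto_const])
    have "((\<lambda>R. ennreal (?K * T R)) \<longlongrightarrow> ennreal 0) at_top"
      by (intro tendsto_ennrealI tendsto_mult_right_zero T0)
    then show "((\<lambda>R. ennreal (?K * T R)) \<longlongrightarrow> 0) at_top" by simp
    show "\<forall>\<^sub>F R in at_top. sq_ennorm (\<lambda>\<xi>. F R \<xi> - g \<xi>) \<le> ennreal (?K * T R)"
      using gF by (simp add: norm_minus_commute)
  qed auto
  ultimately show ?thesis unfolding is_fourier_L2_def F_def tr_def[abs_def] by auto
qed

lemma fourier_L2_is_fourier_L2: "square_integrable f \<Longrightarrow> is_fourier_L2 f (fourier_L2 f)"
  unfolding fourier_L2_def using is_fourier_L2_exists by (rule someI_ex)

lemma square_integrable_fourier_L2: "square_integrable f \<Longrightarrow> square_integrable (fourier_L2 f)"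
  using fourier_L2_is_fourier_L2 by (auto simp: is_fourier_L2_def)

lemma is_fourier_L2_diff:
  fixes f :: "'a::euclidean_space \<Rightarrow> complex"
  assumes f: "square_integrable f" "is_fourier_L2 f f'" and g: "square_integrable g" "is_fourier_L2 g g'"
  shows "is_fourier_L2 (\<lambda>x. f x - g x) (\<lambda>\<xi>. f' \<xi> - g' \<xi>)"
  unfolding is_fourier_L2_def
proof
  let ?F = "\<lambda>R. fourier_L1 (\<lambda>x. indicator (ball 0 R) x * f x)" and ?G = "\<lambda>R. fourier_L1 (\<lambda>x. indicator (ball 0 R) x * g x)"
  have sf': "square_integrable f'" and sg': "square_integrable g'" using f g by (auto simp: is_fourier_L2_def)
  then show "square_integrable (\<lambda>\<xi>. f' \<xi> - g' \<xi>)" by (rule square_integrable_diff)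
  have [measurable]: "f' \<in> borel_measurable lebesgue" "g' \<in> borel_measurable lebesgue" using sf' sg' by auto
  have [measurable]: "?F R \<in> borel_measurable lebesgue" "?G R \<in> borel_measurable lebesgue" for R
    using plancherel_L1(1)[OF indicator_ball_truncation(2,1)[OF f(1)]] plancherel_L1(1)[OF indicator_ball_truncation(2,1)[OF g(1)]] by auto
  let ?a = "\<lambda>R. sq_ennorm (\<lambda>\<xi>. ?F R \<xi> - f' \<xi>)" and ?b = "\<lambda>R. sq_ennorm (\<lambda>\<xi>. ?G R \<xi> - g' \<xi>)"
  show "((\<lambda>R. sq_ennorm (\<lambda>\<xi>. fourier_L1 (\<lambda>x. indicator (ball 0 R) x * (f x - g x)) \<xi> - (f' \<xi> - g' \<xi>))) \<longlongrightarrow> 0) at_top"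
  proof (rule tendsto_sandwich[OF _ _ tendsto_const])
    have "((\<lambda>R. ennreal 2 * ?a R + ennreal 2 * ?b R) \<longlongrightarrow> ennreal 2 * 0 + ennreal 2 * 0) at_top"
      using f(2) g(2) unfolding is_fourier_L2_def by (intro tendsto_add ennreal_tendsto_cmult) auto
    then show "((\<lambda>R. ennreal 2 * ?a R + ennreal 2 * ?b R) \<longlongrightarrow> 0) at_top" by simp
    show "\<forall>\<^sub>F R in at_top. sq_ennorm (\<lambda>\<xi>. fourier_L1 (\<lambda>x. indicator (ball 0 R) x * (f x - g x)) \<xi> - (f' \<xi> - g' \<xi>))
        \<le> ennreal 2 * ?a R + ennreal 2 * ?b R"
    proof (rule always_eventually, rule allI)
      fix R
      have eq: "fourier_L1 (\<lambda>x. indicator (ball 0 R) x * (f x - g x)) \<xi> = ?F R \<xi> - ?G R \<xi>" for \<xi>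
        unfolding right_diff_distrib by (rule fourier_L1_diff) (intro indicator_ball_truncation f g)+
      have "sq_ennorm (\<lambda>\<xi>. fourier_L1 (\<lambda>x. indicator (ball 0 R) x * (f x - g x)) \<xi> - (f' \<xi> - g' \<xi>))
         \<le> (\<integral>\<^sup>+\<xi>. ennreal 2 * ennreal ((cmod (?F R \<xi> - f' \<xi>))\<^sup>2) + ennreal 2 * ennreal ((cmod (?G R \<xi> - g' \<xi>))\<^sup>2) \<partial>lebesgue)"
      proof (rule nn_integral_mono)
        fix \<xi>
        have "(cmod (?F R \<xi> - ?G R \<xi> - (f' \<xi> - g' \<xi>)))\<^sup>2 = (cmod ((?F R \<xi> - f' \<xi>) + - (?G R \<xi> - g' \<xi>)))\<^sup>2"
          by (simp add: algebra_simps)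
        also have "\<dots> \<le> 2 * (cmod (?F R \<xi> - f' \<xi>))\<^sup>2 + 2 * (cmod (- (?G R \<xi> - g' \<xi>)))\<^sup>2"
          by (rule norm_add_square_le)
        also have "cmod (- (?G R \<xi> - g' \<xi>)) = cmod (?G R \<xi> - g' \<xi>)" by (rule norm_minus_cancel)
        finally show "ennreal ((cmod (fourier_L1 (\<lambda>x. indicator (ball 0 R) x * (f x - g x)) \<xi> - (f' \<xi> - g' \<xi>)))\<^sup>2)
            \<le> ennreal 2 * ennreal ((cmod (?F R \<xi> - f' \<xi>))\<^sup>2) + ennreal 2 * ennreal ((cmod (?G R \<xi> - g' \<xi>))\<^sup>2)"
          unfolding eq by (simp add: ennreal_mult[symmetric] ennreal_plus[symmetric] del: ennreal_plus ennreal_numeral)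
      qed
      also have "\<dots> = ennreal 2 * ?a R + ennreal 2 * ?b R"
        by (simp add: nn_integral_add nn_integral_cmult)
      finally show "sq_ennorm (\<lambda>\<xi>. fourier_L1 (\<lambda>x. indicator (ball 0 R) x * (f x - g x)) \<xi> - (f' \<xi> - g' \<xi>))
        \<le> ennreal 2 * ?a R + ennreal 2 * ?b R" .
    qed
  qed auto
qed

lemma is_fourier_L2_plancherel:
  fixes f :: "'a::euclidean_space \<Rightarrow> complex"
  assumes f: "square_integrable f" and g: "is_fourier_L2 f g"
  shows "sq_norm g = (2 * pi) ^ DIM('a) * sq_norm f"
proof -
  let ?tr = "\<lambda>R x. indicator (ball 0 R) x * f x"
  note tr = indicator_ball_truncation[OF f]
  note pl = plancherel_L1[OF tr(2,1)]
  have sg: "square_integrable g" using g by (simp add: is_fourier_L2_def)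
  have 1: "((\<lambda>R. sq_norm (fourier_L1 (?tr R))) \<longlongrightarrow> sq_norm g) at_top"
    by (rule square_integral_tendsto[OF sg pl(1)]) (use g in \<open>simp add: is_fourier_L2_def\<close>)
  have sd: "square_integrable (\<lambda>x. ?tr R x - f x)" for R by (rule square_integrable_diff[OF tr(1) f])
  have "((\<lambda>R. sq_norm (?tr R)) \<longlongrightarrow> sq_norm f) at_top"
  proof (rule square_integral_tendsto[OF f tr(1)])
    have "((\<lambda>R. ennreal (sq_norm (\<lambda>x. ?tr R x - f x))) \<longlongrightarrow> ennreal 0) at_top"
      using truncation_tendsto[OF f] by (intro tendsto_ennrealI) (simp add: norm_minus_commute)
    then show "((\<lambda>R. sq_ennorm (\<lambda>x. ?tr R x - f x)) \<longlongrightarrow> 0) at_top"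
      unfolding square_integrable_nn_integral[OF sd] by simp
  qed
  then have 2: "((\<lambda>R. (2 * pi) ^ DIM('a) * sq_norm (?tr R)) \<longlongrightarrow> (2 * pi) ^ DIM('a) * sq_norm f) at_top"
    by (rule tendsto_mult_left)
  show ?thesis using tendsto_unique[OF _ 1[unfolded pl(2)] 2] by simp
qed

lemma square_integrable_zero_AE:
  assumes "square_integrable f" and "sq_norm f = 0"
  shows "AE x in lebesgue. f x = 0"
  using assms integral_nonneg_eq_0_iff_AE[of lebesgue "\<lambda>x. (cmod (f x))\<^sup>2"]
  by (simp add: square_integrable_def)

text \<open>The difference of two transforms of \<open>f\<close> is a transform of 0, and by
  Plancherel its norm is 0. Hence the choice in \<open>fourier_L2\<close> is harmless up to null
  sets.\<close>

lemma is_fourier_L2_unique: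
  assumes f: "square_integrable f" and g: "is_fourier_L2 f g" and h: "is_fourier_L2 f h"
  shows "AE \<xi> in lebesgue. g \<xi> = h \<xi>"
proof -
  have z: "is_fourier_L2 (\<lambda>x. f x - f x) (\<lambda>\<xi>. g \<xi> - h \<xi>)"
    by (rule is_fourier_L2_diff[OF f g f h])
  have "square_integrable (\<lambda>x. f x - f x)" by (rule square_integrable_diff[OF f f])
  from is_fourier_L2_plancherel[OF this z] have "sq_norm (\<lambda>\<xi>. g \<xi> - h \<xi>) = 0" by simp
  moreover have "square_integrable (\<lambda>\<xi>. g \<xi> - h \<xi>)" using z by (simp add: is_fourier_L2_def)
  ultimately show ?thesis using square_integrable_zero_AE by fastforce
qed

text \<open>The bridge from the chosen transform to explicit integrals: Plancherel for the tail of
  \<open>f\<close> shows that the truncated transforms converge in mean to the full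
  integral.\<close>

lemma is_fourier_L2_L1:
  fixes f :: "'a::euclidean_space \<Rightarrow> complex"
  assumes f: "square_integrable f" and f1: "integrable lebesgue f"
  shows "is_fourier_L2 f (fourier_L1 f)"
  unfolding is_fourier_L2_def
proof
  let ?tr = "\<lambda>R x. indicator (ball 0 R) x * f x"
  note tr = indicator_ball_truncation[OF f]
  show "square_integrable (fourier_L1 f)" by (rule plancherel_L1[OF f1 f])
  have sd: "square_integrable (\<lambda>x. ?tr R x - f x)" "integrable lebesgue (\<lambda>x. ?tr R x - f x)" for R
    using square_integrable_diff[OF tr(1) f] tr(2) f1 by auto
  have eq: "sq_ennorm (\<lambda>\<xi>. fourier_L1 (?tr R) \<xi> - fourier_L1 f \<xi>)
      = ennreal ((2 * pi) ^ DIM('a) * sq_norm (\<lambda>x. ?tr R x - f x))" for R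
    unfolding fourier_L1_diff[OF tr(2) f1, symmetric]
    unfolding square_integrable_nn_integral[OF plancherel_L1(1)[OF sd(2,1)]] plancherel_L1(2)[OF sd(2,1)] ..
  have "((\<lambda>R. ennreal ((2 * pi) ^ DIM('a) * sq_norm (\<lambda>x. ?tr R x - f x))) \<longlongrightarrow> ennreal 0) at_top"
    using truncation_tendsto[OF f] by (intro tendsto_ennrealI tendsto_mult_right_zero) (simp add: norm_minus_commute)
  then show "((\<lambda>R. sq_ennorm (\<lambda>\<xi>. fourier_L1 (?tr R) \<xi> - fourier_L1 f \<xi>)) \<longlongrightarrow> 0) at_top"
    unfolding eq by simp
qed

lemma fourier_L2_eq_fourier_L1:
  assumes "square_integrable f" "integrable lebesgue f"
  shows "AE \<xi> in lebesgue. fourier_L2 f \<xi> = fourier_L1 f \<xi>"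
  by (rule is_fourier_L2_unique[OF assms(1) fourier_L2_is_fourier_L2[OF assms(1)] is_fourier_L2_L1[OF assms]])

lemma fourier_L2_diff:
  assumes "square_integrable f" "square_integrable g"
  shows "AE \<xi> in lebesgue. fourier_L2 (\<lambda>x. f x - g x) \<xi> = fourier_L2 f \<xi> - fourier_L2 g \<xi>"
  by (intro is_fourier_L2_unique[where f = "\<lambda>x. f x - g x"] fourier_L2_is_fourier_L2 is_fourier_L2_diff square_integrable_diff assms)

lemma plancherel_L2:
  fixes f :: "'a::euclidean_space \<Rightarrow> complex"
  assumes "square_integrable f"
  shows "sq_norm (fourier_L2 f) = (2 * pi) ^ DIM('a) * sq_norm f"
  by (rule is_fourier_L2_plancherel[OF assms fourier_L2_is_fourier_L2[OF assms]])

lemma cmod_diff_square: "(cmod (a - b))\<^sup>2 = (cmod a)\<^sup>2 + (cmod b)\<^sup>2 - 2 * Re (a * cnj b)"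
  unfolding cmod_power2 by (simp add: power2_eq_square algebra_simps)

lemma square_integral_polarisation:
  assumes f: "square_integrable f" and g: "square_integrable g"
  shows "2 * (\<integral>x. Re (f x * cnj (g x)) \<partial>lebesgue)
    = sq_norm f + sq_norm g - sq_norm (\<lambda>x. f x - g x)"
proof -
  have [measurable]: "g \<in> borel_measurable lebesgue" using g by auto
  have "square_integrable (\<lambda>x. cnj (g x))" using g by (simp add: square_integrable_def)
  then have "integrable lebesgue (\<lambda>x. Re (f x * cnj (g x)))"
    using square_integrable_mult_integrable[OF f] by (intro integrable_Re)
  moreover define h where "h x = Re (f x * cnj (g x))" for x
  ultimately have "integrable lebesgue h" by (simp add: h_def[abs_def])
  then show ?thesis unfolding cmod_diff_square h_def[symmetric] using f g by (simp add: square_integrable_def)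
qed

text \<open>Polarisation by the norm of a difference: Plancherel for \<open>f\<close>,
  \<open>g\<close> and \<open>f - g\<close>, with linearity in the form of
  \<open>fourier_L2_diff\<close>.\<close>

lemma parseval_L2:
  fixes f g :: "'a::euclidean_space \<Rightarrow> complex"
  assumes f: "square_integrable f" and g: "square_integrable g"
  shows "(\<integral>\<xi>. Re (fourier_L2 f \<xi> * cnj (fourier_L2 g \<xi>)) \<partial>lebesgue) = (2 * pi) ^ DIM('a) * (\<integral>x. Re (f x * cnj (g x)) \<partial>lebesgue)"
proof -
  have sd: "square_integrable (\<lambda>x. f x - g x)" by (rule square_integrable_diff[OF f g])
  have "sq_norm (\<lambda>\<xi>. fourier_L2 f \<xi> - fourier_L2 g \<xi>) = sq_norm (fourier_L2 (\<lambda>x. f x - g x))"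
  proof (rule integral_cong_AE)
    show "AE \<xi> in lebesgue. (cmod (fourier_L2 f \<xi> - fourier_L2 g \<xi>))\<^sup>2 = (cmod (fourier_L2 (\<lambda>x. f x - g x) \<xi>))\<^sup>2"
      using fourier_L2_diff[OF f g] by eventually_elim simp
  qed (use square_integrable_fourier_L2[OF f] square_integrable_fourier_L2[OF g] square_integrable_fourier_L2[OF sd] in measurable)
  then have "2 * (\<integral>\<xi>. Re (fourier_L2 f \<xi> * cnj (fourier_L2 g \<xi>)) \<partial>lebesgue) = (2 * pi) ^ DIM('a) * (2 * (\<integral>x. Re (f x * cnj (g x)) \<partial>lebesgue))"
    unfolding square_integral_polarisation[OF f g] square_integral_polarisation[OF square_integrable_fourier_L2[OF f] square_integrable_fourier_L2[OF g]]
    by (simp add: plancherel_L2 f g sd algebra_simps)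
  then show ?thesis by simp
qed

subsection \<open>Laplace transforms\<close>

lemma nn_integral_gamma_laplace:
  fixes a p :: real
  assumes a: "a > 0" and p: "p > 0"
  shows "(\<integral>\<^sup>+t. ennreal (indicator {0..} t * t powr (a - 1) * exp (- (p * t))) \<partial>lborel) = ennreal (Gamma a * p powr (- a))"
proof -
  let ?f = "\<lambda>t::real. ennreal (indicator {0..} t * t powr (a - 1) * exp (- (p * t)))"
  have eq: "ennreal (indicator {0..} (p * t) * (p * t) powr (a - 1) / exp (p * t)) = ennreal (p powr (a - 1)) * ?f t" for t
    using p by (subst ennreal_mult[symmetric])
      (auto simp: indicator_def powr_mult exp_minus field_simps zero_le_mult_iff)
  have "ennreal (Gamma a) = (\<integral>\<^sup>+t. ennreal (indicator {0..} t * t powr (a - 1) / exp t) \<partial>lborel)"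
    by (rule Gamma_conv_nn_integral_real[OF a])
  also have "\<dots> = ennreal \<bar>p\<bar> * (\<integral>\<^sup>+t. ennreal (indicator {0..} (0 + p * t) * (0 + p * t) powr (a - 1) / exp (0 + p * t)) \<partial>lborel)"
    by (rule nn_integral_real_affine) (use p in auto)
  also have "\<dots> = ennreal p * (ennreal (p powr (a - 1)) * (\<integral>\<^sup>+t. ?f t \<partial>lborel))"
    unfolding add_0_left eq using p by (subst nn_integral_cmult) auto
  also have "\<dots> = ennreal (p powr a) * (\<integral>\<^sup>+t. ?f t \<partial>lborel)"
    using p by (simp add: mult.assoc[symmetric] ennreal_mult[symmetric] powr_mult_base)
  finally have "ennreal (p powr (- a)) * ennreal (Gamma a) = ennreal (p powr (- a)) * (ennreal (p powr a) * (\<integral>\<^sup>+t. ?f t \<partial>lborel))"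
    by simp
  also have "\<dots> = (\<integral>\<^sup>+t. ?f t \<partial>lborel)"
    using p by (simp add: mult.assoc[symmetric] ennreal_mult[symmetric] powr_add[symmetric])
  finally show ?thesis using p by (simp add: ennreal_mult[symmetric] mult.commute Gamma_real_nonneg a)
qed

lemma has_integral_gamma_laplace:
  fixes a p :: real
  assumes a: "a > 0" and p: "p > 0"
  shows "has_bochner_integral lborel (\<lambda>t. indicator {0..} t * t powr (a - 1) * exp (- (p * t))) (Gamma a * p powr (- a))"
  using nn_integral_gamma_laplace[OF assms] Gamma_real_nonneg[OF a]
  by (intro has_bochner_integral_nn_integral) auto

text \<open>Translation by \<rho> reduces to the Gamma integral and splits off exp (- p * \<rho>),
  which is the Gaussian in \<open>x\<close> once \<rho> is the squared norm.\<close>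

lemma has_integral_truncated_power_laplace:
  fixes a p \<rho> :: real
  assumes a: "a > 0" and p: "p > 0"
  shows "has_bochner_integral lborel (\<lambda>t. max 0 (t - \<rho>) powr a * exp (- (p * t))) (exp (- (p * \<rho>)) * (Gamma (a + 1) * p powr (- a - 1)))"
proof -
  have "has_bochner_integral lborel (\<lambda>t. exp (- (p * \<rho>)) * (indicator {0..} t * t powr (a + 1 - 1) * exp (- (p * t)))) (exp (- (p * \<rho>)) * (Gamma (a + 1) * p powr (- (a + 1))))"
    using has_integral_gamma_laplace[of "a + 1" p] a p by (intro has_bochner_integral_mult_right) auto
  also have "(\<lambda>t. exp (- (p * \<rho>)) * (indicator {0..} t * t powr (a + 1 - 1) * exp (- (p * t))))
      = (\<lambda>t. (\<lambda>t. max 0 (t - \<rho>) powr a * exp (- (p * t))) (\<rho> + 1 * t))"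
    by (auto simp: fun_eq_iff indicator_def exp_add[symmetric] algebra_simps max_def)
  finally show ?thesis
    by (subst lborel_has_bochner_integral_real_affine_iff[of 1 _ _ \<rho>]) simp_all
qed

section \<open>The subordination formula and related Gamma integrals\<close>

lemma nn_integral_power_tail:
  fixes s y :: real
  assumes s: "s > 0" and y: "y > 0"
  shows "(\<integral>\<^sup>+r. ennreal (r powr (- 1 - s)) * indicator {y..} r \<partial>lborel) = ennreal (y powr (- s) / s)"
proof -
  have "(\<integral>\<^sup>+r. ennreal (r powr (- 1 - s)) * indicator {y..} r \<partial>lborel) = ennreal (0 - (- (y powr (- s)) / s))"
  proof (rule nn_integral_FTC_atLeast)
    show "DERIV (\<lambda>r. - (r powr (- s)) / s) x :> x powr (- 1 - s)" if "y \<le> x" for x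
    proof -
      have eq: "- 1 - s = - s - 1" by simp
      show ?thesis unfolding eq using that y s by (auto intro!: derivative_eq_intros)
    qed
    show "((\<lambda>r. - (r powr (- s)) / s) \<longlongrightarrow> 0) at_top"
      using s by real_asymp
  qed auto
  then show ?thesis by simp
qed

text \<open>Write 1 - exp (- \<eta> * r) as the integral of \<eta> * exp (- \<eta> * y) over 0 \<le>
  y \<le> r and exchange the integrals. The integral over r \<ge> y is a power tail, and what
  remains is a Gamma integral with parameter 1 - s.\<close>

lemma nn_integral_power_laplace_difference:
  fixes s \<eta> :: real
  assumes s: "0 < s" "s < 1" and \<eta>: "0 \<le> \<eta>"
  shows "(\<integral>\<^sup>+r. ennreal ((1 - exp (- (\<eta> * r))) * (indicator {0<..} r * r powr (- 1 - s))) \<partial>lborel)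
    = ennreal (Gamma (1 - s) / s * \<eta> powr s)"
proof (cases "\<eta> = 0")
  case False
  then have \<eta>: "\<eta> > 0" using \<eta> by simp
  have inner: "ennreal ((1 - exp (- (\<eta> * r))) * (indicator {0<..} r * r powr (- 1 - s)))
      = (\<integral>\<^sup>+y. ennreal (\<eta> * exp (- (\<eta> * y))) * indicator {0..r} y * (ennreal (r powr (- 1 - s)) * indicator {0<..} r) \<partial>lborel)" for r
  proof (cases "r > 0")
    case True
    have "(\<integral>\<^sup>+y. ennreal (\<eta> * exp (- (\<eta> * y))) * indicator {0..r} y \<partial>lborel) = ennreal (- exp (- (\<eta> * r)) - (- exp (- (\<eta> * 0))))"
      by (rule nn_integral_FTC_Icc) (use True \<eta> in \<open>auto intro!: derivative_eq_intros simp: has_real_derivative_iff_has_vector_derivative[symmetric]\<close>)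
    then show ?thesis using True \<eta>
      by (subst nn_integral_multc) (auto simp: ennreal_mult[symmetric])
  qed (auto simp: indicator_def)
  have "(\<integral>\<^sup>+r. ennreal ((1 - exp (- (\<eta> * r))) * (indicator {0<..} r * r powr (- 1 - s))) \<partial>lborel)
      = (\<integral>\<^sup>+r. (\<integral>\<^sup>+y. ennreal (\<eta> * exp (- (\<eta> * y))) * indicator {0..r} y * (ennreal (r powr (- 1 - s)) * indicator {0<..} r) \<partial>lborel) \<partial>lborel)"
    unfolding inner ..
  also have "\<dots> = (\<integral>\<^sup>+y. (\<integral>\<^sup>+r. ennreal (\<eta> * exp (- (\<eta> * y))) * indicator {0..r} y * (ennreal (r powr (- 1 - s)) * indicator {0<..} r) \<partial>lborel) \<partial>lborel)"
  proof (rule lborel_pair.Fubini'[symmetric])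
    have "(\<lambda>(r, y :: real). ennreal (\<eta> * exp (- (\<eta> * y))) * (if 0 \<le> y \<and> y \<le> r then 1 else 0) * (ennreal (r powr (- 1 - s)) * indicator {0<..} r)) \<in> borel_measurable (lborel \<Otimes>\<^sub>M lborel)"
      by measurable
    also have "(\<lambda>(r, y :: real). ennreal (\<eta> * exp (- (\<eta> * y))) * (if 0 \<le> y \<and> y \<le> r then 1 else 0) * (ennreal (r powr (- 1 - s)) * indicator {0<..} r))
      = (\<lambda>(r, y). ennreal (\<eta> * exp (- (\<eta> * y))) * indicator {0..r} y * (ennreal (r powr (- 1 - s)) * indicator {0<..} r))"
      by (auto simp: fun_eq_iff indicator_def)
    finally show "\<dots> \<in> borel_measurable (lborel \<Otimes>\<^sub>M lborel)" .
  qed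
  also have "\<dots> = (\<integral>\<^sup>+y. ennreal (\<eta> / s) * ennreal (indicator {0..} y * y powr ((1 - s) - 1) * exp (- (\<eta> * y))) \<partial>lborel)"
  proof (rule nn_integral_cong_AE)
    \<comment> \<open>At y = 0 the left integral is infinite, whereas \<open>0 powr (- s)\<close> is
      0.\<close>
    have "AE y in lborel. y \<noteq> (0::real)" by (rule AE_lborel_singleton)
    then show "AE y in lborel. (\<integral>\<^sup>+r. ennreal (\<eta> * exp (- (\<eta> * y))) * indicator {0..r} y * (ennreal (r powr (- 1 - s)) * indicator {0<..} r) \<partial>lborel)
       = ennreal (\<eta> / s) * ennreal (indicator {0..} y * y powr ((1 - s) - 1) * exp (- (\<eta> * y)))"
    proof eventually_elim
      case (elim y)
      show ?case
      proof (cases "y > 0")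
        case True
        have "(\<integral>\<^sup>+r. ennreal (\<eta> * exp (- (\<eta> * y))) * indicator {0..r} y * (ennreal (r powr (- 1 - s)) * indicator {0<..} r) \<partial>lborel)
          = (\<integral>\<^sup>+r. ennreal (\<eta> * exp (- (\<eta> * y))) * (ennreal (r powr (- 1 - s)) * indicator {y..} r) \<partial>lborel)"
          using True by (intro nn_integral_cong) (auto simp: indicator_def)
        also have "\<dots> = ennreal (\<eta> * exp (- (\<eta> * y))) * ennreal (y powr (- s) / s)"
          using True s by (subst nn_integral_cmult) (auto simp: nn_integral_power_tail)
        finally show ?thesis using True s \<eta> by (simp add: ennreal_mult[symmetric] mult_ac)
      qed (use elim in \<open>auto simp: indicator_def\<close>)
    qed
  qed
  also have "\<dots> = ennreal (\<eta> / s) * ennreal (Gamma (1 - s) * \<eta> powr (- (1 - s)))"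
    using nn_integral_gamma_laplace[of "1 - s" \<eta>] s \<eta> by (subst nn_integral_cmult) auto
  also have "\<dots> = ennreal (Gamma (1 - s) / s * \<eta> powr s)"
  proof -
    have "\<eta> * \<eta> powr (- (1 - s)) = \<eta> powr s" using \<eta> by (subst powr_mult_base) auto
    then show ?thesis using s \<eta> by (simp add: ennreal_mult[symmetric] Gamma_real_nonneg mult_ac)
  qed
  finally show ?thesis .
qed simp

lemma has_integral_power_laplace_difference:
  fixes s \<eta> :: real
  assumes s: "0 < s" "s < 1" and \<eta>: "0 \<le> \<eta>"
  shows "has_bochner_integral lborel (\<lambda>r. (1 - exp (- (\<eta> * r))) * (indicator {0<..} r * r powr (- 1 - s))) (Gamma (1 - s) / s * \<eta> powr s)"
  using nn_integral_power_laplace_difference[OF assms] Gamma_real_nonneg[of "1 - s"] s \<eta>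
  by (intro has_bochner_integral_nn_integral) (auto intro!: AE_I2 simp: indicator_def)

lemma one_plus_powr_minus_le_one:
  fixes r b :: real
  assumes "0 \<le> r" "0 \<le> b"
  shows "(1 + r) powr (- b) \<le> 1"
  using assms powr_mono[of "- b" 0 "1 + r"] by simp

text \<open>Gamma b * (1 + r)^(- b) is a Laplace transform in 1 + r, so Gamma b times the difference
  is an average of 1 - exp (- q * r) over the Gamma density in q. The exchange of integrals reduces
  it to the subordination formula and a Gamma integral with parameter b + s.\<close>

lemma nn_integral_power_difference:
  fixes s b :: real
  assumes s: "0 < s" "s < 1" and b: "b > 0"
  shows "(\<integral>\<^sup>+r. ennreal ((1 - (1 + r) powr (- b)) * (indicator {0<..} r * r powr (- 1 - s))) \<partial>lborel)
    = ennreal (Gamma (1 - s) / s * (Gamma (b + s) / Gamma b))"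
proof -
  let ?g = "\<lambda>q::real. indicator {0..} q * q powr (b - 1)"
  have Gb: "Gamma b > 0" using b by (rule Gamma_real_pos)
  have inner: "ennreal (Gamma b) * ennreal ((1 - (1 + r) powr (- b)) * (indicator {0<..} r * r powr (- 1 - s)))
      = (\<integral>\<^sup>+q. ennreal (?g q * exp (- q)) * ennreal ((1 - exp (- (q * r))) * (indicator {0<..} r * r powr (- 1 - s))) \<partial>lborel)" for r
  proof (cases "r > 0")
    case True
    have "has_bochner_integral lborel (\<lambda>q. ?g q * exp (- (1 * q)) - ?g q * exp (- ((1 + r) * q))) (Gamma b * 1 powr (- b) - Gamma b * (1 + r) powr (- b))"
      using True b by (intro has_bochner_integral_diff has_integral_gamma_laplace) auto
    also have "(\<lambda>q. ?g q * exp (- (1 * q)) - ?g q * exp (- ((1 + r) * q))) = (\<lambda>q. ?g q * exp (- q) * (1 - exp (- (q * r))))"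
      by (auto simp: fun_eq_iff algebra_simps exp_add[symmetric])
    finally have 1: "has_bochner_integral lborel (\<lambda>q. ?g q * exp (- q) * (1 - exp (- (q * r)))) (Gamma b * (1 - (1 + r) powr (- b)))"
      by (simp add: algebra_simps)
    have "(\<integral>\<^sup>+q. ennreal (?g q * exp (- q) * (1 - exp (- (q * r)))) \<partial>lborel) = ennreal (Gamma b * (1 - (1 + r) powr (- b)))"
      using 1 True by (subst nn_integral_eq_integral) (auto simp: has_bochner_integral_iff indicator_def intro!: AE_I2)
    moreover have "(\<integral>\<^sup>+q. ennreal (?g q * exp (- q)) * ennreal ((1 - exp (- (q * r))) * (indicator {0<..} r * r powr (- 1 - s))) \<partial>lborel)
      = (\<integral>\<^sup>+q. ennreal (?g q * exp (- q) * (1 - exp (- (q * r)))) * ennreal (r powr (- 1 - s)) \<partial>lborel)"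
      using True by (intro nn_integral_cong) (auto simp: indicator_def ennreal_mult[symmetric] mult_ac)
    moreover have "1 - (1 + r) powr (- b) \<ge> 0"
      using True b one_plus_powr_minus_le_one[of r b] by simp
    moreover have "(\<integral>\<^sup>+q. ennreal (?g q * exp (- q) * (1 - exp (- (q * r)))) * ennreal (r powr (- 1 - s)) \<partial>lborel)
        = (\<integral>\<^sup>+q. ennreal (?g q * exp (- q) * (1 - exp (- (q * r)))) \<partial>lborel) * ennreal (r powr (- 1 - s))"
      by (rule nn_integral_multc) measurable
    ultimately show ?thesis using True Gb
      by (simp only:) (simp add: ennreal_mult[symmetric] mult_ac)
  qed (auto simp: indicator_def)
  have "ennreal (Gamma b) * (\<integral>\<^sup>+r. ennreal ((1 - (1 + r) powr (- b)) * (indicator {0<..} r * r powr (- 1 - s))) \<partial>lborel)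
    = (\<integral>\<^sup>+r. (\<integral>\<^sup>+q. ennreal (?g q * exp (- q)) * ennreal ((1 - exp (- (q * r))) * (indicator {0<..} r * r powr (- 1 - s))) \<partial>lborel) \<partial>lborel)"
    unfolding inner[symmetric] by (subst nn_integral_cmult) auto
  also have "\<dots> = (\<integral>\<^sup>+q. (\<integral>\<^sup>+r. ennreal (?g q * exp (- q)) * ennreal ((1 - exp (- (q * r))) * (indicator {0<..} r * r powr (- 1 - s))) \<partial>lborel) \<partial>lborel)"
    by (rule lborel_pair.Fubini'[symmetric]) measurable
  also have "\<dots> = (\<integral>\<^sup>+q. ennreal (Gamma (1 - s) / s) * ennreal (indicator {0..} q * q powr (b + s - 1) * exp (- (1 * q))) \<partial>lborel)"
  proof (rule nn_integral_cong)
    fix q :: real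
    show "(\<integral>\<^sup>+r. ennreal (?g q * exp (- q)) * ennreal ((1 - exp (- (q * r))) * (indicator {0<..} r * r powr (- 1 - s))) \<partial>lborel)
        = ennreal (Gamma (1 - s) / s) * ennreal (indicator {0..} q * q powr (b + s - 1) * exp (- (1 * q)))"
    proof (cases "q \<ge> 0")
      case True
      have pw: "q powr (b - 1) * q powr s = q powr (b + s - 1)" by (simp add: powr_add[symmetric] algebra_simps)
      have "(\<integral>\<^sup>+r. ennreal (?g q * exp (- q)) * ennreal ((1 - exp (- (q * r))) * (indicator {0<..} r * r powr (- 1 - s))) \<partial>lborel)
          = ennreal (?g q * exp (- q)) * ennreal (Gamma (1 - s) / s * q powr s)"
        unfolding nn_integral_power_laplace_difference[OF s True, symmetric] by (rule nn_integral_cmult) measurable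
      also have "\<dots> = ennreal (Gamma (1 - s) / s) * ennreal (indicator {0..} q * q powr (b + s - 1) * exp (- (1 * q)))"
        using True s unfolding pw[symmetric] by (simp add: ennreal_mult[symmetric] Gamma_real_nonneg mult_ac)
      finally show ?thesis .
    qed (auto simp: indicator_def)
  qed
  also have "\<dots> = ennreal (Gamma (1 - s) / s) * ennreal (Gamma (b + s))"
    using s b nn_integral_gamma_laplace[of "b + s" 1] by (subst nn_integral_cmult) auto
  finally have "ennreal (1 / Gamma b) * (ennreal (Gamma b) * (\<integral>\<^sup>+r. ennreal ((1 - (1 + r) powr (- b)) * (indicator {0<..} r * r powr (- 1 - s))) \<partial>lborel))
     = ennreal (1 / Gamma b) * (ennreal (Gamma (1 - s) / s) * ennreal (Gamma (b + s)))" by simp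
  then show ?thesis using Gb s b
    by (simp add: mult.assoc[symmetric] ennreal_mult[symmetric] Gamma_real_nonneg)
qed

lemma has_integral_power_difference:
  fixes s b :: real
  assumes s: "0 < s" "s < 1" and b: "b > 0"
  shows "has_bochner_integral lborel (\<lambda>r. (1 - (1 + r) powr (- b)) * (indicator {0<..} r * r powr (- 1 - s))) (Gamma (1 - s) / s * (Gamma (b + s) / Gamma b))"
proof (rule has_bochner_integral_nn_integral[OF _ _ _ nn_integral_power_difference[OF assms]])
  have "1 - (1 + r) powr (- b) \<ge> 0" if "r > 0" for r
    using that b one_plus_powr_minus_le_one[of r b] by simp
  then show "AE r in lborel. 0 \<le> (1 - (1 + r) powr (- b)) * (indicator {0<..} r * r powr (- 1 - s))"
    by (intro AE_I2) (auto simp: indicator_def)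
  show "0 \<le> Gamma (1 - s) / s * (Gamma (b + s) / Gamma b)"
    using s b by (intro mult_nonneg_nonneg divide_nonneg_nonneg Gamma_real_nonneg) auto
qed measurable

text \<open>In the variable exp (- t) the hypotheses say that moments vanish, and Stone-Weierstrass
  approximates \<open>h\<close> itself, suitably weighted, by polynomials. Pairing \<open>h\<close>
  with its approximations makes a weighted integral of h^2 arbitrarily small.\<close>

lemma laplace_transform_injective_real:
  fixes h :: "real \<Rightarrow> real"
  assumes cont: "continuous_on UNIV h" and zero: "\<And>t. t \<le> 0 \<Longrightarrow> h t = 0"
    and bound: "\<And>t. \<bar>h t\<bar> \<le> C * exp t"
    and laplace: "\<And>n::nat. n \<ge> 3 \<Longrightarrow> (\<integral>t. exp (- (real n * t)) * h t \<partial>lborel) = 0"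
  shows "h t = 0"
proof -
  have [measurable]: "h \<in> borel_measurable borel" using cont by (rule borel_measurable_continuous_onI)
  have C0: "C \<ge> 0" using bound[of 0] by simp
  have int: "integrable lborel (\<lambda>t. exp (- (real n * t)) * h t)" if "n \<ge> 2" for n
  proof (rule Bochner_Integration.integrable_bound)
    show "integrable lborel (\<lambda>t. C * (indicator {0..} t * t powr (1 - 1) * exp (- (1 * t))))"
      using has_integral_gamma_laplace[of 1 1] by (intro integrable_mult_right) (simp add: has_bochner_integral_iff)
    show "AE t in lborel. norm (exp (- (real n * t)) * h t) \<le> norm (C * (indicator {0..} t * t powr (1 - 1) * exp (- (1 * t))))"
      using AE_lborel_singleton[of 0]
    proof eventually_elim
      case (elim t)
      show ?case
      proof (cases "t > 0")
        case True
        have "exp (- (real n * t)) * \<bar>h t\<bar> \<le> exp (- (2 * t)) * (C * exp t)"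
          using bound[of t] True that by (intro mult_mono) (auto intro!: mult_right_mono)
        also have "\<dots> = C * exp (- t)" by (simp add: exp_add[symmetric])
        finally show ?thesis using True C0 by (simp add: abs_mult)
      qed (use zero elim in auto)
    qed
  qed measurable
  \<comment> \<open>In this variable the growth exp t is 1 / x: one factor \<open>x\<close> makes
    the product bounded, the second makes it tend to 0 at the origin, so that it extends
    continuously to the closed interval.\<close>
  define k where "k x = x\<^sup>2 * h (- ln x)" for x :: real
  have k_cont: "continuous_on {0..1} k"
  proof (rule continuous_at_imp_continuous_on, rule ballI)
    fix x :: real assume "x \<in> {0..1}"
    then consider "x = 0" | "x > 0" by force
    then show "isCont k x"
    proof cases
      case 1
      \<comment> \<open>\<open>isCont\<close> asks for a two-sided limit, so the estimate also
        covers negative \<open>x\<close>, with the values that \<open>ln\<close> takes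
        there.\<close>
      have "(k \<longlongrightarrow> 0) (at 0)"
      proof (rule Lim_null_comparison)
        have "\<forall>\<^sub>F x :: real in at 0. \<bar>x\<bar> < 1"
          by (rule order_tendstoD(2)[where y = 0]) (auto intro: tendsto_eq_intros)
        moreover have "\<forall>\<^sub>F x :: real in at 0. x \<noteq> 0" by (rule eventually_neq_at_within)
        ultimately show "\<forall>\<^sub>F x in at 0. norm (k x) \<le> C * \<bar>x\<bar>"
        proof eventually_elim
          case (elim x)
          have "\<bar>h (- ln x)\<bar> \<le> C / \<bar>x\<bar>"
            using bound[of "- ln x"] elim by (cases "x > 0") (auto simp: exp_minus exp_ln_iff ln_real_def divide_inverse)
          then have "x\<^sup>2 * \<bar>h (- ln x)\<bar> \<le> x\<^sup>2 * (C / \<bar>x\<bar>)" by (intro mult_left_mono) auto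
          also have "\<dots> = C * \<bar>x\<bar>" using elim by (simp add: power2_eq_square abs_if field_simps)
          finally show ?case by (simp add: k_def abs_mult)
        qed
        show "((\<lambda>x. C * \<bar>x\<bar>) \<longlongrightarrow> 0) (at 0)" by (auto intro!: tendsto_eq_intros)
      qed
      then show ?thesis using 1 by (simp add: isCont_def k_def)
    next
      case 2
      have "isCont h y" for y using cont by (simp add: continuous_on_eq_continuous_at)
      then have "isCont (\<lambda>x. h (- ln x)) x"
        using 2 by (intro isCont_o2[of x "\<lambda>x. - ln x" h]) (auto intro!: continuous_intros)
      then show ?thesis unfolding k_def[abs_def] by (intro continuous_intros)
    qed
  qed
  define J where "J = (\<integral>t. exp (- (real 3 * t)) * \<bar>h t\<bar> \<partial>lborel)"
  have intJ: "integrable lborel (\<lambda>t. exp (- (real 3 * t)) * \<bar>h t\<bar>)"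
    using integrable_abs[OF int[of 3]] by (simp add: abs_mult)
  have J0: "J \<ge> 0" unfolding J_def by simp
  have int5: "integrable lborel (\<lambda>t. exp (- (5 * t)) * (h t)\<^sup>2)"
  proof (rule Bochner_Integration.integrable_bound)
    show "integrable lborel (\<lambda>t. C * (exp (- (real 3 * t)) * \<bar>h t\<bar>))" by (intro integrable_mult_right intJ)
    show "AE t in lborel. norm (exp (- (5 * t)) * (h t)\<^sup>2) \<le> norm (C * (exp (- (real 3 * t)) * \<bar>h t\<bar>))"
    proof (rule AE_I2)
      fix t :: real
      show "norm (exp (- (5 * t)) * (h t)\<^sup>2) \<le> norm (C * (exp (- (real 3 * t)) * \<bar>h t\<bar>))"
      proof (cases "t \<le> 0")
        case False
        have "exp (- (5 * t)) * (h t)\<^sup>2 = (exp (- (3 * t)) * \<bar>h t\<bar>) * (exp (- (2 * t)) * \<bar>h t\<bar>)"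
        proof -
          have "exp (- (5 * t)) = exp (- (3 * t)) * exp (- (2 * t))" by (simp add: exp_add[symmetric])
          moreover have "(h t)\<^sup>2 = \<bar>h t\<bar> * \<bar>h t\<bar>" by (simp add: power2_eq_square)
          ultimately show ?thesis by (simp only: mult_ac)
        qed
        also have "exp (- (2 * t)) * \<bar>h t\<bar> \<le> exp (- (2 * t)) * (C * exp t)" using bound by (intro mult_left_mono) auto
        also have "exp (- (2 * t)) * (C * exp t) = C * exp (- t)" by (simp add: exp_add[symmetric])
        also have "C * exp (- t) \<le> C * 1" using False C0 by (intro mult_left_mono) auto
        finally have "exp (- (5 * t)) * (h t)\<^sup>2 \<le> (exp (- (3 * t)) * \<bar>h t\<bar>) * (C * 1)"
          by (simp add: mult_left_mono)
        then show ?thesis using C0 by (simp add: abs_mult mult_ac)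
      qed (simp add: zero)
    qed
  qed measurable
  \<comment> \<open>Here 5 = 2 + 3: exp (- 5 * t) * (h t)^2 is \<open>k (exp (- t))\<close> times
    exp (- 3 * t) * h t. Replacing \<open>k\<close> by a polynomial costs at most
    \<open>e * J\<close>, and the polynomial part is a combination of Laplace integrals with n \<ge>
    3, all of them 0.\<close>
  have small: "(\<integral>t. exp (- (5 * t)) * (h t)\<^sup>2 \<partial>lborel) \<le> e * J" if e: "e > 0" for e
  proof -
    obtain g where g: "real_polynomial_function g" "\<And>x. x \<in> {0..1} \<Longrightarrow> \<bar>k x - g x\<bar> < e"
      using Stone_Weierstrass_real_polynomial_function[OF compact_Icc k_cont e] by auto
    then obtain a n where ga: "g = (\<lambda>x. \<Sum>i\<le>n. a i * x ^ i)" by (auto simp: real_polynomial_function_iff_sum)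
    have gt: "g (exp (- t)) * (exp (- (3 * t)) * h t) = (\<Sum>i\<le>n. a i * (exp (- (real (i + 3) * t)) * h t))" for t
    proof -
      have "exp (- t) ^ i * exp (- (3 * t)) = exp (- (real (i + 3) * t))" for i
        by (simp add: exp_of_nat_mult[symmetric] exp_add[symmetric] algebra_simps)
      then show ?thesis unfolding ga sum_distrib_right by (intro sum.cong) (auto simp: mult_ac)
    qed
    have gi: "integrable lborel (\<lambda>t. g (exp (- t)) * (exp (- (3 * t)) * h t))"
      unfolding gt by (intro Bochner_Integration.integrable_sum integrable_mult_right int) auto
    have g0: "(\<integral>t. g (exp (- t)) * (exp (- (3 * t)) * h t) \<partial>lborel) = 0"
    proof -
      have "(\<integral>t. g (exp (- t)) * (exp (- (3 * t)) * h t) \<partial>lborel) = (\<Sum>i\<le>n. \<integral>t. a i * (exp (- (real (i + 3) * t)) * h t) \<partial>lborel)"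
        unfolding gt by (rule Bochner_Integration.integral_sum) (intro integrable_mult_right int, simp)
      also have "\<dots> = 0"
        by (intro sum.neutral ballI) (simp only: integral_mult_right_zero laplace[of "_ + 3"] le_add2 mult_zero_right simp_thms)
      finally show ?thesis .
    qed
    have "(\<integral>t. exp (- (5 * t)) * (h t)\<^sup>2 \<partial>lborel) = (\<integral>t. exp (- (5 * t)) * (h t)\<^sup>2 - g (exp (- t)) * (exp (- (3 * t)) * h t) \<partial>lborel)"
      using int5 gi g0 by simp
    also have "\<dots> \<le> (\<integral>t. e * (exp (- (real 3 * t)) * \<bar>h t\<bar>) \<partial>lborel)"
    proof (rule integral_mono)
      show "integrable lborel (\<lambda>t. exp (- (5 * t)) * (h t)\<^sup>2 - g (exp (- t)) * (exp (- (3 * t)) * h t))"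
        using int5 gi by auto
      show "integrable lborel (\<lambda>t. e * (exp (- (real 3 * t)) * \<bar>h t\<bar>))" by (intro integrable_mult_right intJ)
      fix t :: real
      show "exp (- (5 * t)) * (h t)\<^sup>2 - g (exp (- t)) * (exp (- (3 * t)) * h t) \<le> e * (exp (- (real 3 * t)) * \<bar>h t\<bar>)"
      proof (cases "t \<le> 0")
        case False
        then have "\<bar>k (exp (- t)) - g (exp (- t))\<bar> < e" by (intro g) auto
        moreover have "exp (- (5 * t)) * (h t)\<^sup>2 - g (exp (- t)) * (exp (- (3 * t)) * h t) = (k (exp (- t)) - g (exp (- t))) * (exp (- (3 * t)) * h t)"
          by (simp add: k_def power2_eq_square algebra_simps exp_add[symmetric])
        moreover have "(k (exp (- t)) - g (exp (- t))) * (exp (- (3 * t)) * h t) \<le> \<bar>k (exp (- t)) - g (exp (- t))\<bar> * \<bar>exp (- (3 * t)) * h t\<bar>"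
          by (metis abs_ge_self abs_mult)
        moreover have "\<bar>k (exp (- t)) - g (exp (- t))\<bar> * \<bar>exp (- (3 * t)) * h t\<bar> \<le> e * \<bar>exp (- (3 * t)) * h t\<bar>"
          using calculation(1) by (intro mult_right_mono) auto
        ultimately show ?thesis by (simp add: abs_mult)
      qed (simp add: zero)
    qed
    also have "\<dots> = e * J" unfolding J_def by simp
    finally show ?thesis .
  qed
  have "(\<integral>t. exp (- (5 * t)) * (h t)\<^sup>2 \<partial>lborel) \<le> 0"
  proof (rule field_le_epsilon)
    fix e :: real assume "e > 0"
    have "(\<integral>t. exp (- (5 * t)) * (h t)\<^sup>2 \<partial>lborel) \<le> e / (J + 1) * J" using \<open>e > 0\<close> J0 by (intro small) auto
    also have "\<dots> \<le> e" using \<open>e > 0\<close> J0 by (simp add: field_simps)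
    finally show "(\<integral>t. exp (- (5 * t)) * (h t)\<^sup>2 \<partial>lborel) \<le> 0 + e" by simp
  qed
  moreover have "(\<integral>t. exp (- (5 * t)) * (h t)\<^sup>2 \<partial>lborel) \<ge> 0" by simp
  ultimately have "AE t in lborel. exp (- (5 * t)) * (h t)\<^sup>2 = 0"
    using integral_nonneg_eq_0_iff_AE[OF int5] by auto
  then have "AE t in lborel. t \<notin> {t. h t \<noteq> 0}" by simp
  \<comment> \<open>A nonempty open set is not null, which turns the almost everywhere statement
    into a pointwise one.\<close>
  moreover have op: "open {t. h t \<noteq> 0}" using cont by (intro open_Collect_neq) (auto intro: continuous_intros)
  ultimately have "{t. h t \<noteq> 0} \<in> null_sets lborel"
    by (subst AE_iff_null_sets) auto
  then have "negligible {t. h t \<noteq> 0}"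
    by (simp add: negligible_iff_null_sets null_sets_completionI)
  with op have "{t. h t \<noteq> 0} = {}" using open_not_negligible by blast
  then show ?thesis by auto
qed

lemma laplace_transform_injective:
  fixes h :: "real \<Rightarrow> complex"
  assumes cont: "continuous_on UNIV h" and zero: "\<And>t. t \<le> 0 \<Longrightarrow> h t = 0"
    and bound: "\<And>t. cmod (h t) \<le> C * exp t"
    and int: "\<And>n::nat. n \<ge> 3 \<Longrightarrow> integrable lborel (\<lambda>t. exp (- (real n * t)) *\<^sub>R h t)"
    and laplace: "\<And>n::nat. n \<ge> 3 \<Longrightarrow> (\<integral>t. exp (- (real n * t)) *\<^sub>R h t \<partial>lborel) = 0"
  shows "h t = 0"
proof -
  have "Re (h t) = 0"
  proof (rule laplace_transform_injective_real[where h = "\<lambda>t. Re (h t)" and C = C])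
    show "\<bar>Re (h t)\<bar> \<le> C * exp t" for t using abs_Re_le_cmod[of "h t"] bound[of t] by linarith
    show "(\<integral>t. exp (- (real n * t)) * Re (h t) \<partial>lborel) = 0" if "n \<ge> 3" for n :: nat
      using integral_Re[OF int[OF that]] laplace[OF that] by simp
  qed (use cont zero in \<open>auto intro!: continuous_intros\<close>)
  moreover have "Im (h t) = 0"
  proof (rule laplace_transform_injective_real[where h = "\<lambda>t. Im (h t)" and C = C])
    show "\<bar>Im (h t)\<bar> \<le> C * exp t" for t using abs_Im_le_cmod[of "h t"] bound[of t] by linarith
    show "(\<integral>t. exp (- (real n * t)) * Im (h t) \<partial>lborel) = 0" if "n \<ge> 3" for n :: nat
      using integral_Im[OF int[OF that]] laplace[OF that] by simp
  qed (use cont zero in \<open>auto intro!: continuous_intros\<close>)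
  ultimately show ?thesis by (simp add: complex_eq_iff)
qed

text \<open>Integrals over \<open>p\<close> that depend on a level \<open>t\<close> and are to be
  compared through their Laplace transforms in \<open>t\<close>. One majorant \<open>D T\<close>
  serves all levels up to \<open>T\<close>: it gives continuity in the level, and the growth of its
  mass gives the exponential bound under which the Laplace transform is injective.\<close>

locale laplace_dominated =
  fixes G :: "real \<Rightarrow> 'p::euclidean_space \<Rightarrow> complex" and D :: "real \<Rightarrow> 'p \<Rightarrow> real" and C :: real
  assumes G_measurable: "(\<lambda>(t, p). G t p) \<in> borel_measurable (lborel \<Otimes>\<^sub>M lborel)"
    and G_cont: "\<And>p. continuous_on UNIV (\<lambda>t. G t p)"
    and G_zero: "\<And>t p. t \<le> 0 \<Longrightarrow> G t p = 0"
    and D_measurable: "\<And>T. D T \<in> borel_measurable lborel"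
    and dominated: "\<And>t T p. t \<le> T \<Longrightarrow> 0 \<le> T \<Longrightarrow> cmod (G t p) \<le> D T p"
    and C_nonneg: "0 \<le> C"
    and D_bound: "\<And>T. 0 \<le> T \<Longrightarrow> (\<integral>\<^sup>+p. ennreal (D T p) \<partial>lborel) \<le> ennreal (C * exp T)"
begin

lemma measurable_slices: "G t \<in> borel_measurable lborel" "(\<lambda>t. G t p) \<in> borel_measurable lborel"
  using measurable_Pair2[OF G_measurable, of t] measurable_Pair1[OF G_measurable, of p] by simp_all

lemma D_nonneg: "0 \<le> T \<Longrightarrow> 0 \<le> D T p"
  using dominated[of T T p] norm_ge_zero order_trans by blast

lemma D_integrable: "0 \<le> T \<Longrightarrow> integrable lborel (D T)"
  using D_bound[of T] D_measurable[of T] D_nonneg[of T]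
  by (auto simp: integrable_iff_bounded intro: le_less_trans)

lemma D_integral_le: "0 \<le> T \<Longrightarrow> (\<integral>p. D T p \<partial>lborel) \<le> C * exp T"
  using D_bound[of T] D_integrable[of T] D_nonneg[of T] C_nonneg
  by (simp add: nn_integral_eq_integral)

lemma G_integrable: "integrable lborel (G t)"
  by (rule Bochner_Integration.integrable_bound[OF D_integrable[of "max 0 t"]])
    (use measurable_slices dominated[of t "max 0 t"] D_nonneg[of "max 0 t"] in auto)

definition F :: "real \<Rightarrow> complex" where "F t = (\<integral>p. G t p \<partial>lborel)"

lemma F_zero: "t \<le> 0 \<Longrightarrow> F t = 0"
  by (simp add: F_def G_zero)

lemma norm_G_integral_le: "(\<integral>p. cmod (G t p) \<partial>lborel) \<le> C * exp t"
proof (cases "t \<le> 0")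
  case False
  have "(\<integral>p. cmod (G t p) \<partial>lborel) \<le> (\<integral>p. D t p \<partial>lborel)"
    using False by (intro integral_mono integrable_norm G_integrable D_integrable dominated) auto
  also have "\<dots> \<le> C * exp t" using False by (intro D_integral_le) auto
  finally show ?thesis .
qed (simp add: G_zero C_nonneg)

lemma F_bound: "cmod (F t) \<le> C * exp t"
  unfolding F_def using integral_norm_bound norm_G_integral_le order_trans by blast

lemma F_cont: "continuous_on UNIV F"
proof (rule continuous_at_imp_continuous_on, rule ballI)
  fix t :: real
  have "(F \<longlongrightarrow> F t) (at t)"
    unfolding tendsto_at_iff_sequentially
  proof safe
    fix X :: "nat \<Rightarrow> real" assume X: "X \<longlonglongrightarrow> t"
    \<comment> \<open>The levels \<open>X n\<close> lie below one \<open>B\<close>, and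
      \<open>D B\<close> dominates all of them at once.\<close>
    have "Bseq X" by (rule convergent_imp_Bseq[OF convergentI[OF X]])
    then obtain B where B: "\<And>n. norm (X n) \<le> B" unfolding Bseq_def by blast
    have B0: "B \<ge> 0" using B[of 0] norm_ge_zero order_trans by blast
    show "(F \<circ> X) \<longlonglongrightarrow> F t"
      unfolding o_def F_def
    proof (rule integral_dominated_convergence[where w = "D B"])
      show "AE p in lborel. (\<lambda>n. G (X n) p) \<longlonglongrightarrow> G t p"
        using G_cont X by (intro AE_I2 isCont_tendsto_compose[of t "\<lambda>t. G t _"]) (auto simp: continuous_on_eq_continuous_at)
      show "AE p in lborel. norm (G (X n) p) \<le> D B p" for n
        using B[of n] B0 by (intro AE_I2 dominated) auto
    qed (use measurable_slices D_integrable B0 in auto)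
  qed
  then show "isCont F t" by (simp add: isCont_def)
qed

lemma exp_integrable: "integrable lborel (\<lambda>t. C * (indicator {0<..} t * exp (- t)))"
proof -
  have "integrable lborel (\<lambda>t. indicator {0..} t * t powr (1 - 1) * exp (- (1 * t)) :: real)"
    using has_integral_gamma_laplace[of 1 1] by (simp add: has_bochner_integral_iff)
  moreover have "(\<lambda>t. indicator {0..} t * t powr (1 - 1) * exp (- (1 * t)) :: real) = (\<lambda>t. indicator {0<..} t * exp (- t))"
    by (auto simp: fun_eq_iff indicator_def)
  ultimately show ?thesis by simp
qed

text \<open>The factor exp (- 2 * t) absorbs the growth exp t and leaves an integrable exp (- t);
  this is why n starts at 2.\<close>

lemma laplace_bound:
  assumes n: "n \<ge> 2" and g: "\<And>t. t \<le> 0 \<Longrightarrow> g t = 0" "\<And>t. g t \<le> C * exp t" "0 \<le> g t"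
  shows "exp (- (real n * t)) * g t \<le> C * (indicator {0<..} t * exp (- t))"
proof (cases "t > 0")
  case True
  have "exp (- (real n * t)) * g t \<le> exp (- (2 * t)) * (C * exp t)"
    using g(2)[of t] g(3) True n by (intro mult_mono) (auto intro!: mult_right_mono)
  also have "\<dots> = C * exp (- t)" by (simp add: exp_add[symmetric])
  finally show ?thesis using True by simp
qed (use C_nonneg g in auto)

lemma F_laplace_integrable:
  assumes n: "n \<ge> 2"
  shows "integrable lborel (\<lambda>t. exp (- (real n * t)) *\<^sub>R F t)"
proof (rule Bochner_Integration.integrable_bound[OF exp_integrable])
  have [measurable]: "F \<in> borel_measurable borel" by (rule borel_measurable_continuous_onI[OF F_cont])
  show "(\<lambda>t. exp (- (real n * t)) *\<^sub>R F t) \<in> borel_measurable lborel" by measurable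
  show "AE t in lborel. norm (exp (- (real n * t)) *\<^sub>R F t) \<le> norm (C * (indicator {0<..} t * exp (- t)))"
    using laplace_bound[OF n, of "\<lambda>t. cmod (F t)"] F_bound F_zero
    by (auto intro!: AE_I2 order_trans[OF _ abs_ge_self])
qed

lemma laplace_pair_integrable:
  assumes n: "n \<ge> 2"
  shows "integrable (lborel \<Otimes>\<^sub>M lborel) (\<lambda>(t, p). exp (- (real n * t)) *\<^sub>R G t p)"
proof (rule lborel_pair.Fubini_integrable)
  note [measurable] = G_measurable
  show "(\<lambda>(t, p). exp (- (real n * t)) *\<^sub>R G t p) \<in> borel_measurable (lborel \<Otimes>\<^sub>M lborel)" by measurable
  have "integrable lborel (\<lambda>t. exp (- (real n * t)) * (\<integral>p. cmod (G t p) \<partial>lborel))"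
  proof (rule Bochner_Integration.integrable_bound[OF exp_integrable])
    show "(\<lambda>t. exp (- (real n * t)) * (\<integral>p. cmod (G t p) \<partial>lborel)) \<in> borel_measurable lborel" by measurable
    show "AE t in lborel. norm (exp (- (real n * t)) * (\<integral>p. cmod (G t p) \<partial>lborel)) \<le> norm (C * (indicator {0<..} t * exp (- t)))"
      using laplace_bound[OF n, of "\<lambda>t. \<integral>p. cmod (G t p) \<partial>lborel"] norm_G_integral_le G_zero
      by (auto intro!: AE_I2 order_trans[OF _ abs_ge_self[of "C * _"]])
  qed
  then show "integrable lborel (\<lambda>t. \<integral>p. norm (case (t, p) of (t, p) \<Rightarrow> exp (- (real n * t)) *\<^sub>R G t p) \<partial>lborel)"
    by simp
  show "AE t in lborel. integrable lborel (\<lambda>p. case (t, p) of (t, p) \<Rightarrow> exp (- (real n * t)) *\<^sub>R G t p)"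
    by (simp add: G_integrable)
qed

lemma F_laplace:
  assumes n: "n \<ge> 2"
  shows "(\<integral>t. exp (- (real n * t)) *\<^sub>R F t \<partial>lborel) = (\<integral>p. (\<integral>t. exp (- (real n * t)) *\<^sub>R G t p \<partial>lborel) \<partial>lborel)"
    and "integrable lborel (\<lambda>p. \<integral>t. exp (- (real n * t)) *\<^sub>R G t p \<partial>lborel)"
proof -
  have "(\<integral>t. exp (- (real n * t)) *\<^sub>R F t \<partial>lborel) = (\<integral>t. (\<integral>p. exp (- (real n * t)) *\<^sub>R G t p \<partial>lborel) \<partial>lborel)"
    by (simp add: F_def)
  then show "(\<integral>t. exp (- (real n * t)) *\<^sub>R F t \<partial>lborel) = (\<integral>p. (\<integral>t. exp (- (real n * t)) *\<^sub>R G t p \<partial>lborel) \<partial>lborel)"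
    using lborel_pair.Fubini_integral[OF laplace_pair_integrable[OF n]] by simp
  show "integrable lborel (\<lambda>p. \<integral>t. exp (- (real n * t)) *\<^sub>R G t p \<partial>lborel)"
    by (rule lborel_pair.integrable_snd[OF laplace_pair_integrable[OF n]])
qed

end

text \<open>The two parameter spaces may differ: the lemma will compare an integral over
  \<open>x\<close> with one over pairs \<open>(r, x)\<close>.\<close>

lemma laplace_dominated_eqI:
  assumes A: "laplace_dominated G D C" and B: "laplace_dominated G' D' C'"
    and eq: "\<And>n::nat. n \<ge> 3 \<Longrightarrow> (\<integral>p. (\<integral>t. exp (- (real n * t)) *\<^sub>R G t p \<partial>lborel) \<partial>lborel)
       = (\<integral>p. (\<integral>t. exp (- (real n * t)) *\<^sub>R G' t p \<partial>lborel) \<partial>lborel)"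
  shows "(\<integral>p. G t p \<partial>lborel) = (\<integral>p. G' t p \<partial>lborel)"
proof -
  interpret A: laplace_dominated G D C by (rule A)
  interpret B: laplace_dominated G' D' C' by (rule B)
  have "A.F t - B.F t = 0"
  proof (rule laplace_transform_injective[where h = "\<lambda>t. A.F t - B.F t" and C = "C + C'"])
    show "cmod (A.F t - B.F t) \<le> (C + C') * exp t" for t
      using norm_triangle_ineq4[of "A.F t" "B.F t"] A.F_bound[of t] B.F_bound[of t] by (simp add: distrib_right)
    show "integrable lborel (\<lambda>t. exp (- (real n * t)) *\<^sub>R (A.F t - B.F t))" if "n \<ge> 3" for n
      using that A.F_laplace_integrable[of n] B.F_laplace_integrable[of n] by (simp add: scaleR_diff_right)
    show "(\<integral>t. exp (- (real n * t)) *\<^sub>R (A.F t - B.F t) \<partial>lborel) = 0" if "n \<ge> 3" for n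
      using that A.F_laplace_integrable[of n] B.F_laplace_integrable[of n] A.F_laplace(1)[of n] B.F_laplace(1)[of n] eq[OF that]
      by (simp add: scaleR_diff_right)
  qed (use A.F_zero B.F_zero A.F_cont B.F_cont in \<open>auto intro!: continuous_intros\<close>)
  then show ?thesis by (simp add: A.F_def B.F_def)
qed

subsection \<open>The truncated quadratic and its dilations\<close>

lemma lborel_nn_integral_scale:
  fixes f :: "'a::euclidean_space \<Rightarrow> ennreal"
  assumes c: "c > 0" and [measurable]: "f \<in> borel_measurable borel"
  shows "(\<integral>\<^sup>+x. f x \<partial>lborel) = ennreal (c ^ DIM('a)) * (\<integral>\<^sup>+x. f (c *\<^sub>R x) \<partial>lborel)"
  using c by (subst lborel_affine[of c 0]) (auto simp: nn_integral_density nn_integral_distr nn_integral_cmult)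

text \<open>Up to a constant, the density of the Levy measure of the \<open>s\<close>-stable
  subordinator.\<close>

definition levy_weight :: "real \<Rightarrow> real \<Rightarrow> real" where
  "levy_weight s r = indicator {0<..} r * r powr (- 1 - s)"

definition cap :: "real \<Rightarrow> 'a::euclidean_space \<Rightarrow> real" where
  "cap t x = max 0 (t - (norm x)\<^sup>2)"

text \<open>The dilation of \<open>cap t\<close> by sqrt (1 + r) with its mass preserved, written
  without the square root.\<close>

definition dilated_cap :: "real \<Rightarrow> real \<Rightarrow> 'a::euclidean_space \<Rightarrow> real" where
  "dilated_cap t r x = (1 + r) powr (- (real DIM('a) / 2)) * max 0 (t - (norm x)\<^sup>2 / (1 + r))"

text \<open>Near r = 0 the bound has to vanish linearly in \<open>r\<close> in order to beat r^(- 1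
  - s); for r \<le> 1 both caps are supported where the squared norm is at most 2 * T. For r > 1 the
  weight is integrable and the sum of the caps is good enough. For r < 0 the formula may be
  negative, but there the weight is 0.\<close>

definition cap_majorant :: "real \<Rightarrow> real \<times> 'a::euclidean_space \<Rightarrow> real" where
  "cap_majorant T p = (if fst p \<le> 1 then (2 + real DIM('a) / 2) * T * fst p * (if (norm (snd p))\<^sup>2 \<le> 2 * T then 1 else 0)
     else cap T (snd p) + dilated_cap T (fst p) (snd p))"

lemma levy_weight_measurable [measurable]: "levy_weight s \<in> borel_measurable borel"
  unfolding levy_weight_def by measurable

lemma cap_measurable [measurable]: "cap t \<in> borel_measurable borel"
  unfolding cap_def by measurable

lemma levy_weight_nonneg [simp]: "0 \<le> levy_weight s r"
  by (simp add: levy_weight_def)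

lemma levy_weight_zero: "r \<le> 0 \<Longrightarrow> levy_weight s r = 0"
  by (simp add: levy_weight_def)

lemma cap_nonneg [simp]: "0 \<le> cap t x" and dilated_cap_nonneg [simp]: "0 \<le> dilated_cap t r x"
  by (simp_all add: cap_def dilated_cap_def)

lemma cap_zero:
  assumes "t \<le> 0" shows "cap t x = 0"
  using assms zero_le_power2[of "norm x"] unfolding cap_def by linarith

lemma dilated_cap_zero:
  assumes "t \<le> 0" "0 \<le> r" shows "dilated_cap t r x = 0"
proof -
  have "0 \<le> (norm x)\<^sup>2 / (1 + r)" using assms by simp
  then have "max 0 (t - (norm x)\<^sup>2 / (1 + r)) = 0" using assms by linarith
  then show ?thesis by (simp add: dilated_cap_def)
qed

lemma cap_mono: "t \<le> T \<Longrightarrow> cap t x \<le> cap T x"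
  by (auto simp: cap_def)

lemma dilated_cap_mono: "t \<le> T \<Longrightarrow> dilated_cap t r x \<le> dilated_cap T r x"
  unfolding dilated_cap_def by (intro mult_left_mono) auto

lemma one_minus_powr_le:
  fixes r b :: real
  assumes "0 \<le> r" "0 \<le> b"
  shows "1 - (1 + r) powr (- b) \<le> b * r"
proof -
  have "1 - b * r \<le> 1 + (- b) * ln (1 + r)"
    using assms ln_add_one_self_le_self[of r] by (simp add: mult_left_mono)
  also have "\<dots> \<le> exp ((- b) * ln (1 + r))" by (rule exp_ge_add_one_self)
  also have "\<dots> = (1 + r) powr (- b)" using assms by (simp add: powr_def)
  finally show ?thesis by simp
qed

text \<open>For r \<le> 1 two effects are separated. Spreading the quadratic moves the positive part
  by at most \<rho> * r \<le> 2 * T * r, and shrinking its height costs at most a fraction DIM * r /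
  2 of \<open>T\<close>.\<close>

lemma cap_difference_le_majorant:
  fixes x :: "'a::euclidean_space"
  assumes r: "0 < r" and T: "0 \<le> T" "t \<le> T"
  shows "\<bar>cap t x - dilated_cap t r x\<bar> \<le> cap_majorant T (r, x)"
proof (cases "r \<le> 1")
  case False
  have "\<bar>cap t x - dilated_cap t r x\<bar> \<le> cap t x + dilated_cap t r x"
    using cap_nonneg[of t x] dilated_cap_nonneg[of t r x] by linarith
  also have "\<dots> \<le> cap T x + dilated_cap T r x" using T by (intro add_mono cap_mono dilated_cap_mono)
  finally show ?thesis using False by (simp add: cap_majorant_def)
next
  case r1: True
  define m where "m = (1 + r) powr (- (real DIM('a) / 2))"
  define \<rho> where "\<rho> = (norm x)\<^sup>2"
  have \<rho>0: "\<rho> \<ge> 0" by (simp add: \<rho>_def)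
  have m: "0 \<le> m" "m \<le> 1" "1 - m \<le> real DIM('a) / 2 * r"
    unfolding m_def using r one_plus_powr_minus_le_one[of r "real DIM('a) / 2"] one_minus_powr_le[of r "real DIM('a) / 2"]
    by auto
  show ?thesis
  proof (cases "t \<le> 0")
    case True
    then show ?thesis using r T r1
      by (simp add: cap_zero dilated_cap_zero cap_majorant_def)
  next
    case False
    show ?thesis
    proof (cases "\<rho> \<le> 2 * t")
      case True
      define a b where "a = t - \<rho>" and "b = t - \<rho> / (1 + r)"
      have ab: "\<bar>max 0 a - max 0 b\<bar> \<le> 2 * T * r"
      proof -
        have "b - a = \<rho> * r / (1 + r)" using r by (simp add: a_def b_def field_simps)
        moreover have "\<rho> * r / (1 + r) \<le> \<rho> * r" using r \<rho>0 by (simp add: divide_le_eq mult_left_mono algebra_simps)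
        moreover have "\<rho> * r / (1 + r) \<ge> 0" using r \<rho>0 by simp
        moreover have "\<rho> * r \<le> 2 * T * r" using True T r by (intro mult_right_mono) auto
        ultimately show ?thesis by linarith
      qed
      have "\<rho> / (1 + r) \<ge> 0" using r \<rho>0 by simp
      then have b: "0 \<le> max 0 b" "max 0 b \<le> T" using T unfolding b_def by auto
      have "(1 - m) * max 0 b \<le> real DIM('a) / 2 * r * T"
        using m b r T by (intro mult_mono) auto
      moreover have "0 \<le> (1 - m) * max 0 b" using m b by simp
      moreover have "cap t x - dilated_cap t r x = (max 0 a - max 0 b) + (1 - m) * max 0 b"
        by (simp add: cap_def dilated_cap_def a_def b_def m_def \<rho>_def algebra_simps)
      ultimately have "\<bar>cap t x - dilated_cap t r x\<bar> \<le> 2 * T * r + real DIM('a) / 2 * r * T"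
        using ab by linarith
      also have "\<dots> = cap_majorant T (r, x)"
        using r1 True T by (simp add: cap_majorant_def \<rho>_def algebra_simps)
      finally show ?thesis .
    next
      case nt: False
      \<comment> \<open>Beyond \<rho> = 2 * t even the spread-out cap vanishes.\<close>
      have "\<rho> / (1 + r) \<ge> \<rho> / 2" using r r1 \<rho>0 by (intro divide_left_mono) auto
      then have "max 0 (t - \<rho>) = 0" "max 0 (t - \<rho> / (1 + r)) = 0"
        using nt False by auto
      then have "cap t x = 0" "dilated_cap t r x = 0"
        by (simp_all add: cap_def dilated_cap_def \<rho>_def[symmetric])
      then show ?thesis using r r1 T by (simp add: cap_majorant_def)
    qed
  qed
qed

text \<open>It trades the natural bound in \<open>r\<close> for one whose integral against the
  weight is the subordination formula at \<eta> = 1.\<close>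

lemma min_one_le_exp:
  fixes r :: real
  assumes r: "0 < r"
  shows "min 1 r \<le> 2 * (1 - exp (- r))"
proof -
  have e: "exp (- r) \<le> 1 / (1 + r)" using r exp_ge_add_one_self[of r] by (simp add: exp_minus field_simps)
  have "min 1 r \<le> 2 * (1 - 1 / (1 + r))"
  proof (cases "r \<le> 1")
    case True
    then have "r * (1 + r) \<le> r * 2" using r by (intro mult_left_mono) auto
    then show ?thesis using r True by (simp add: field_simps)
  qed (use r in \<open>simp add: field_simps\<close>)
  also have "\<dots> \<le> 2 * (1 - exp (- r))" using e by simp
  finally show ?thesis .
qed

text \<open>Uniform in \<open>x\<close>, for the integral over \<open>r\<close> at a fixed point.
  The constant covers both cases: 2 + DIM / 2 for r \<le> 1, and 2 from the heights of the two caps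
  for r > 1.\<close>

lemma cap_difference_bound:
  fixes x :: "'a::euclidean_space"
  assumes r: "0 < r" and t: "0 \<le> t"
  shows "\<bar>cap t x - dilated_cap t r x\<bar> \<le> (4 + real DIM('a)) * t * (2 * (1 - exp (- r)))"
proof -
  have d: "dilated_cap t r x \<le> t"
  proof -
    have "max 0 (t - (norm x)\<^sup>2 / (1 + r)) \<le> t" using r t by simp
    then have "dilated_cap t r x \<le> 1 * t" unfolding dilated_cap_def
      using r t by (intro mult_mono one_plus_powr_minus_le_one) auto
    then show ?thesis by simp
  qed
  have c: "cap t x \<le> t" using t by (simp add: cap_def)
  have "cap_majorant t (r, x) \<le> (4 + real DIM('a)) * t * min 1 r"
  proof (cases "r \<le> 1")
    case True
    have "cap_majorant t (r, x) \<le> (2 + real DIM('a) / 2) * t * r * 1"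
      unfolding cap_majorant_def using r t True by (auto intro!: mult_left_mono mult_nonneg_nonneg)
    also have "\<dots> \<le> (4 + real DIM('a)) * t * r * 1" using r t by (intro mult_right_mono) auto
    finally show ?thesis using True by simp
  next
    case False
    then have "cap_majorant t (r, x) \<le> 2 * t" using c d by (simp add: cap_majorant_def)
    also have "\<dots> \<le> (4 + real DIM('a)) * t" using t by (intro mult_right_mono) auto
    finally show ?thesis using False by simp
  qed
  also have "\<dots> \<le> (4 + real DIM('a)) * t * (2 * (1 - exp (- r)))"
    using t min_one_le_exp[OF r] by (intro mult_left_mono) auto
  finally show ?thesis using cap_difference_le_majorant[OF r t order_refl, of x] by linarith
qed

text \<open>Apply 1 + y \<le> exp y at y = T / n, using n \<ge> 1. Masses grow polynomially in
  \<open>T\<close>, and this puts them into the form that \<open>laplace_dominated\<close> asks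
  for.\<close>

lemma power_le_exp: "(1 + T) ^ n \<le> real n ^ n * exp T" if "0 \<le> T" for T :: real
proof (cases "n = 0")
  case False
  have "1 + T \<le> real n + T" using False by simp
  also have "\<dots> = real n * (1 + T / real n)" using False by (simp add: distrib_left)
  also have "\<dots> \<le> real n * exp (T / real n)" by (intro mult_left_mono exp_ge_add_one_self) auto
  finally have "(1 + T) ^ n \<le> (real n * exp (T / real n)) ^ n" using that by (intro power_mono) auto
  also have "\<dots> = real n ^ n * exp T" using False by (simp add: power_mult_distrib exp_of_nat_mult[symmetric])
  finally show ?thesis .
qed (use that in simp)

text \<open>Since 2 * T \<le> (1 + T)^2, the ball of radius 1 + T contains the support, with a
  volume polynomial in \<open>T\<close>.\<close>

lemma nn_integral_ball_bound:
  fixes f :: "'a::euclidean_space \<Rightarrow> real"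
  assumes T: "0 \<le> T" and c: "0 \<le> c" and f: "\<And>x. (norm x)\<^sup>2 \<le> 2 * T \<Longrightarrow> f x \<le> c" "\<And>x. (norm x)\<^sup>2 > 2 * T \<Longrightarrow> f x \<le> 0"
  shows "(\<integral>\<^sup>+x. ennreal (f x) \<partial>lborel) \<le> ennreal (c * (unit_ball_vol (real DIM('a)) * (1 + T) ^ DIM('a)))"
proof -
  have "(\<integral>\<^sup>+x. ennreal (f x) \<partial>lborel) \<le> (\<integral>\<^sup>+x. ennreal c * indicator (cball 0 (1 + T) :: 'a set) x \<partial>lborel)"
  proof (rule nn_integral_mono)
    fix x :: 'a
    show "ennreal (f x) \<le> ennreal c * indicator (cball 0 (1 + T)) x"
    proof (cases "(norm x)\<^sup>2 \<le> 2 * T")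
      case True
      then have "(norm x)\<^sup>2 \<le> 1 + 2 * T + T\<^sup>2" using zero_le_power2[of T] by linarith
      also have "\<dots> = (1 + T)\<^sup>2" by (simp add: power2_sum)
      finally have "norm x \<le> 1 + T" using T by (auto intro: power2_le_imp_le)
      then show ?thesis using f(1)[OF True] by (simp add: ennreal_leI)
    next
      case False
      then show ?thesis using f(2)[of x] by (simp add: ennreal_neg)
    qed
  qed
  also have "\<dots> = ennreal c * emeasure lborel (cball 0 (1 + T) :: 'a set)"
    by (rule nn_integral_cmult_indicator) simp
  also have "\<dots> = ennreal (c * (unit_ball_vol (real DIM('a)) * (1 + T) ^ DIM('a)))"
    using T c by (simp add: emeasure_cball ennreal_mult[symmetric])
  finally show ?thesis .
qed

lemma nn_integral_cap_le:
  assumes T: "0 \<le> T"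
  shows "(\<integral>\<^sup>+x. ennreal (cap T (x :: 'a::euclidean_space)) \<partial>lborel) \<le> ennreal (T * (unit_ball_vol (real DIM('a)) * (1 + T) ^ DIM('a)))"
  by (rule nn_integral_ball_bound) (use T in \<open>auto simp: cap_def\<close>)

lemma dilated_cap_measurable [measurable]: "dilated_cap T r \<in> borel_measurable borel"
  unfolding dilated_cap_def by measurable

lemma nn_integral_dilated_cap:
  assumes r: "0 < r"
  shows "(\<integral>\<^sup>+x. ennreal (dilated_cap T r (x :: 'a::euclidean_space)) \<partial>lborel) = (\<integral>\<^sup>+x. ennreal (cap T (x :: 'a)) \<partial>lborel)"
proof -
  let ?c = "sqrt (1 + r)"
  have c: "?c > 0" "?c\<^sup>2 = 1 + r" using r by auto
  have pw: "?c ^ DIM('a) * (1 + r) powr (- (real DIM('a) / 2)) = 1"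
  proof -
    have "?c ^ DIM('a) = ?c powr real DIM('a)" using c by (simp add: powr_realpow)
    also have "\<dots> = (1 + r) powr (real DIM('a) / 2)" using r by (simp add: powr_half_sqrt[symmetric] powr_powr)
    finally show ?thesis using r by (simp add: powr_add[symmetric])
  qed
  have sc: "dilated_cap T r (?c *\<^sub>R x) = (1 + r) powr (- (real DIM('a) / 2)) * cap T x" for x :: 'a
    using c r by (simp add: dilated_cap_def cap_def power_mult_distrib)
  have "(\<integral>\<^sup>+x. ennreal (dilated_cap T r (x :: 'a)) \<partial>lborel) = ennreal (?c ^ DIM('a)) * (\<integral>\<^sup>+x. ennreal ((1 + r) powr (- (real DIM('a) / 2))) * ennreal (cap T (x :: 'a)) \<partial>lborel)"
    by (subst lborel_nn_integral_scale[OF c(1)]) (simp_all add: sc ennreal_mult)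
  also have "\<dots> = ennreal (?c ^ DIM('a) * (1 + r) powr (- (real DIM('a) / 2))) * (\<integral>\<^sup>+x. ennreal (cap T (x :: 'a)) \<partial>lborel)"
    using r by (subst nn_integral_cmult) (auto simp: ennreal_mult mult.assoc)
  finally show ?thesis by (simp add: pw)
qed

text \<open>For r > 1 the equal mass of the dilation keeps the bound uniform in \<open>r\<close>,
  although the supports grow.\<close>

lemma nn_integral_cap_majorant:
  assumes r: "0 < r" and T: "0 \<le> T"
  shows "(\<integral>\<^sup>+x. ennreal (cap_majorant T (r, x :: 'a::euclidean_space)) \<partial>lborel)
    \<le> ennreal ((4 + real DIM('a)) * (unit_ball_vol (real DIM('a)) * (1 + T) ^ (DIM('a) + 1)) * (2 * (1 - exp (- r))))"
proof -
  let ?V = "unit_ball_vol (real DIM('a)) * (1 + T) ^ DIM('a)"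
  have V: "0 \<le> ?V" using T by simp
  have "(\<integral>\<^sup>+x. ennreal (cap_majorant T (r, x :: 'a)) \<partial>lborel) \<le> ennreal ((4 + real DIM('a)) * T * min 1 r * ?V)"
  proof (cases "r \<le> 1")
    case True
    have "(\<integral>\<^sup>+x. ennreal (cap_majorant T (r, x :: 'a)) \<partial>lborel) \<le> ennreal ((2 + real DIM('a) / 2) * T * r * ?V)"
      by (rule nn_integral_ball_bound) (use True r T in \<open>auto simp: cap_majorant_def\<close>)
    also have "\<dots> \<le> ennreal ((4 + real DIM('a)) * T * min 1 r * ?V)"
    proof -
      have "min 1 r = r" using True by simp
      then show ?thesis using r T V by (simp only:) (intro ennreal_leI mult_right_mono; simp)
    qed
    finally show ?thesis .
  next
    case False
    have "(\<integral>\<^sup>+x. ennreal (cap_majorant T (r, x :: 'a)) \<partial>lborel) = (\<integral>\<^sup>+x. ennreal (cap T (x :: 'a)) + ennreal (dilated_cap T r x) \<partial>lborel)"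
      using False by (simp add: cap_majorant_def)
    also have "\<dots> = (\<integral>\<^sup>+x. ennreal (cap T (x :: 'a)) \<partial>lborel) + (\<integral>\<^sup>+x. ennreal (cap T (x :: 'a)) \<partial>lborel)"
      by (subst nn_integral_add) (auto simp: nn_integral_dilated_cap[OF r])
    also have "\<dots> \<le> ennreal (T * ?V) + ennreal (T * ?V)" using T by (intro add_mono nn_integral_cap_le)
    also have "\<dots> = ennreal (2 * T * ?V)" using T V by (subst ennreal_plus[symmetric]) auto
    also have "\<dots> \<le> ennreal ((4 + real DIM('a)) * T * min 1 r * ?V)"
    proof -
      have "min 1 r = 1" using False by simp
      then show ?thesis using r T V by (simp only: mult_1_right) (intro ennreal_leI mult_right_mono; simp)
    qed
    finally show ?thesis .
  qed
  also have "\<dots> \<le> ennreal ((4 + real DIM('a)) * (unit_ball_vol (real DIM('a)) * (1 + T) ^ (DIM('a) + 1)) * (2 * (1 - exp (- r))))"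
  proof (rule ennreal_leI)
    have "(4 + real DIM('a)) * T * min 1 r * ?V = (4 + real DIM('a)) * (T * ?V) * min 1 r" by (simp add: mult_ac)
    also have "\<dots> \<le> (4 + real DIM('a)) * ((1 + T) * ?V) * (2 * (1 - exp (- r)))"
      using T V r by (intro mult_mono min_one_le_exp mult_left_mono mult_right_mono mult_nonneg_nonneg) auto
    finally show "(4 + real DIM('a)) * T * min 1 r * ?V \<le> (4 + real DIM('a)) * (unit_ball_vol (real DIM('a)) * (1 + T) ^ (DIM('a) + 1)) * (2 * (1 - exp (- r)))"
      by (simp add: mult_ac)
  qed
  finally show ?thesis .
qed

subsection \<open>The fractional Laplacian of the profile\<close>

text \<open>Matching of Laplace transforms: the power of the cap contributes Gamma (s + 2), the
  subordination formula Gamma (1 - s) / s, and the 4 in \<eta> = |\<xi>|^2 / (4 * p) contributes 4^s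
  = 2^(2 * s).\<close>

definition levy_const :: "real \<Rightarrow> real" where
  "levy_const s = Gamma (s + 2) * 2 powr (2 * s) * s / Gamma (1 - s)"

text \<open>The power s of minus the Laplacian applied to \<open>cap t x powr (1 + s)\<close>, as
  \<open>fourier_cap_laplacian\<close> shows. The formula involves the cap to the first power
  only.\<close>

definition cap_laplacian :: "real \<Rightarrow> real \<Rightarrow> 'a::euclidean_space \<Rightarrow> real" where
  "cap_laplacian s t x = levy_const s * (\<integral>r. (cap t x - dilated_cap t r x) * levy_weight s r \<partial>lborel)"

lemma levy_const_pos: "0 < s \<Longrightarrow> s < 1 \<Longrightarrow> 0 < levy_const s"
  unfolding levy_const_def by (intro divide_pos_pos mult_pos_pos Gamma_real_pos) auto

lemma pair_lborel_measurable:
  assumes "(\<lambda>(t, p). G t p) \<in> borel_measurable (lborel \<Otimes>\<^sub>M (lborel \<Otimes>\<^sub>M lborel))"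
  shows "(\<lambda>(t, p). G t p) \<in> borel_measurable (lborel \<Otimes>\<^sub>M lborel)"
  using assms by (simp only: lborel_prod)

lemma cap_majorant_measurable: "(cap_majorant T :: real \<times> 'a::euclidean_space \<Rightarrow> real) \<in> borel_measurable lborel"
proof -
  have "(cap_majorant T :: real \<times> 'a \<Rightarrow> real) \<in> borel_measurable (lborel \<Otimes>\<^sub>M lborel)"
    unfolding cap_majorant_def cap_def dilated_cap_def by measurable
  then show ?thesis by (simp only: lborel_prod)
qed

text \<open>Tonelli with \<open>r\<close> outside: each integral over \<open>x\<close> is at most a
  multiple of 1 - exp (- r), which the weight integrates by subordination at \<eta> = 1; exp T
  absorbs the powers of 1 + T.\<close>

lemma weighted_cap_majorant_bound:
  fixes T :: real
  assumes s: "0 < s" "s < 1" and T: "0 \<le> T"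
  shows "(\<integral>\<^sup>+p. ennreal (levy_weight s (fst p) * cap_majorant T (p :: real \<times> 'a::euclidean_space)) \<partial>lborel)
    \<le> ennreal ((4 + real DIM('a)) * unit_ball_vol (real DIM('a)) * real (DIM('a) + 1) ^ (DIM('a) + 1) * (2 * (Gamma (1 - s) / s)) * exp T)"
proof -
  let ?K = "(4 + real DIM('a)) * (unit_ball_vol (real DIM('a)) * (1 + T) ^ (DIM('a) + 1)) * 2"
  have K: "0 \<le> ?K" using T by simp
  have [measurable]: "(cap_majorant T :: real \<times> 'a \<Rightarrow> real) \<in> borel_measurable (lborel \<Otimes>\<^sub>M lborel)"
    unfolding cap_majorant_def cap_def dilated_cap_def by measurable
  have "(\<integral>\<^sup>+p. ennreal (levy_weight s (fst p) * cap_majorant T (p :: real \<times> 'a)) \<partial>lborel)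
      = (\<integral>\<^sup>+p. ennreal (levy_weight s (fst p) * cap_majorant T (p :: real \<times> 'a)) \<partial>(lborel \<Otimes>\<^sub>M lborel))"
    by (simp only: lborel_prod)
  also have "\<dots> = (\<integral>\<^sup>+r. (\<integral>\<^sup>+x. ennreal (levy_weight s r * cap_majorant T (r, x :: 'a)) \<partial>lborel) \<partial>lborel)"
    by (subst lborel.nn_integral_fst[symmetric]) auto
  also have "\<dots> \<le> (\<integral>\<^sup>+r. ennreal ?K * ennreal ((1 - exp (- (1 * r))) * (indicator {0<..} r * r powr (- 1 - s))) \<partial>lborel)"
  proof (rule nn_integral_mono)
    fix r :: real
    show "(\<integral>\<^sup>+x. ennreal (levy_weight s r * cap_majorant T (r, x :: 'a)) \<partial>lborel) \<le> ennreal ?K * ennreal ((1 - exp (- (1 * r))) * (indicator {0<..} r * r powr (- 1 - s)))"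
    proof (cases "r > 0")
      case True
      have "(\<lambda>x :: 'a. cap_majorant T (r, x)) \<in> borel_measurable borel"
        unfolding cap_majorant_def fst_conv snd_conv by measurable
      then have "(\<integral>\<^sup>+x. ennreal (levy_weight s r * cap_majorant T (r, x :: 'a)) \<partial>lborel)
          = ennreal (levy_weight s r) * (\<integral>\<^sup>+x. ennreal (cap_majorant T (r, x :: 'a)) \<partial>lborel)"
        by (subst nn_integral_cmult[symmetric]) (auto simp: ennreal_mult')
      also have "\<dots> \<le> ennreal (levy_weight s r) * ennreal ((4 + real DIM('a)) * (unit_ball_vol (real DIM('a)) * (1 + T) ^ (DIM('a) + 1)) * (2 * (1 - exp (- r))))"
        by (intro mult_left_mono nn_integral_cap_majorant True T) auto
      also have "\<dots> = ennreal ?K * ennreal ((1 - exp (- (1 * r))) * (indicator {0<..} r * r powr (- 1 - s)))"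
      proof -
        have "levy_weight s r * ((4 + real DIM('a)) * (unit_ball_vol (real DIM('a)) * (1 + T) ^ (DIM('a) + 1)) * (2 * (1 - exp (- r))))
            = ?K * ((1 - exp (- (1 * r))) * (indicator {0<..} r * r powr (- 1 - s)))"
          by (simp add: levy_weight_def mult_ac right_diff_distrib left_diff_distrib)
        moreover have "0 \<le> (1 - exp (- (1 * r))) * (indicator {0<..} r * r powr (- 1 - s))" using True by simp
        ultimately show ?thesis using K by (simp only: ennreal_mult[symmetric] ennreal_mult'[symmetric] levy_weight_nonneg)
      qed
      finally show ?thesis .
    qed (simp add: levy_weight_zero)
  qed
  also have "\<dots> = ennreal ?K * ennreal (Gamma (1 - s) / s * 1 powr s)"
    using nn_integral_power_laplace_difference[of s 1] s by (subst nn_integral_cmult) auto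
  also have "\<dots> = ennreal ((4 + real DIM('a)) * unit_ball_vol (real DIM('a)) * (2 * (Gamma (1 - s) / s)) * (1 + T) ^ (DIM('a) + 1))"
    using K s by (simp add: ennreal_mult[symmetric] Gamma_real_nonneg mult_ac)
  also have "\<dots> \<le> ennreal ((4 + real DIM('a)) * unit_ball_vol (real DIM('a)) * (2 * (Gamma (1 - s) / s)) * (real (DIM('a) + 1) ^ (DIM('a) + 1) * exp T))"
    using s by (intro ennreal_leI mult_left_mono power_le_exp T mult_nonneg_nonneg divide_nonneg_pos Gamma_real_nonneg) auto
  finally show ?thesis by (simp add: mult_ac)
qed

lemma weighted_cap_majorant_measurable:
  "(\<lambda>p :: real \<times> 'a::euclidean_space. levy_weight s (fst p) * cap_majorant T p) \<in> borel_measurable lborel"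
proof -
  have "(\<lambda>p :: real \<times> 'a. levy_weight s (fst p)) \<in> borel_measurable (lborel \<Otimes>\<^sub>M lborel)" by measurable
  then have "(\<lambda>p :: real \<times> 'a. levy_weight s (fst p)) \<in> borel_measurable lborel" by (simp only: lborel_prod)
  then show ?thesis using cap_majorant_measurable by (rule borel_measurable_times)
qed

lemma weighted_cap_majorant_integrable:
  assumes s: "0 < s" "s < 1" and T: "0 \<le> T"
  shows "integrable lborel (\<lambda>p :: real \<times> 'a::euclidean_space. levy_weight s (fst p) * cap_majorant T p)"
proof (rule integrableI_bounded[OF weighted_cap_majorant_measurable])
  \<comment> \<open>Positivity is available only for positive \<open>r\<close>; elsewhere the weight
    kills the product.\<close>
  have "0 \<le> cap_majorant T p" if "0 < fst p" for p :: "real \<times> 'a"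
    using cap_difference_le_majorant[OF that T order_refl, of "snd p"] by (simp add: order_trans[OF abs_ge_zero])
  then have "norm (levy_weight s (fst p) * cap_majorant T p) = levy_weight s (fst p) * cap_majorant T p" for p :: "real \<times> 'a"
    by (cases "0 < fst p") (auto simp: levy_weight_zero abs_mult)
  then show "(\<integral>\<^sup>+p. ennreal (norm (levy_weight s (fst p) * cap_majorant T (p :: real \<times> 'a))) \<partial>lborel) < \<infinity>"
    using weighted_cap_majorant_bound[OF assms, where 'a = 'a] by (simp add: le_less_trans)
qed

lemma weighted_cap_difference_le:
  fixes x :: "'a::euclidean_space"
  assumes "t \<le> T" "0 \<le> T"
  shows "\<bar>(cap t x - dilated_cap t r x) * levy_weight s r\<bar> \<le> levy_weight s r * cap_majorant T (r, x)"
proof (cases "r > 0")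
  case True
  then show ?thesis using cap_difference_le_majorant[OF True assms(2,1), of x]
    by (simp add: abs_mult mult.commute mult_left_mono)
qed (simp add: levy_weight_zero)

lemma weighted_cap_difference_integrable:
  assumes s: "0 < s" "s < 1"
  shows "integrable (lborel \<Otimes>\<^sub>M lborel) (\<lambda>(r, x :: 'a::euclidean_space). (cap t x - dilated_cap t r x) * levy_weight s r)"
proof (rule Bochner_Integration.integrable_bound)
  show "integrable (lborel \<Otimes>\<^sub>M lborel) (\<lambda>p :: real \<times> 'a. levy_weight s (fst p) * cap_majorant (max 0 t) p)"
    using weighted_cap_majorant_integrable[OF s, of "max 0 t", where 'a = 'a] by (simp only: lborel_prod max.cobounded1)
  show "(\<lambda>(r, x :: 'a). (cap t x - dilated_cap t r x) * levy_weight s r) \<in> borel_measurable (lborel \<Otimes>\<^sub>M lborel)"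
    unfolding cap_def dilated_cap_def by measurable
  show "AE p in lborel \<Otimes>\<^sub>M lborel. norm (case p of (r, x :: 'a) \<Rightarrow> (cap t x - dilated_cap t r x) * levy_weight s r)
      \<le> norm (levy_weight s (fst p) * cap_majorant (max 0 t) p)"
    using weighted_cap_difference_le[of t "max 0 t"] by (auto intro!: AE_I2 order_trans[OF _ abs_ge_self])
qed

lemma cap_laplacian_integrable:
  assumes s: "0 < s" "s < 1"
  shows "integrable lborel (cap_laplacian s t :: 'a::euclidean_space \<Rightarrow> real)"
  unfolding cap_laplacian_def[abs_def]
  by (intro integrable_mult_right lborel_pair.integrable_snd weighted_cap_difference_integrable s)

lemma weighted_cap_difference_bound:
  fixes x :: "'a::euclidean_space"
  assumes t: "0 \<le> t"
  shows "\<bar>(cap t x - dilated_cap t r x) * levy_weight s r\<bar>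
    \<le> (4 + real DIM('a)) * t * 2 * ((1 - exp (- (1 * r))) * (indicator {0<..} r * r powr (- 1 - s)))"
proof (cases "r > 0")
  case True
  have "\<bar>(cap t x - dilated_cap t r x) * levy_weight s r\<bar> \<le> ((4 + real DIM('a)) * t * (2 * (1 - exp (- r)))) * levy_weight s r"
    unfolding abs_mult using cap_difference_bound[OF True t, of x] by (simp add: mult_right_mono)
  also have "\<dots> = (4 + real DIM('a)) * t * 2 * ((1 - exp (- (1 * r))) * (indicator {0<..} r * r powr (- 1 - s)))"
    by (simp add: levy_weight_def algebra_simps)
  finally show ?thesis .
qed (simp add: levy_weight_zero)

lemma weighted_cap_difference_integrable_slice:
  fixes x :: "'a::euclidean_space"
  assumes s: "0 < s" "s < 1" and t: "0 \<le> t"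
  shows "integrable lborel (\<lambda>r. (cap t x - dilated_cap t r x) * levy_weight s r)"
proof (rule Bochner_Integration.integrable_bound)
  show "integrable lborel (\<lambda>r. (4 + real DIM('a)) * t * 2 * ((1 - exp (- (1 * r))) * (indicator {0<..} r * r powr (- 1 - s))))"
    using has_integral_power_laplace_difference[of s 1] s by (intro integrable_mult_right) (simp add: has_bochner_integral_iff)
  show "(\<lambda>r. (cap t x - dilated_cap t r x) * levy_weight s r) \<in> borel_measurable lborel"
    unfolding dilated_cap_def by measurable
  show "AE r in lborel. norm ((cap t x - dilated_cap t r x) * levy_weight s r)
     \<le> norm ((4 + real DIM('a)) * t * 2 * ((1 - exp (- (1 * r))) * (indicator {0<..} r * r powr (- 1 - s))))"
    using weighted_cap_difference_bound[OF t, of x] by (intro AE_I2) (metis abs_ge_self order_trans real_norm_def)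
qed

lemma cap_laplacian_bounded:
  fixes x :: "'a::euclidean_space"
  assumes s: "0 < s" "s < 1" and t: "0 \<le> t"
  shows "\<bar>cap_laplacian s t x\<bar> \<le> levy_const s * ((4 + real DIM('a)) * t * 2 * (Gamma (1 - s) / s))"
proof -
  have hb: "has_bochner_integral lborel (\<lambda>r. (1 - exp (- (1 * r))) * (indicator {0<..} r * r powr (- 1 - s))) (Gamma (1 - s) / s * 1 powr s)"
    using s by (intro has_integral_power_laplace_difference) auto
  have "\<bar>\<integral>r. (cap t x - dilated_cap t r x) * levy_weight s r \<partial>lborel\<bar> \<le> (\<integral>r. \<bar>(cap t x - dilated_cap t r x) * levy_weight s r\<bar> \<partial>lborel)"
    by (rule integral_abs_bound)
  also have "\<dots> \<le> (\<integral>r. (4 + real DIM('a)) * t * 2 * ((1 - exp (- (1 * r))) * (indicator {0<..} r * r powr (- 1 - s))) \<partial>lborel)"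
    using hb by (intro integral_mono integrable_abs weighted_cap_difference_integrable_slice weighted_cap_difference_bound integrable_mult_right s t)
      (simp add: has_bochner_integral_iff)
  also have "\<dots> = (4 + real DIM('a)) * t * 2 * (Gamma (1 - s) / s)"
    unfolding integral_mult_right_zero using hb by (simp add: has_bochner_integral_iff)
  finally have *: "\<bar>\<integral>r. (cap t x - dilated_cap t r x) * levy_weight s r \<partial>lborel\<bar> \<le> (4 + real DIM('a)) * t * 2 * (Gamma (1 - s) / s)" .
  have "\<bar>cap_laplacian s t x\<bar> = levy_const s * \<bar>\<integral>r. (cap t x - dilated_cap t r x) * levy_weight s r \<partial>lborel\<bar>"
    unfolding cap_laplacian_def abs_mult using levy_const_pos[OF s] by simp
  also have "\<dots> \<le> levy_const s * ((4 + real DIM('a)) * t * 2 * (Gamma (1 - s) / s))"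
    using levy_const_pos[OF s] * by (intro mult_left_mono) auto
  finally show ?thesis .
qed

text \<open>Inside the ball the integrand is linear in the square of the norm, so the integral is explicit;
  outside, the same expression is a lower bound of the integrand pointwise.\<close>

lemma quadratic_part_has_integral:
  fixes t \<rho> :: real
  assumes s: "0 < s" "s < 1"
  shows "has_bochner_integral lborel
      (\<lambda>r. (t * (1 - (1 + r) powr (- (real DIM('a::euclidean_space) / 2))) - \<rho> * (1 - (1 + r) powr (- (real DIM('a) / 2 + 1)))) * levy_weight s r)
      (kappa_const s DIM('a) / levy_const s * (t - gamma_const s DIM('a) * \<rho>))"
proof -
  define b where "b = real DIM('a) / 2"
  have b: "b > 0" by (simp add: b_def)
  let ?q = "\<lambda>r::real. indicator {0<..} r * r powr (- 1 - s)"
  have "has_bochner_integral lborel (\<lambda>r. t * ((1 - (1 + r) powr (- b)) * ?q r) - \<rho> * ((1 - (1 + r) powr (- (b + 1))) * ?q r))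
     (t * (Gamma (1 - s) / s * (Gamma (b + s) / Gamma b)) - \<rho> * (Gamma (1 - s) / s * (Gamma (b + 1 + s) / Gamma (b + 1))))"
    using s b by (intro has_bochner_integral_diff has_bochner_integral_mult_right has_integral_power_difference) auto
  moreover have "t * (Gamma (1 - s) / s * (Gamma (b + s) / Gamma b)) - \<rho> * (Gamma (1 - s) / s * (Gamma (b + 1 + s) / Gamma (b + 1)))
      = kappa_const s DIM('a) / levy_const s * (t - gamma_const s DIM('a) * \<rho>)"
  proof -
    \<comment> \<open>The two integrals have parameters b and b + 1. By the Gamma recurrence their
      ratio is (b + s) / b, which for b = DIM / 2 is 1 + 2 * s / DIM: the origin of
      \<open>gamma_const\<close>.\<close>
    have G1: "Gamma (b + 1 + s) = (b + s) * Gamma (b + s)" "Gamma (b + 1) = b * Gamma b"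
      using Gamma_plus1[of "b + s"] Gamma_plus1[of b] b s by (auto simp: nonpos_Ints_def add_ac)
    have pos: "Gamma (1 - s) > 0" "Gamma b > 0" "Gamma (s + 2) > 0" using s b by (auto intro: Gamma_real_pos)
    have k: "kappa_const s DIM('a) / levy_const s = Gamma (1 - s) / s * (Gamma (b + s) / Gamma b)"
    proof -
      have nz: "Gamma (1 - s) \<noteq> 0" "Gamma b \<noteq> 0" "Gamma (s + 2) \<noteq> 0" using pos by linarith+
      show ?thesis
        unfolding kappa_const_def levy_const_def b_def[symmetric] using nz s by (simp add: field_simps)
    qed
    have g: "gamma_const s DIM('a) = (b + s) / b"
      by (simp add: gamma_const_def b_def field_simps)
    have alg: "t * (g1 / s * (gbs / gb)) - \<rho> * (g1 / s * ((b + s) * gbs / (b * gb))) = g1 / s * (gbs / gb) * (t - (b + s) / b * \<rho>)"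
      if "gb \<noteq> 0" for gb gbs g1 :: real
      using that b s by (simp add: field_simps)
    show ?thesis unfolding k g G1 by (rule alg) (use pos in linarith)
  qed
  moreover have "(\<lambda>r. t * ((1 - (1 + r) powr (- b)) * ?q r) - \<rho> * ((1 - (1 + r) powr (- (b + 1))) * ?q r))
      = (\<lambda>r. (t * (1 - (1 + r) powr (- b)) - \<rho> * (1 - (1 + r) powr (- (b + 1)))) * levy_weight s r)"
    by (simp add: fun_eq_iff levy_weight_def algebra_simps)
  ultimately show ?thesis unfolding b_def by (simp only:)
qed

text \<open>Dropping both positive parts changes the difference by the negative part of t - \<rho>
  minus \<open>m\<close> times that of t - \<rho> / (1 + r). This is nonnegative because m \<le> 1
  and the negative part decreases in its argument; it is 0 where \<rho> \<le> t.\<close>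

lemma cap_difference_quadratic:
  fixes x :: "'a::euclidean_space" and t r :: real
  assumes r: "0 < r"
  defines "\<rho> \<equiv> (norm x)\<^sup>2"
  defines "Q \<equiv> t * (1 - (1 + r) powr (- (real DIM('a) / 2))) - \<rho> * (1 - (1 + r) powr (- (real DIM('a) / 2 + 1)))"
  shows "Q \<le> cap t x - dilated_cap t r x"
    and "\<rho> \<le> t \<Longrightarrow> cap t x - dilated_cap t r x = Q"
proof -
  define m where "m = (1 + r) powr (- (real DIM('a) / 2))"
  have m: "0 \<le> m" "m \<le> 1" unfolding m_def using r by (auto intro: one_plus_powr_minus_le_one)
  have m1: "(1 + r) powr (- (real DIM('a) / 2 + 1)) = m / (1 + r)"
  proof -
    have e: "- (real DIM('a) / 2 + 1) = - (real DIM('a) / 2) - 1" by simp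
    show ?thesis unfolding e powr_diff m_def using r by simp
  qed
  have \<rho>: "0 \<le> \<rho>" by (simp add: \<rho>_def)
  have le: "\<rho> / (1 + r) \<le> \<rho>" using r \<rho> by (simp add: divide_le_eq algebra_simps)
  have Q: "Q = (t - \<rho>) - m * (t - \<rho> / (1 + r))"
    unfolding Q_def m1 m_def[symmetric] by (simp add: algebra_simps)
  have C: "cap t x - dilated_cap t r x = max 0 (t - \<rho>) - m * max 0 (t - \<rho> / (1 + r))"
    by (simp add: cap_def dilated_cap_def \<rho>_def m_def)
  show eq: "cap t x - dilated_cap t r x = Q" if "\<rho> \<le> t"
    using that le unfolding Q C by simp
  show "Q \<le> cap t x - dilated_cap t r x"
  proof -
    have "m * (max 0 (t - \<rho> / (1 + r)) - (t - \<rho> / (1 + r))) \<le> 1 * (max 0 (t - \<rho> / (1 + r)) - (t - \<rho> / (1 + r)))"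
      using m by (intro mult_right_mono) auto
    also have "\<dots> \<le> max 0 (t - \<rho>) - (t - \<rho>)" using le by auto
    finally show ?thesis unfolding Q C right_diff_distrib by linarith
  qed
qed

lemma cap_laplacian_ge:
  fixes x :: "'a::euclidean_space"
  assumes s: "0 < s" "s < 1" and t: "0 \<le> t"
  shows "kappa_const s DIM('a) * (t - gamma_const s DIM('a) * (norm x)\<^sup>2) \<le> cap_laplacian s t x"
    and "(norm x)\<^sup>2 \<le> t \<Longrightarrow> cap_laplacian s t x = kappa_const s DIM('a) * (t - gamma_const s DIM('a) * (norm x)\<^sup>2)"
proof -
  let ?Q = "\<lambda>r. (t * (1 - (1 + r) powr (- (real DIM('a) / 2))) - (norm x)\<^sup>2 * (1 - (1 + r) powr (- (real DIM('a) / 2 + 1)))) * levy_weight s r"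
  have c: "levy_const s > 0" by (rule levy_const_pos[OF s])
  have Q: "integrable lborel ?Q" "kappa_const s DIM('a) * (t - gamma_const s DIM('a) * (norm x)\<^sup>2) = levy_const s * (\<integral>r. ?Q r \<partial>lborel)"
    using quadratic_part_has_integral[OF s, of t "(norm x)\<^sup>2", where 'a = 'a] c by (auto simp: has_bochner_integral_iff)
  have "(\<integral>r. ?Q r \<partial>lborel) \<le> (\<integral>r. (cap t x - dilated_cap t r x) * levy_weight s r \<partial>lborel)"
  proof (rule integral_mono)
    show "?Q r \<le> (cap t x - dilated_cap t r x) * levy_weight s r" for r
      using cap_difference_quadratic(1)[of r t x]
      by (cases "r > 0") (auto intro!: mult_right_mono simp: levy_weight_zero)
  qed (use Q weighted_cap_difference_integrable_slice[OF s t] in auto)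
  then show "kappa_const s DIM('a) * (t - gamma_const s DIM('a) * (norm x)\<^sup>2) \<le> cap_laplacian s t x"
    unfolding Q(2) cap_laplacian_def using c by (intro mult_left_mono) auto
  assume "(norm x)\<^sup>2 \<le> t"
  then have eq: "(cap t x - dilated_cap t r x) * levy_weight s r = ?Q r" for r
    using cap_difference_quadratic(2)[of r x t] by (cases "r > 0") (auto simp: levy_weight_zero)
  then show "cap_laplacian s t x = kappa_const s DIM('a) * (t - gamma_const s DIM('a) * (norm x)\<^sup>2)"
    unfolding Q(2) cap_laplacian_def by (simp only: eq)
qed

section \<open>Laplace transforms in the level of the profile and of its fractional
  Laplacian\<close>

lemma integral_exp_scaleR_of_real:
  assumes "has_bochner_integral lborel (\<lambda>t. g t * exp (- (p * t))) v"
  shows "(\<integral>t. exp (- (p * t)) *\<^sub>R (z * complex_of_real (g t)) \<partial>lborel) = z * complex_of_real v"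
proof -
  have "(\<integral>t. exp (- (p * t)) *\<^sub>R (z * complex_of_real (g t)) \<partial>lborel) = (\<integral>t. z * complex_of_real (g t * exp (- (p * t))) \<partial>lborel)"
    by (simp add: scaleR_conv_of_real mult_ac)
  also have "\<dots> = z * complex_of_real v"
    unfolding integral_mult_right_zero integral_complex_of_real using assms by (simp add: has_bochner_integral_iff)
  finally show ?thesis .
qed

lemma cap_power_le: 
  assumes s: "0 < s" "s < 1" and T: "0 \<le> T"
  shows "cap T x powr (1 + s) \<le> (1 + T)\<^sup>2"
proof -
  have "cap T x \<le> 1 + T" unfolding cap_def using T zero_le_power2[of "norm x"] by linarith
  then have "cap T x powr (1 + s) \<le> (1 + T) powr (1 + s)"
    using s T by (intro powr_mono2) auto
  also have "\<dots> \<le> (1 + T) powr 2" using s T by (intro powr_mono) auto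
  finally show ?thesis using T by (simp add: powr_numeral)
qed

lemma nn_integral_cap_power:
  assumes s: "0 < s" "s < 1" and T: "0 \<le> T"
  shows "(\<integral>\<^sup>+x. ennreal (cap T (x :: 'a::euclidean_space) powr (1 + s)) \<partial>lborel)
    \<le> ennreal (unit_ball_vol (real DIM('a)) * real (DIM('a) + 2) ^ (DIM('a) + 2) * exp T)"
proof -
  have "(\<integral>\<^sup>+x. ennreal (cap T (x :: 'a) powr (1 + s)) \<partial>lborel) \<le> ennreal ((1 + T)\<^sup>2 * (unit_ball_vol (real DIM('a)) * (1 + T) ^ DIM('a)))"
    by (rule nn_integral_ball_bound) (use T cap_power_le[OF s T] in \<open>auto simp: cap_def\<close>)
  also have "(1 + T)\<^sup>2 * (unit_ball_vol (real DIM('a)) * (1 + T) ^ DIM('a)) = unit_ball_vol (real DIM('a)) * (1 + T) ^ (DIM('a) + 2)"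
    by (simp add: power2_eq_square)
  also have "\<dots> \<le> unit_ball_vol (real DIM('a)) * (real (DIM('a) + 2) ^ (DIM('a) + 2) * exp T)"
    by (intro mult_left_mono power_le_exp T) auto
  finally show ?thesis by (simp add: mult_ac ennreal_leI)
qed

lemma cap_power_integrable:
  assumes s: "0 < s" "s < 1" and T: "0 \<le> T"
  shows "integrable lborel (\<lambda>x :: 'a::euclidean_space. cap T x powr (1 + s))"
proof (rule integrableI_bounded)
  show "(\<integral>\<^sup>+x. ennreal (norm (cap T (x :: 'a) powr (1 + s))) \<partial>lborel) < \<infinity>"
    using nn_integral_cap_power[OF assms, where 'a = 'a] by (simp add: le_less_trans)
qed measurable

lemma laplace_dominated_cap_power:
  fixes \<xi> :: "'a::euclidean_space"
  assumes s: "0 < s" "s < 1" and A: "0 \<le> A"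
  shows "laplace_dominated (\<lambda>t x :: 'a. complex_of_real A * fourier_char \<xi> x * complex_of_real (cap t x powr (1 + s)))
    (\<lambda>T x. A * cap T x powr (1 + s)) (A * (unit_ball_vol (real DIM('a)) * real (DIM('a) + 2) ^ (DIM('a) + 2)))"
proof
  show "(\<lambda>(t, x :: 'a). complex_of_real A * fourier_char \<xi> x * complex_of_real (cap t x powr (1 + s))) \<in> borel_measurable (lborel \<Otimes>\<^sub>M lborel)"
    unfolding cap_def by measurable
  show "continuous_on UNIV (\<lambda>t. complex_of_real A * fourier_char \<xi> x * complex_of_real (cap t x powr (1 + s)))" for x :: 'a
    unfolding cap_def using s by (intro continuous_intros continuous_on_powr') auto
  show "complex_of_real A * fourier_char \<xi> x * complex_of_real (cap t x powr (1 + s)) = 0" if "t \<le> 0" for t and x :: 'a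
    using that by (simp add: cap_zero)
  show "(\<lambda>x :: 'a. A * cap T x powr (1 + s)) \<in> borel_measurable lborel" for T by measurable
  show "cmod (complex_of_real A * fourier_char \<xi> x * complex_of_real (cap t x powr (1 + s))) \<le> A * cap T x powr (1 + s)"
    if "t \<le> T" "0 \<le> T" for t T and x :: 'a
    using that A s cap_mono[of t T x] by (auto simp: norm_mult intro!: mult_left_mono powr_mono2)
  show "0 \<le> A * (unit_ball_vol (real DIM('a)) * real (DIM('a) + 2) ^ (DIM('a) + 2))" using A by simp
  show "(\<integral>\<^sup>+x. ennreal (A * cap T (x :: 'a) powr (1 + s)) \<partial>lborel) \<le> ennreal (A * (unit_ball_vol (real DIM('a)) * real (DIM('a) + 2) ^ (DIM('a) + 2)) * exp T)"
    if T: "0 \<le> T" for T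
  proof -
    have "(\<integral>\<^sup>+x. ennreal (A * cap T (x :: 'a) powr (1 + s)) \<partial>lborel) = ennreal A * (\<integral>\<^sup>+x. ennreal (cap T (x :: 'a) powr (1 + s)) \<partial>lborel)"
      using A by (subst nn_integral_cmult[symmetric]) (auto simp: ennreal_mult)
    also have "\<dots> \<le> ennreal A * ennreal (unit_ball_vol (real DIM('a)) * real (DIM('a) + 2) ^ (DIM('a) + 2) * exp T)"
      by (intro mult_left_mono nn_integral_cap_power s T) auto
    also have "\<dots> = ennreal (A * (unit_ball_vol (real DIM('a)) * real (DIM('a) + 2) ^ (DIM('a) + 2)) * exp T)"
      using A by (subst ennreal_mult[symmetric]) (auto simp: mult_ac)
    finally show ?thesis .
  qed
qed

lemma laplace_cap_power:
  fixes \<xi> :: "'a::euclidean_space"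
  assumes s: "0 < s" and p: "0 < p"
  shows "(\<integral>x. (\<integral>t. exp (- (p * t)) *\<^sub>R (complex_of_real A * fourier_char \<xi> x * complex_of_real (cap t x powr (1 + s))) \<partial>lborel) \<partial>lborel)
    = complex_of_real (A * (Gamma (s + 2) * p powr (- 2 - s)) * ((pi / p) powr (real DIM('a) / 2) * exp (- (norm \<xi>)\<^sup>2 / (4 * p))))"
proof -
  have "(\<integral>t. exp (- (p * t)) *\<^sub>R (complex_of_real A * fourier_char \<xi> x * complex_of_real (cap t x powr (1 + s))) \<partial>lborel)
     = complex_of_real (A * (Gamma (s + 2) * p powr (- 2 - s))) * (fourier_char \<xi> x * complex_of_real (exp (- p * (norm x)\<^sup>2)))" for x :: 'a
  proof -
    have "has_bochner_integral lborel (\<lambda>t. cap t x powr (1 + s) * exp (- (p * t))) (exp (- (p * (norm x)\<^sup>2)) * (Gamma (1 + s + 1) * p powr (- (1 + s) - 1)))"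
      unfolding cap_def using s p by (intro has_integral_truncated_power_laplace) auto
    also have "1 + s + 1 = s + 2" by simp
    also have "- (1 + s) - 1 = - 2 - s" by simp
    finally show ?thesis by (subst integral_exp_scaleR_of_real) (auto simp: mult_ac)
  qed
  then show ?thesis by (simp only: integral_mult_right_zero gaussian_fourier[OF p] of_real_mult)
qed

text \<open>The parameter is the pair \<open>(r, x)\<close>, so that the integral against the weight
  and the Fourier integral count as one.\<close>

lemma laplace_dominated_cap_difference:
  fixes \<xi> :: "'a::euclidean_space"
  assumes s: "0 < s" "s < 1" and c: "0 \<le> c"
  shows "laplace_dominated (\<lambda>t p :: real \<times> 'a. complex_of_real c * fourier_char \<xi> (snd p) * complex_of_real ((cap t (snd p) - dilated_cap t (fst p) (snd p)) * levy_weight s (fst p)))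
    (\<lambda>T p. c * (levy_weight s (fst p) * cap_majorant T p))
    (c * ((4 + real DIM('a)) * unit_ball_vol (real DIM('a)) * real (DIM('a) + 1) ^ (DIM('a) + 1) * (2 * (Gamma (1 - s) / s))))"
    (is "laplace_dominated ?G ?D ?C")
proof
  show "(\<lambda>(t, p). ?G t p) \<in> borel_measurable (lborel \<Otimes>\<^sub>M lborel)"
    unfolding cap_def dilated_cap_def by (rule pair_lborel_measurable) measurable
  show "continuous_on UNIV (\<lambda>t. ?G t p)" for p
    unfolding cap_def dilated_cap_def by (intro continuous_intros)
  show "?G t p = 0" if "t \<le> 0" for t p
    using that by (cases "fst p > 0") (auto simp: cap_zero dilated_cap_zero levy_weight_zero)
  show "?D T \<in> borel_measurable lborel" for T
    by (intro borel_measurable_times borel_measurable_const weighted_cap_majorant_measurable)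
  show "cmod (?G t p) \<le> ?D T p" if "t \<le> T" "0 \<le> T" for t T p
    using weighted_cap_difference_le[OF that, of "snd p" "fst p" s] c
    unfolding norm_mult norm_fourier_kernel norm_of_real by (simp add: mult_left_mono)
  show "0 \<le> ?C" using c s by (auto intro!: mult_nonneg_nonneg divide_nonneg_nonneg Gamma_real_nonneg)
  show "(\<integral>\<^sup>+p. ennreal (?D T p) \<partial>lborel) \<le> ennreal (?C * exp T)" if T: "0 \<le> T" for T
  proof -
    have "(\<integral>\<^sup>+p. ennreal (?D T p) \<partial>lborel) = ennreal c * (\<integral>\<^sup>+p. ennreal (levy_weight s (fst p) * cap_majorant T p) \<partial>(lborel :: (real \<times> 'a) measure))"
      unfolding ennreal_mult'[OF c]
      by (intro nn_integral_cmult measurable_compose[OF _ measurable_ennreal] weighted_cap_majorant_measurable)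
    also have "\<dots> \<le> ennreal c * ennreal ((4 + real DIM('a)) * unit_ball_vol (real DIM('a)) * real (DIM('a) + 1) ^ (DIM('a) + 1) * (2 * (Gamma (1 - s) / s)) * exp T)"
      by (intro mult_left_mono weighted_cap_majorant_bound s T) auto
    also have "\<dots> = ennreal (?C * exp T)"
      using c by (simp add: ennreal_mult'[symmetric] mult_ac)
    finally show ?thesis .
  qed
qed

text \<open>Both caps are first powers, so both terms carry Gamma 2 * p^(- 2), and \<open>r\<close>
  enters only through the height and the width of the second Gaussian.\<close>

lemma laplace_cap_difference_slice:
  fixes x :: "'a::euclidean_space"
  assumes p: "0 < p" and r: "0 < r"
  shows "(\<integral>t. exp (- (p * t)) *\<^sub>R (z * complex_of_real ((cap t x - dilated_cap t r x) * q)) \<partial>lborel)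
    = z * complex_of_real (q * p powr (- 2)) * (complex_of_real (exp (- p * (norm x)\<^sup>2))
        - complex_of_real ((1 + r) powr (- (real DIM('a) / 2))) * complex_of_real (exp (- (p / (1 + r)) * (norm x)\<^sup>2)))"
proof -
  define m where "m = (1 + r) powr (- (real DIM('a) / 2))"
  have G2: "Gamma (2 :: real) = 1" using Gamma_fact[of 1, where 'a = real] by simp
  have "has_bochner_integral lborel (\<lambda>t. q * (max 0 (t - (norm x)\<^sup>2) powr 1 * exp (- (p * t)) - m * (max 0 (t - (norm x)\<^sup>2 / (1 + r)) powr 1 * exp (- (p * t)))))
    (q * (exp (- (p * (norm x)\<^sup>2)) * (Gamma (1 + 1) * p powr (- 1 - 1)) - m * (exp (- (p * ((norm x)\<^sup>2 / (1 + r)))) * (Gamma (1 + 1) * p powr (- 1 - 1)))))"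
    using p by (intro has_bochner_integral_diff has_bochner_integral_mult_right has_integral_truncated_power_laplace) auto
  also have "(\<lambda>t. q * (max 0 (t - (norm x)\<^sup>2) powr 1 * exp (- (p * t)) - m * (max 0 (t - (norm x)\<^sup>2 / (1 + r)) powr 1 * exp (- (p * t)))))
      = (\<lambda>t. (cap t x - dilated_cap t r x) * q * exp (- (p * t)))"
    by (simp add: fun_eq_iff cap_def dilated_cap_def m_def algebra_simps)
  finally show ?thesis
    by (subst integral_exp_scaleR_of_real) (auto simp: G2 m_def algebra_simps)
qed

text \<open>With \<open>t\<close> integrated out, the two caps are Gaussians with parameters n and n
  / (1 + r). Their Fourier transforms differ by the factor exp (- \<eta> * r), so the difference is
  a Gaussian times 1 - exp (- \<eta> * r), and the integral over \<open>r\<close> yields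
  \<eta>^s.\<close>

lemma laplace_cap_difference:
  fixes \<xi> :: "'a::euclidean_space"
  assumes s: "0 < s" "s < 1" and c: "0 \<le> c" and n: "(2 :: nat) \<le> n"
  shows "(\<integral>p. (\<integral>t. exp (- (real n * t)) *\<^sub>R (complex_of_real c * fourier_char \<xi> (snd p) * complex_of_real ((cap t (snd p :: 'a) - dilated_cap t (fst p) (snd p)) * levy_weight s (fst p))) \<partial>lborel) \<partial>lborel)
    = complex_of_real (c * real n powr (- 2) * ((pi / real n) powr (real DIM('a) / 2) * exp (- (norm \<xi>)\<^sup>2 / (4 * real n)))
       * (Gamma (1 - s) / s * ((norm \<xi>)\<^sup>2 / (4 * real n)) powr s))"
    (is "(\<integral>p. ?L p \<partial>lborel) = _")
proof -
  interpret laplace_dominated "\<lambda>t p :: real \<times> 'a. complex_of_real c * fourier_char \<xi> (snd p) * complex_of_real ((cap t (snd p) - dilated_cap t (fst p) (snd p)) * levy_weight s (fst p))"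
    "\<lambda>T p. c * (levy_weight s (fst p) * cap_majorant T p)"
    "c * ((4 + real DIM('a)) * unit_ball_vol (real DIM('a)) * real (DIM('a) + 1) ^ (DIM('a) + 1) * (2 * (Gamma (1 - s) / s)))"
    by (rule laplace_dominated_cap_difference[OF s c])
  define N where "N = real n"
  have N: "0 < N" using n by (simp add: N_def)
  define \<eta> where "\<eta> = (norm \<xi>)\<^sup>2 / (4 * N)"
  have \<eta>: "0 \<le> \<eta>" using N by (simp add: \<eta>_def)
  define B where "B = c * N powr (- 2) * ((pi / N) powr (real DIM('a) / 2) * exp (- \<eta>))"
  have "(\<integral>p. ?L p \<partial>lborel) = (\<integral>p. ?L p \<partial>(lborel \<Otimes>\<^sub>M lborel))" by (simp only: lborel_prod)
  \<comment> \<open>Joint integrability, with \<open>t\<close> already integrated out, comes from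
    \<open>laplace_dominated\<close>; it lets \<open>x\<close> be integrated before
    \<open>r\<close>.\<close>
  also have "\<dots> = (\<integral>r. (\<integral>x. ?L (r, x) \<partial>lborel) \<partial>lborel)"
    using F_laplace(2)[OF n] by (intro lborel_pair.integral_fst'[symmetric]) (simp only: lborel_prod)
  also have "\<dots> = (\<integral>r. complex_of_real (B * ((1 - exp (- (\<eta> * r))) * levy_weight s r)) \<partial>lborel)"
  proof (rule Bochner_Integration.integral_cong[OF refl])
    fix r :: real
    show "(\<integral>x. ?L (r, x) \<partial>lborel) = complex_of_real (B * ((1 - exp (- (\<eta> * r))) * levy_weight s r))"
    proof (cases "r > 0")
      case True
      define m where "m = (1 + r) powr (- (real DIM('a) / 2))"
      define z where "z = complex_of_real (c * (levy_weight s r * N powr (- 2)))"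
      let ?E = "\<lambda>x. fourier_char \<xi> x :: complex"
      have Nr: "0 < N / (1 + r)" using N True by simp
      have "(\<integral>x. ?L (r, x) \<partial>lborel) = (\<integral>x. z * (?E x * complex_of_real (exp (- N * (norm x)\<^sup>2))) - z * complex_of_real m * (?E x * complex_of_real (exp (- (N / (1 + r)) * (norm x)\<^sup>2))) \<partial>lborel)"
        unfolding fst_conv snd_conv N_def[symmetric] laplace_cap_difference_slice[OF N True]
        by (rule Bochner_Integration.integral_cong) (simp_all add: z_def m_def algebra_simps)
      also have "\<dots> = z * (\<integral>x. ?E x * complex_of_real (exp (- N * (norm x)\<^sup>2)) \<partial>lborel) - z * complex_of_real m * (\<integral>x. ?E x * complex_of_real (exp (- (N / (1 + r)) * (norm x)\<^sup>2)) \<partial>lborel)"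
        unfolding integral_mult_right_zero[symmetric]
        by (intro Bochner_Integration.integral_diff integrable_mult_right gaussian_fourier_integrable N Nr)
      also have "\<dots> = z * complex_of_real ((pi / N) powr (real DIM('a) / 2) * exp (- \<eta>)) - z * complex_of_real m * complex_of_real ((pi / (N / (1 + r))) powr (real DIM('a) / 2) * exp (- (norm \<xi>)\<^sup>2 / (4 * (N / (1 + r)))))"
        unfolding gaussian_fourier[OF N] gaussian_fourier[OF Nr] by (simp add: \<eta>_def)
      also have "\<dots> = z * complex_of_real ((pi / N) powr (real DIM('a) / 2) * exp (- \<eta>)) - z * complex_of_real (m * ((pi / (N / (1 + r))) powr (real DIM('a) / 2) * exp (- (norm \<xi>)\<^sup>2 / (4 * (N / (1 + r))))))"
        by (simp only: of_real_mult mult.assoc)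
      \<comment> \<open>The wider Gaussian's transform has the extra factor (1 + r)^(DIM / 2), which
        the height \<open>m\<close> cancels: equal mass is what leaves the bare exp (- \<eta> *
        r).\<close>
      also have "m * ((pi / (N / (1 + r))) powr (real DIM('a) / 2) * exp (- (norm \<xi>)\<^sup>2 / (4 * (N / (1 + r))))) = (pi / N) powr (real DIM('a) / 2) * exp (- \<eta>) * exp (- (\<eta> * r))"
      proof -
        have "pi / (N / (1 + r)) = (1 + r) * (pi / N)" by simp
        then have "(pi / (N / (1 + r))) powr (real DIM('a) / 2) = (1 + r) powr (real DIM('a) / 2) * (pi / N) powr (real DIM('a) / 2)"
          using N True by (simp only: powr_mult)
        moreover have "m * (1 + r) powr (real DIM('a) / 2) = 1" unfolding m_def using True by (simp add: powr_add[symmetric])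
        moreover have "- (norm \<xi>)\<^sup>2 / (4 * (N / (1 + r))) = - \<eta> + - (\<eta> * r)" using N True by (simp add: \<eta>_def field_simps)
        ultimately show ?thesis by (simp only: exp_add) (simp add: mult.assoc[symmetric])
      qed
      finally show ?thesis by (simp add: z_def B_def algebra_simps)
    qed (simp add: levy_weight_zero)
  qed
  also have "\<dots> = complex_of_real (B * (Gamma (1 - s) / s * \<eta> powr s))"
    unfolding integral_complex_of_real integral_mult_right_zero
    using has_integral_power_laplace_difference[OF s \<eta>] by (simp add: has_bochner_integral_iff levy_weight_def)
  finally show ?thesis unfolding B_def N_def[symmetric] \<eta>_def by simp
qed

text \<open>At a fixed \<xi> both sides are functions of the level \<open>t\<close> alone, and their
  Laplace transforms agree at every integer n \<ge> 3.\<close>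

lemma fourier_cap_laplacian:
  fixes \<xi> :: "'a::euclidean_space"
  assumes s: "0 < s" "s < 1"
  shows "fourier_L1 (\<lambda>x. complex_of_real (cap_laplacian s t x)) \<xi>
    = complex_of_real (norm \<xi> powr (2 * s)) * fourier_L1 (\<lambda>x. complex_of_real (cap t x powr (1 + s))) \<xi>"
proof -
  let ?E = "\<lambda>x. fourier_char \<xi> x :: complex"
  let ?c = "levy_const s" and ?A = "norm \<xi> powr (2 * s)"
  let ?k = "\<lambda>r x. (cap t x - dilated_cap t r x) * levy_weight s r"
  have c: "0 \<le> ?c" using levy_const_pos[OF s] by simp
  have A: "0 \<le> ?A" by simp
  have eq: "(\<integral>x. complex_of_real ?A * ?E x * complex_of_real (cap t x powr (1 + s)) \<partial>lborel)
      = (\<integral>p. complex_of_real ?c * ?E (snd p) * complex_of_real (?k (fst p) (snd p :: 'a)) \<partial>lborel)"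
  proof (rule laplace_dominated_eqI[OF laplace_dominated_cap_power[OF s A] laplace_dominated_cap_difference[OF s c]])
    fix n :: nat assume n: "3 \<le> n"
    define N where "N = real n"
    have N: "0 < N" using n by (simp add: N_def)
    have "((norm \<xi>)\<^sup>2 / (4 * N)) powr s = ?A / (2 powr (2 * s) * N powr s)"
    proof -
      have "((norm \<xi>)\<^sup>2) powr s = ?A"
        by (cases "\<xi> = 0") (simp_all add: powr_powr[symmetric] powr_numeral)
      moreover have "(4 :: real) powr s = 2 powr (2 * s)" by (simp add: powr_powr[symmetric])
      ultimately show ?thesis using N by (simp add: powr_divide powr_mult)
    qed
    then have "?c * N powr (- 2) * (Gamma (1 - s) / s * ((norm \<xi>)\<^sup>2 / (4 * N)) powr s) = ?A * (Gamma (s + 2) * (N powr (- 2) / N powr s))"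
    proof -
      have "Gamma (1 - s) \<noteq> 0" using Gamma_real_pos[of "1 - s"] s by linarith
      then have alg: "G * P * s / g1 * y * (g1 / s * (a / (P * z))) = a * (G * (y / z))" if "g1 \<noteq> 0" "P \<noteq> 0" for G P g1 y a z :: real
        using that s by (simp add: field_simps)
      show ?thesis unfolding \<open>((norm \<xi>)\<^sup>2 / (4 * N)) powr s = ?A / (2 powr (2 * s) * N powr s)\<close> levy_const_def
        by (rule alg) (use \<open>Gamma (1 - s) \<noteq> 0\<close> in auto)
    qed
    also have "N powr (- 2) / N powr s = N powr (- 2 - s)" by (simp add: powr_diff)
    finally have "?A * (Gamma (s + 2) * N powr (- 2 - s)) = ?c * N powr (- 2) * (Gamma (1 - s) / s * ((norm \<xi>)\<^sup>2 / (4 * N)) powr s)" ..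
    then have key: "?A * (Gamma (s + 2) * N powr (- 2 - s)) * y = ?c * N powr (- 2) * y * (Gamma (1 - s) / s * ((norm \<xi>)\<^sup>2 / (4 * N)) powr s)" for y
      by (simp add: mult_ac)
    have n2: "2 \<le> n" using n by simp
    show "(\<integral>x. (\<integral>t. exp (- (real n * t)) *\<^sub>R (complex_of_real ?A * ?E x * complex_of_real (cap t (x :: 'a) powr (1 + s))) \<partial>lborel) \<partial>lborel)
      = (\<integral>p. (\<integral>t. exp (- (real n * t)) *\<^sub>R (complex_of_real ?c * ?E (snd p) * complex_of_real ((cap t (snd p :: 'a) - dilated_cap t (fst p) (snd p)) * levy_weight s (fst p))) \<partial>lborel) \<partial>lborel)"
      unfolding laplace_cap_difference[OF s c n2] laplace_cap_power[OF s(1) N[unfolded N_def]]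
      unfolding N_def[symmetric] key ..
  qed
  \<comment> \<open>Its \<open>G_integrable\<close> supplies the joint integrability needed to swap
    the integral over \<open>r\<close> with the Fourier integral.\<close>
  interpret D: laplace_dominated "\<lambda>t p :: real \<times> 'a. complex_of_real ?c * ?E (snd p) * complex_of_real ((cap t (snd p) - dilated_cap t (fst p) (snd p)) * levy_weight s (fst p))"
    "\<lambda>T p. ?c * (levy_weight s (fst p) * cap_majorant T p)"
    "?c * ((4 + real DIM('a)) * unit_ball_vol (real DIM('a)) * real (DIM('a) + 1) ^ (DIM('a) + 1) * (2 * (Gamma (1 - s) / s)))"
    by (rule laplace_dominated_cap_difference[OF s c])
  have int: "integrable (lborel \<Otimes>\<^sub>M lborel) (\<lambda>(r, x :: 'a). complex_of_real ?c * ?E x * complex_of_real (?k r x))"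
    using D.G_integrable[of t] unfolding lborel_prod by (simp add: case_prod_unfold)
  have wm: "(cap_laplacian s t :: 'a \<Rightarrow> real) \<in> borel_measurable borel"
    using cap_laplacian_integrable[OF s, of t, where 'a = 'a] by auto
  have "fourier_L1 (\<lambda>x :: 'a. complex_of_real (cap_laplacian s t x)) \<xi> = (\<integral>x. ?E x * complex_of_real (cap_laplacian s t x) \<partial>lborel)"
    using wm by (intro fourier_L1_borel) measurable
  also have "\<dots> = (\<integral>x. (\<integral>r. complex_of_real ?c * ?E x * complex_of_real (?k r x) \<partial>lborel) \<partial>lborel)"
    unfolding integral_mult_right_zero integral_complex_of_real cap_laplacian_def by (simp add: mult_ac)
  also have "\<dots> = (\<integral>p. (case p of (r, x) \<Rightarrow> complex_of_real ?c * ?E x * complex_of_real (?k r x)) \<partial>(lborel \<Otimes>\<^sub>M lborel))"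
    by (rule lborel_pair.integral_snd[OF int])
  also have "\<dots> = (\<integral>p. complex_of_real ?c * ?E (snd p) * complex_of_real (?k (fst p) (snd p :: 'a)) \<partial>lborel)"
    by (simp only: lborel_prod case_prod_unfold)
  also have "\<dots> = (\<integral>x. complex_of_real ?A * (?E x * complex_of_real (cap t x powr (1 + s))) \<partial>lborel)"
    using eq[symmetric] by (simp only: mult.assoc)
  also have "\<dots> = complex_of_real ?A * (\<integral>x. ?E x * complex_of_real (cap t x powr (1 + s)) \<partial>lborel)"
    by (rule integral_mult_right_zero)
  also have "(\<integral>x. ?E x * complex_of_real (cap t x powr (1 + s)) \<partial>lborel) = fourier_L1 (\<lambda>x. complex_of_real (cap t x powr (1 + s))) \<xi>"
    by (subst fourier_L1_borel) measurable
  finally show ?thesis .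
qed

subsection \<open>The variational inequality\<close>

text \<open>\<open>inv_fourier_L2\<close> evaluates at \<open>- x\<close>, so norms of inverse
  transforms need this invariance. Reflection is the affine map with all coefficients - 1.\<close>

lemma
  shows lebesgue_reflect_measurable: "uminus \<in> lebesgue \<rightarrow>\<^sub>M (lebesgue :: 'a::euclidean_space measure)"
    and lebesgue_distr_uminus: "distr lebesgue lebesgue uminus = (lebesgue :: 'a measure)"
proof -
  have eq: "(\<lambda>x::'a. 0 + (\<Sum>j\<in>Basis. (- 1 * (x \<bullet> j)) *\<^sub>R j)) = uminus"
    by (auto simp: fun_eq_iff sum_negf euclidean_representation)
  show "uminus \<in> lebesgue \<rightarrow>\<^sub>M (lebesgue :: 'a measure)"
    using lebesgue_affine_measurable[of "\<lambda>_. - 1" "0 :: 'a"] unfolding eq by simp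
  show "distr lebesgue lebesgue uminus = (lebesgue :: 'a measure)"
    using lebesgue_affine_euclidean[of "\<lambda>_. - 1" "0 :: 'a"] unfolding eq by (simp add: density_1)
qed

lemma lebesgue_integral_reflect:
  fixes f :: "'a::euclidean_space \<Rightarrow> real"
  assumes "f \<in> borel_measurable lebesgue"
  shows "(\<integral>x. f (- x) \<partial>lebesgue) = (\<integral>x. f x \<partial>lebesgue)"
  using integral_distr[OF lebesgue_reflect_measurable assms] by (simp add: lebesgue_distr_uminus)

text \<open>The inverse transform is a reflected forward transform, so Plancherel applies to it
  directly: one factor (2 * pi)^DIM from Plancherel against two from the squared
  normalisation.\<close>

lemma frac_laplacian_norm:
  fixes f :: "'a::euclidean_space \<Rightarrow> complex"
  assumes g: "square_integrable (\<lambda>\<xi>. complex_of_real (norm \<xi> powr s) * fourier_L2 f \<xi>)"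
  shows "sq_norm (frac_laplacian s f)
    = sq_norm (\<lambda>\<xi>. complex_of_real (norm \<xi> powr s) * fourier_L2 f \<xi>) / (2 * pi) ^ DIM('a)"
proof -
  let ?g = "\<lambda>\<xi>. complex_of_real (norm \<xi> powr s) * fourier_L2 f \<xi>" and ?K = "(2 * pi) ^ DIM('a)"
  have [measurable]: "fourier_L2 ?g \<in> borel_measurable lebesgue" using square_integrable_fourier_L2[OF g] by auto
  have K: "?K > 0" by simp
  have "sq_norm (frac_laplacian s f) = (\<integral>y. (cmod (fourier_L2 ?g (- y)))\<^sup>2 / ?K\<^sup>2 \<partial>lebesgue)"
    unfolding frac_laplacian_def fourier_multiplier_def inv_fourier_L2_def
    by (simp add: norm_divide norm_power power_divide abs_of_pos norm_mult)
  also have "\<dots> = (\<integral>y. (cmod (fourier_L2 ?g y))\<^sup>2 / ?K\<^sup>2 \<partial>lebesgue)"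
    by (rule lebesgue_integral_reflect[where f = "\<lambda>y. (cmod (fourier_L2 ?g y))\<^sup>2 / ?K\<^sup>2"]) measurable
  also have "\<dots> = sq_norm (fourier_L2 ?g) / ?K\<^sup>2"
    by (rule integral_divide_zero)
  also have "\<dots> = (sq_norm ?g) / ?K"
    unfolding plancherel_L2[OF g] using K by (simp only: power2_eq_square) (simp add: field_simps)
  finally show ?thesis .
qed

lemma sobolev_space_homogeneous:
  assumes f: "f \<in> sobolev_space s" and s: "0 \<le> s"
  shows "square_integrable (\<lambda>\<xi>. complex_of_real (norm \<xi> powr s) * fourier_L2 f \<xi>)"
proof (rule square_integrable_bound)
  have f2: "square_integrable f" using f by (simp add: sobolev_space_def)
  have [measurable]: "fourier_L2 f \<in> borel_measurable lebesgue" using square_integrable_fourier_L2[OF f2] by auto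
  have [measurable]: "(\<lambda>\<xi>. complex_of_real (norm \<xi> powr s)) \<in> borel_measurable lebesgue"
    by (rule borel_imp_lebesgue_measurable) measurable
  show "square_integrable (\<lambda>\<xi>. complex_of_real ((1 + (norm \<xi>)\<^sup>2) powr (s / 2)) * fourier_L2 f \<xi>)"
    using f by (simp add: sobolev_space_def)
  show "(\<lambda>\<xi>. complex_of_real (norm \<xi> powr s) * fourier_L2 f \<xi>) \<in> borel_measurable lebesgue" by measurable
  have "norm \<xi> powr s \<le> (1 + (norm \<xi>)\<^sup>2) powr (s / 2)" for \<xi> :: 'a
  proof -
    have "norm \<xi> powr s = ((norm \<xi>)\<^sup>2) powr (s / 2)"
      by (cases "\<xi> = 0") (simp_all add: powr_powr powr_numeral[symmetric] del: powr_numeral)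
    also have "\<dots> \<le> (1 + (norm \<xi>)\<^sup>2) powr (s / 2)" using s by (intro powr_mono2) auto
    finally show ?thesis .
  qed
  then show "AE \<xi> in lebesgue. cmod (complex_of_real (norm \<xi> powr s) * fourier_L2 f \<xi>)
      \<le> cmod (complex_of_real ((1 + (norm \<xi>)\<^sup>2) powr (s / 2)) * fourier_L2 f \<xi>)"
    by (auto simp: norm_mult intro!: AE_I2 mult_right_mono)
qed

text \<open>The inhomogeneous weight is at most (1 + |\<xi>|)^s, and the power s < 1 is subadditive,
  so it is controlled by 1 and the homogeneous weight.\<close>

lemma sobolev_spaceI:
  assumes f: "square_integrable f" and g: "square_integrable (\<lambda>\<xi>. complex_of_real (norm \<xi> powr s) * fourier_L2 f \<xi>)"
    and s: "0 < s" "s < 1"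
  shows "f \<in> sobolev_space s"
proof -
  have f': "square_integrable (fourier_L2 f)" by (rule square_integrable_fourier_L2[OF f])
  have [measurable]: "fourier_L2 f \<in> borel_measurable lebesgue" using f' by auto
  have [measurable]: "(\<lambda>\<xi>::'a. complex_of_real ((1 + (norm \<xi>)\<^sup>2) powr (s / 2))) \<in> borel_measurable lebesgue"
    by (rule borel_imp_lebesgue_measurable) measurable
  have le: "((1 + (norm \<xi>)\<^sup>2) powr (s / 2))\<^sup>2 \<le> 2 * 1 + 2 * (norm \<xi> powr s)\<^sup>2" for \<xi> :: 'a
  proof -
    have "(1 + (norm \<xi>)\<^sup>2) powr (s / 2) \<le> (1 + norm \<xi>)\<^sup>2 powr (s / 2)"
      using s by (intro powr_mono2) (auto simp: power2_sum)
    also have "\<dots> = (1 + norm \<xi>) powr s" by (simp add: powr_powr powr_numeral[symmetric] del: powr_numeral)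
    also have "\<dots> \<le> 1 + norm \<xi> powr s"
    proof -
      \<comment> \<open>Subadditivity by normalising: 1 / u and |\<xi>| / u lie between 0 and 1 and
        sum to 1, and there z \<le> z^s.\<close>
      define u where "u = 1 + norm \<xi>"
      have u: "u > 0" "1 \<le> u" "norm \<xi> \<le> u" by (auto simp: u_def add_pos_nonneg)
      have "1 / u \<le> (1 / u) powr s" using u s powr_mono'[of s 1 "1 / u"] by simp
      moreover have "norm \<xi> / u \<le> (norm \<xi> / u) powr s" using u s powr_mono'[of s 1 "norm \<xi> / u"] by simp
      moreover have "1 / u + norm \<xi> / u = 1" using u by (simp add: u_def field_simps)
      ultimately have "1 \<le> (1 / u) powr s + (norm \<xi> / u) powr s" by linarith
      also have "\<dots> = (1 + norm \<xi> powr s) / u powr s" using u by (simp add: powr_divide add_divide_distrib)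
      finally show ?thesis using u by (simp add: u_def field_simps)
    qed
    finally have "((1 + (norm \<xi>)\<^sup>2) powr (s / 2))\<^sup>2 \<le> (1 + norm \<xi> powr s)\<^sup>2" by (intro power_mono) auto
    also have "\<dots> \<le> 2 * 1 + 2 * (norm \<xi> powr s)\<^sup>2" using norm_add_square_le[of 1 "norm \<xi> powr s"] by simp
    finally show ?thesis .
  qed
  have "integrable lebesgue (\<lambda>\<xi>. (cmod (complex_of_real ((1 + (norm \<xi>)\<^sup>2) powr (s / 2)) * fourier_L2 f \<xi>))\<^sup>2)"
  proof (rule Bochner_Integration.integrable_bound)
    show "integrable lebesgue (\<lambda>\<xi>. 2 * (cmod (fourier_L2 f \<xi>))\<^sup>2 + 2 * (cmod (complex_of_real (norm \<xi> powr s) * fourier_L2 f \<xi>))\<^sup>2)"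
      using f' g by (auto simp: square_integrable_def)
    have "((1 + (norm \<xi>)\<^sup>2) powr (s / 2))\<^sup>2 * (cmod (fourier_L2 f \<xi>))\<^sup>2 \<le> (2 * 1 + 2 * (norm \<xi> powr s)\<^sup>2) * (cmod (fourier_L2 f \<xi>))\<^sup>2" for \<xi>
      by (intro mult_right_mono le) auto
    then show "AE \<xi> in lebesgue. norm ((cmod (complex_of_real ((1 + (norm \<xi>)\<^sup>2) powr (s / 2)) * fourier_L2 f \<xi>))\<^sup>2)
        \<le> norm (2 * (cmod (fourier_L2 f \<xi>))\<^sup>2 + 2 * (cmod (complex_of_real (norm \<xi> powr s) * fourier_L2 f \<xi>))\<^sup>2)"
      by (intro AE_I2) (simp add: norm_mult power_mult_distrib algebra_simps)
  qed measurable
  then show ?thesis using f by (simp add: sobolev_space_def square_integrable_def)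
qed

lemma fourier_L2_cong_AE:
  assumes f: "square_integrable f" and g: "square_integrable g" and ae: "AE x in lebesgue. f x = g x"
  shows "AE \<xi> in lebesgue. fourier_L2 f \<xi> = fourier_L2 g \<xi>"
proof -
  have fg: "square_integrable (\<lambda>x. f x - g x)" by (rule square_integrable_diff[OF f g])
  have [measurable]: "f \<in> borel_measurable lebesgue" "g \<in> borel_measurable lebesgue" using f g by auto
  have "sq_norm (\<lambda>x. f x - g x) = 0"
    by (rule integral_eq_zero_AE) (use ae in \<open>auto elim: eventually_mono\<close>)
  then have "sq_norm (fourier_L2 (\<lambda>x. f x - g x)) = 0" by (simp add: plancherel_L2[OF fg])
  then have "AE \<xi> in lebesgue. fourier_L2 (\<lambda>x. f x - g x) \<xi> = 0"
    by (rule square_integrable_zero_AE[OF square_integrable_fourier_L2[OF fg]])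
  then show ?thesis using fourier_L2_diff[OF f g] by eventually_elim simp
qed

lemma fourier_L2_inject_AE:
  assumes f: "square_integrable f" and g: "square_integrable g" and ae: "AE \<xi> in lebesgue. fourier_L2 f \<xi> = fourier_L2 g \<xi>"
  shows "AE x in lebesgue. f x = g x"
proof -
  have fg: "square_integrable (\<lambda>x. f x - g x)" by (rule square_integrable_diff[OF f g])
  have [measurable]: "fourier_L2 (\<lambda>x. f x - g x) \<in> borel_measurable lebesgue" using square_integrable_fourier_L2[OF fg] by auto
  have "AE \<xi> in lebesgue. fourier_L2 (\<lambda>x. f x - g x) \<xi> = 0"
    using fourier_L2_diff[OF f g] ae by eventually_elim simp
  then have "sq_norm (fourier_L2 (\<lambda>x. f x - g x)) = 0"
    by (intro integral_eq_zero_AE) (auto elim: eventually_mono)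
  then have "sq_norm (\<lambda>x. f x - g x) = 0" by (simp add: plancherel_L2[OF fg])
  from square_integrable_zero_AE[OF fg this] show ?thesis by simp
qed

text \<open>Functions are not identified modulo null sets, while the minimiser is determined only up
  to them; the converse half of the theorem rests on this invariance.\<close>

lemma admissible_cong_AE:
  fixes u v :: "'a::euclidean_space \<Rightarrow> real"
  assumes u: "u \<in> admissible s \<beta>" and ae: "AE x in lebesgue. v x = u x" and s: "0 < s" "s < 1"
  shows "v \<in> admissible s \<beta>" and "energy s \<beta> v = energy s \<beta> u"
proof -
  let ?cu = "\<lambda>x. complex_of_real (u x)" and ?cv = "\<lambda>x. complex_of_real (v x)"
  have uS: "?cu \<in> sobolev_space s" and uV: "integrable lebesgue (\<lambda>y. (\<beta> / 2 * (norm y)\<^sup>2 - 1) * u y)" and u0: "AE y in lebesgue. 0 \<le> u y"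
    using u by (auto simp: admissible_def)
  have u2: "square_integrable ?cu" using uS by (simp add: sobolev_space_def)
  have um: "?cu \<in> borel_measurable lebesgue" using u2 by auto
  have vm: "?cv \<in> borel_measurable lebesgue" by (rule borel_measurable_AE[OF um]) (use ae in \<open>auto elim: eventually_mono\<close>)
  have v2: "square_integrable ?cv"
    by (rule square_integrable_bound[OF u2 vm]) (use ae in \<open>auto elim: eventually_mono\<close>)
  have F: "AE \<xi> in lebesgue. fourier_L2 ?cv \<xi> = fourier_L2 ?cu \<xi>"
    by (rule fourier_L2_cong_AE[OF v2 u2]) (use ae in \<open>auto elim: eventually_mono\<close>)
  have [measurable]: "fourier_L2 ?cv \<in> borel_measurable lebesgue" "fourier_L2 ?cu \<in> borel_measurable lebesgue"
    using square_integrable_fourier_L2[OF v2] square_integrable_fourier_L2[OF u2] by auto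
  have [measurable]: "(\<lambda>\<xi>::'a. complex_of_real (norm \<xi> powr s)) \<in> borel_measurable lebesgue"
    by (rule borel_imp_lebesgue_measurable) measurable
  have gu: "square_integrable (\<lambda>\<xi>. complex_of_real (norm \<xi> powr s) * fourier_L2 ?cu \<xi>)"
    using uS s by (intro sobolev_space_homogeneous) auto
  have gv: "square_integrable (\<lambda>\<xi>. complex_of_real (norm \<xi> powr s) * fourier_L2 ?cv \<xi>)"
    by (rule square_integrable_bound[OF gu]) (measurable, use F in \<open>auto elim: eventually_mono\<close>)
  have "(\<lambda>y::'a. complex_of_real (\<beta> / 2 * (norm y)\<^sup>2 - 1)) \<in> borel_measurable lebesgue"
    by (rule borel_imp_lebesgue_measurable) measurable
  then have "(\<lambda>y. Re (complex_of_real (\<beta> / 2 * (norm y)\<^sup>2 - 1) * ?cv y)) \<in> borel_measurable lebesgue"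
    using vm by measurable
  then have vVm: "(\<lambda>y. (\<beta> / 2 * (norm y)\<^sup>2 - 1) * v y) \<in> borel_measurable lebesgue" by simp
  have Vae: "AE y in lebesgue. (\<beta> / 2 * (norm y)\<^sup>2 - 1) * v y = (\<beta> / 2 * (norm y)\<^sup>2 - 1) * u y"
    using ae by eventually_elim simp
  have vV: "integrable lebesgue (\<lambda>y. (\<beta> / 2 * (norm y)\<^sup>2 - 1) * v y)"
    using uV vVm Vae by (subst integrable_cong_AE) auto
  have "AE y in lebesgue. 0 \<le> v y" using u0 ae by eventually_elim simp
  then show "v \<in> admissible s \<beta>"
    using sobolev_spaceI[OF v2 gv s] vV by (simp add: admissible_def)
  have 1: "sq_norm (\<lambda>\<xi>. complex_of_real (norm \<xi> powr s) * fourier_L2 ?cv \<xi>)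
      = sq_norm (\<lambda>\<xi>. complex_of_real (norm \<xi> powr s) * fourier_L2 ?cu \<xi>)"
    by (rule integral_cong_AE) (measurable, use F in \<open>auto elim: eventually_mono\<close>)
  have 2: "(\<integral>y. (\<beta> / 2 * (norm y)\<^sup>2 - 1) * v y \<partial>lebesgue) = (\<integral>y. (\<beta> / 2 * (norm y)\<^sup>2 - 1) * u y \<partial>lebesgue)"
    by (rule integral_cong_AE[OF vVm _ Vae]) (use uV in auto)
  show "energy s \<beta> v = energy s \<beta> u"
    unfolding energy_def frac_laplacian_norm[OF gu] frac_laplacian_norm[OF gv] 1 2 ..
qed

text \<open>The variational inequality: \<open>w\<close> is the fractional Laplacian of \<open>u\<close>, and the
  complementarity conditions on \<open>w + V\<close> make \<open>u\<close> the minimiser with a quadratic gap.\<close>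

lemma energy_gap:
  fixes u w v :: "'a::euclidean_space \<Rightarrow> real"
  assumes s: "0 < s" and u: "u \<in> admissible s \<beta>" and v: "v \<in> admissible s \<beta>"
    and w: "square_integrable (\<lambda>x. complex_of_real (w x))"
    and F: "AE \<xi> in lebesgue. fourier_L2 (\<lambda>x. complex_of_real (w x)) \<xi>
        = complex_of_real (norm \<xi> powr (2 * s)) * fourier_L2 (\<lambda>x. complex_of_real (u x)) \<xi>"
    and ge: "\<And>x. 1 - \<beta> / 2 * (norm x)\<^sup>2 \<le> w x"
    and eq: "\<And>x. u x \<noteq> 0 \<Longrightarrow> w x = 1 - \<beta> / 2 * (norm x)\<^sup>2"
  shows "energy s \<beta> u + 1 / (2 * (2 * pi) ^ DIM('a)) *
      sq_norm (\<lambda>\<xi>. complex_of_real (norm \<xi> powr s) * fourier_L2 (\<lambda>x. complex_of_real (v x)) \<xi>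
        - complex_of_real (norm \<xi> powr s) * fourier_L2 (\<lambda>x. complex_of_real (u x)) \<xi>) \<le> energy s \<beta> v"
proof -
  let ?c = "\<lambda>f x. complex_of_real (f x)" and ?K = "(2 * pi) ^ DIM('a)"
  let ?g = "\<lambda>f \<xi>. complex_of_real (norm \<xi> powr s) * fourier_L2 (?c f) \<xi>"
  let ?V = "\<lambda>y::'a. \<beta> / 2 * (norm y)\<^sup>2 - 1"
  have K: "?K > 0" by simp
  \<comment> \<open>Parseval with both factors |\<xi>|^s moved onto \<open>u\<close>, where they
    make up the transform of \<open>w\<close>: the bilinear form of the energy at \<open>u\<close>
    is integration against \<open>w\<close>.\<close>
  have pair: "(\<integral>\<xi>. Re (?g f \<xi> * cnj (?g u \<xi>)) \<partial>lebesgue) = ?K * (\<integral>x. w x * f x \<partial>lebesgue)"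
    "integrable lebesgue (\<lambda>x. w x * f x)" if f: "f \<in> admissible s \<beta>" for f
  proof -
    have f2: "square_integrable (?c f)" using f by (simp add: admissible_def sobolev_space_def)
    have sq: "square_integrable (?g h)" if "h \<in> admissible s \<beta>" for h
      using that s by (intro sobolev_space_homogeneous) (auto simp: admissible_def)
    have [measurable]: "?g f \<in> borel_measurable lebesgue" "?g u \<in> borel_measurable lebesgue"
      "fourier_L2 (?c f) \<in> borel_measurable lebesgue" "fourier_L2 (?c w) \<in> borel_measurable lebesgue"
      using sq[OF f] sq[OF u] square_integrable_fourier_L2[OF f2] square_integrable_fourier_L2[OF w] by auto
    have "(\<integral>\<xi>. Re (?g f \<xi> * cnj (?g u \<xi>)) \<partial>lebesgue) = (\<integral>\<xi>. Re (fourier_L2 (?c f) \<xi> * cnj (fourier_L2 (?c w) \<xi>)) \<partial>lebesgue)"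
    proof (rule integral_cong_AE)
      show "AE \<xi> in lebesgue. Re (?g f \<xi> * cnj (?g u \<xi>)) = Re (fourier_L2 (?c f) \<xi> * cnj (fourier_L2 (?c w) \<xi>))"
        using F
      proof eventually_elim
        case (elim \<xi>)
        have "norm \<xi> powr (2 * s) = norm \<xi> powr s * norm \<xi> powr s" by (simp add: powr_add[symmetric])
        then show ?case unfolding elim by (simp add: algebra_simps)
      qed
    qed measurable
    also have "\<dots> = ?K * (\<integral>x. Re (?c f x * cnj (?c w x)) \<partial>lebesgue)" by (rule parseval_L2[OF f2 w])
    finally show "(\<integral>\<xi>. Re (?g f \<xi> * cnj (?g u \<xi>)) \<partial>lebesgue) = ?K * (\<integral>x. w x * f x \<partial>lebesgue)"
      by (simp add: mult.commute)
    have "integrable lebesgue (\<lambda>x. Re (?c w x * ?c f x))"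
      by (intro integrable_Re square_integrable_mult_integrable w f2)
    then show "integrable lebesgue (\<lambda>x. w x * f x)" by simp
  qed
  have gu: "square_integrable (?g u)" and gv: "square_integrable (?g v)"
    using u v s by (auto intro!: sobolev_space_homogeneous simp: admissible_def)
  have uV: "integrable lebesgue (\<lambda>y. ?V y * u y)" and vV: "integrable lebesgue (\<lambda>y. ?V y * v y)" and v0: "AE y in lebesgue. 0 \<le> v y"
    using u v by (auto simp: admissible_def)
  define R where "R = sq_norm (\<lambda>\<xi>. ?g v \<xi> - ?g u \<xi>)"
  define Qu where "Qu = sq_norm (?g u)"
  define Qv where "Qv = sq_norm (?g v)"
  define wu where "wu = (\<integral>x. w x * u x \<partial>lebesgue)"
  define wv where "wv = (\<integral>x. w x * v x \<partial>lebesgue)"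
  define Vu where "Vu = (\<integral>x. ?V x * u x \<partial>lebesgue)"
  define Vv where "Vv = (\<integral>x. ?V x * v x \<partial>lebesgue)"
  have "2 * (\<integral>\<xi>. Re (?g v \<xi> * cnj (?g u \<xi>)) \<partial>lebesgue) = Qv + Qu - R"
    unfolding Qv_def Qu_def R_def by (rule square_integral_polarisation[OF gv gu])
  then have pol: "2 * (?K * wv) = Qv + Qu - R" unfolding pair(1)[OF v] wv_def .
  have "(\<integral>\<xi>. Re (?g u \<xi> * cnj (?g u \<xi>)) \<partial>lebesgue) = Qu"
  proof -
    have "Re (z * cnj z) = (cmod z)\<^sup>2" for z unfolding cmod_power2 by (simp add: power2_eq_square)
    then show ?thesis unfolding Qu_def by presburger
  qed
  then have Qu: "Qu = ?K * wu" unfolding pair(1)[OF u] wu_def ..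
  \<comment> \<open>Complementarity: where \<open>u\<close> does not vanish, w + V does.\<close>
  have zero: "wu + Vu = 0"
  proof -
    have "wu + Vu = (\<integral>x. w x * u x + ?V x * u x \<partial>lebesgue)"
      unfolding wu_def Vu_def by (rule Bochner_Integration.integral_add[symmetric, OF pair(2)[OF u] uV])
    also have "\<dots> = (\<integral>x. 0 \<partial>(lebesgue :: 'a measure))"
    proof (rule Bochner_Integration.integral_cong[OF refl])
      fix x show "w x * u x + ?V x * u x = 0"
      proof (cases "u x = 0")
        case False
        then have "w x + ?V x = 0" by (simp add: eq)
        then show ?thesis by (simp only: distrib_right[symmetric] mult_zero_left)
      qed simp
    qed
    finally show ?thesis by simp
  qed
  have nonneg: "0 \<le> wv + Vv"
  proof -
    have "0 \<le> (\<integral>x. w x * v x + ?V x * v x \<partial>lebesgue)"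
    proof (rule integral_nonneg_AE)
      show "AE x in lebesgue. 0 \<le> w x * v x + ?V x * v x"
        using v0
      proof eventually_elim
        case (elim x)
        then have "0 \<le> (w x + ?V x) * v x" using ge[of x] by (intro mult_nonneg_nonneg) auto
        then show ?case by (simp add: distrib_right)
      qed
    qed
    then show ?thesis unfolding wv_def Vv_def using Bochner_Integration.integral_add[OF pair(2)[OF v] vV] by simp
  qed
  have Eu: "energy s \<beta> u = 1 / 2 * (Qu / ?K) + Vu"
    unfolding energy_def frac_laplacian_norm[OF gu] Qu_def Vu_def ..
  have Ev: "energy s \<beta> v = 1 / 2 * (Qv / ?K) + Vv"
    unfolding energy_def frac_laplacian_norm[OF gv] Qv_def Vv_def ..
  \<comment> \<open>Expanding the square around \<open>u\<close> leaves the first variation (wv +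
    Vv) - (wu + Vu), which is nonnegative, and the quadratic remainder \<open>R\<close>.\<close>
  have "Qv = 2 * ?K * wv - ?K * wu + R" using pol Qu by linarith
  then have "Qv / ?K = 2 * wv - wu + R / ?K" using K by (simp add: field_simps)
  moreover have "Qu / ?K = wu" using K Qu by simp
  ultimately have "energy s \<beta> v = energy s \<beta> u + (wv + Vv) - (wu + Vu) + 1 / 2 * (R / ?K)"
    unfolding Eu Ev by simp
  then have "energy s \<beta> u + 1 / 2 * (R / ?K) \<le> energy s \<beta> v" using zero nonneg by linarith
  then show ?thesis unfolding R_def by simp
qed

subsection \<open>The minimiser\<close>

lemma bounded_integrable_square_integrable:
  fixes f :: "'a::euclidean_space \<Rightarrow> real"
  assumes f: "integrable lborel f" and M: "\<And>x. \<bar>f x\<bar> \<le> M"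
  shows "square_integrable (\<lambda>x. complex_of_real (f x))" and "integrable lebesgue (\<lambda>x. complex_of_real (f x))"
proof -
  have [measurable]: "f \<in> borel_measurable borel" using f by auto
  have fl: "integrable lebesgue f" using f by (simp add: integrable_completion)
  then show "integrable lebesgue (\<lambda>x. complex_of_real (f x))" by simp
  have "integrable lebesgue (\<lambda>x. (f x)\<^sup>2)"
  proof (rule Bochner_Integration.integrable_bound)
    show "integrable lebesgue (\<lambda>x. M * f x)" using fl by simp
    show "(\<lambda>x. (f x)\<^sup>2) \<in> borel_measurable lebesgue" by (rule borel_imp_lebesgue_measurable) measurable
    show "AE x in lebesgue. norm ((f x)\<^sup>2) \<le> norm (M * f x)"
    proof (rule AE_I2)
      fix x
      have "\<bar>f x\<bar> * \<bar>f x\<bar> \<le> \<bar>M\<bar> * \<bar>f x\<bar>" using M[of x] by (intro mult_right_mono) auto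
      then show "norm ((f x)\<^sup>2) \<le> norm (M * f x)" by (simp add: power2_eq_square abs_mult)
    qed
  qed
  moreover have "(\<lambda>x. complex_of_real (f x)) \<in> borel_measurable lebesgue"
    by (rule borel_imp_lebesgue_measurable) measurable
  ultimately show "square_integrable (\<lambda>x. complex_of_real (f x))" by (simp add: square_integrable_def)
qed

lemma fourier_L1_cmult: "fourier_L1 (\<lambda>x. c * f x) \<xi> = c * fourier_L1 f \<xi>"
proof -
  have "fourier_L1 (\<lambda>x. c * f x) \<xi> = (\<integral>x. c * (fourier_char \<xi> x * f x) \<partial>lebesgue)"
    unfolding fourier_L1_def by (simp only: mult.left_commute)
  then show ?thesis unfolding fourier_L1_def by (simp only: integral_mult_right_zero)
qed

lemma kappa_const_pos: "0 < s \<Longrightarrow> 0 < d \<Longrightarrow> 0 < kappa_const s d"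
  unfolding kappa_const_def by (intro divide_pos_pos mult_pos_pos Gamma_real_pos) auto

context
  fixes s \<beta> :: real
  assumes s: "0 < s" "s < 1" and \<beta>: "0 < \<beta>"
begin

lemma lambda_const_square: "(lambda_const s \<beta> d)\<^sup>2 = \<beta> / (2 * gamma_const s d)" and lambda_const_pos: "0 < lambda_const s \<beta> d"
proof -
  have g: "0 < gamma_const s d" using s by (simp add: gamma_const_def add_pos_nonneg)
  then show "(lambda_const s \<beta> d)\<^sup>2 = \<beta> / (2 * gamma_const s d)" "0 < lambda_const s \<beta> d"
    using \<beta> by (simp_all add: lambda_const_def)
qed

text \<open>Taking l^2 out of the positive part produces l^2 * l^(2 * s); the normalisation in
  \<open>v_D\<close> cancels the second factor. The level is the squared radius of the
  support.\<close>

lemma v_D_eq_cap: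
  fixes x :: "'a::euclidean_space"
  shows "v_D s \<beta> x = (lambda_const s \<beta> DIM('a))\<^sup>2 / kappa_const s DIM('a) * cap (1 / (lambda_const s \<beta> DIM('a))\<^sup>2) x powr (1 + s)"
proof -
  define l where "l = lambda_const s \<beta> DIM('a)"
  have l: "0 < l" unfolding l_def by (rule lambda_const_pos)
  have "max 0 (1 - l\<^sup>2 * (norm x)\<^sup>2) = l\<^sup>2 * cap (1 / l\<^sup>2) x"
    using l by (simp add: cap_def max_mult_distrib_left right_diff_distrib)
  moreover have "(l\<^sup>2 * cap (1 / l\<^sup>2) x) powr (1 + s) = l\<^sup>2 * l powr (2 * s) * cap (1 / l\<^sup>2) x powr (1 + s)"
  proof -
    have "(l\<^sup>2) powr (1 + s) = l\<^sup>2 * (l\<^sup>2) powr s" using l by (simp add: powr_add)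
    also have "(l\<^sup>2) powr s = l powr (2 * s)" using l by (simp add: powr_powr[symmetric] powr_numeral)
    finally show ?thesis using l by (simp add: powr_mult)
  qed
  ultimately show ?thesis unfolding v_D_def Let_def l_def[symmetric] using l by simp
qed

definition v_D_laplacian :: "'a::euclidean_space \<Rightarrow> real" where
  "v_D_laplacian x = (lambda_const s \<beta> DIM('a))\<^sup>2 / kappa_const s DIM('a) * cap_laplacian s (1 / (lambda_const s \<beta> DIM('a))\<^sup>2) x"

lemma v_D_coefficient_pos: "0 < (lambda_const s \<beta> DIM('a::euclidean_space))\<^sup>2 / kappa_const s DIM('a)"
  using lambda_const_pos[of "DIM('a)"] kappa_const_pos[of s "DIM('a)"] s by simp

text \<open>Here the constants of \<open>v_D\<close> are explained: the prefactor l^2 / kappa at the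
  level 1 / l^2 normalises the constant term of the quadratic to 1, and l^2 * gamma = \<beta> / 2
  matches its quadratic term with the potential.\<close>

lemma v_D_laplacian_bounds:
  fixes x :: "'a::euclidean_space"
  shows "1 - \<beta> / 2 * (norm x)\<^sup>2 \<le> v_D_laplacian x"
    and "v_D s \<beta> x \<noteq> 0 \<Longrightarrow> v_D_laplacian x = 1 - \<beta> / 2 * (norm x)\<^sup>2"
proof -
  define l where "l = lambda_const s \<beta> DIM('a)"
  define k where "k = kappa_const s DIM('a)"
  define g where "g = gamma_const s DIM('a)"
  have l: "0 < l" unfolding l_def by (rule lambda_const_pos)
  have k: "0 < k" unfolding k_def using s by (intro kappa_const_pos) auto
  have g: "0 < g" using s by (simp add: g_def gamma_const_def add_pos_nonneg)
  have l2: "l\<^sup>2 = \<beta> / (2 * g)" unfolding l_def g_def by (rule lambda_const_square)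
  have t: "0 \<le> 1 / l\<^sup>2" by simp
  have eq: "l\<^sup>2 / k * (k * (1 / l\<^sup>2 - g * (norm x)\<^sup>2)) = 1 - \<beta> / 2 * (norm x)\<^sup>2"
  proof -
    have "l\<^sup>2 / k * (k * (1 / l\<^sup>2 - g * (norm x)\<^sup>2)) = 1 - (l\<^sup>2 * g) * (norm x)\<^sup>2"
      using l k by (simp add: right_diff_distrib)
    also have "l\<^sup>2 * g = \<beta> / 2" using g by (simp add: l2)
    finally show ?thesis .
  qed
  have c: "0 \<le> l\<^sup>2 / k" using k by simp
  show "1 - \<beta> / 2 * (norm x)\<^sup>2 \<le> v_D_laplacian x"
    unfolding v_D_laplacian_def eq[symmetric] l_def[symmetric] k_def[symmetric]
    using cap_laplacian_ge(1)[OF s t, of x] c unfolding k_def g_def by (intro mult_left_mono)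
  assume "v_D s \<beta> x \<noteq> 0"
  then have "cap (1 / l\<^sup>2) x \<noteq> 0" unfolding v_D_eq_cap l_def by auto
  then have "(norm x)\<^sup>2 \<le> 1 / l\<^sup>2" by (auto simp: cap_def max_def split: if_splits)
  then show "v_D_laplacian x = 1 - \<beta> / 2 * (norm x)\<^sup>2"
    unfolding v_D_laplacian_def eq[symmetric] l_def[symmetric] k_def[symmetric]
    using cap_laplacian_ge(2)[OF s t, of x] unfolding k_def g_def by simp
qed

lemma
  shows v_D_lborel: "integrable lborel (v_D s \<beta> :: 'a::euclidean_space \<Rightarrow> real)"
    and v_D_square_integrable: "square_integrable (\<lambda>x :: 'a. complex_of_real (v_D s \<beta> x))"
    and v_D_lebesgue: "integrable lebesgue (\<lambda>x :: 'a. complex_of_real (v_D s \<beta> x))"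
    and v_D_laplacian_square_integrable: "square_integrable (\<lambda>x :: 'a. complex_of_real (v_D_laplacian x))"
    and v_D_laplacian_lebesgue: "integrable lebesgue (\<lambda>x :: 'a. complex_of_real (v_D_laplacian x))"
proof -
  define a where "a = (lambda_const s \<beta> DIM('a))\<^sup>2 / kappa_const s DIM('a)"
  define t where "t = 1 / (lambda_const s \<beta> DIM('a))\<^sup>2"
  have a: "0 < a" unfolding a_def by (rule v_D_coefficient_pos)
  have t: "0 \<le> t" by (simp add: t_def)
  have vD: "v_D s \<beta> = (\<lambda>x :: 'a. a * cap t x powr (1 + s))" by (simp add: fun_eq_iff v_D_eq_cap a_def t_def)
  have w: "v_D_laplacian = (\<lambda>x :: 'a. a * cap_laplacian s t x)" by (simp add: fun_eq_iff v_D_laplacian_def a_def t_def)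
  show 1: "integrable lborel (v_D s \<beta> :: 'a \<Rightarrow> real)"
    unfolding vD by (intro integrable_mult_right cap_power_integrable s t)
  have 2: "integrable lborel (v_D_laplacian :: 'a \<Rightarrow> real)"
    unfolding w by (intro integrable_mult_right cap_laplacian_integrable s)
  have b1: "\<bar>v_D s \<beta> (x :: 'a)\<bar> \<le> a * (1 + t)\<^sup>2" for x
    unfolding vD using a cap_power_le[OF s t, of x] by (simp add: abs_mult)
  have b2: "\<bar>v_D_laplacian (x :: 'a)\<bar> \<le> a * (levy_const s * ((4 + real DIM('a)) * t * 2 * (Gamma (1 - s) / s)))" for x
    unfolding w abs_mult using a cap_laplacian_bounded[OF s t, of x] by (simp only: abs_of_pos) (simp only: mult_left_mono less_imp_le)
  show "square_integrable (\<lambda>x :: 'a. complex_of_real (v_D s \<beta> x))" "integrable lebesgue (\<lambda>x :: 'a. complex_of_real (v_D s \<beta> x))"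
    by (rule bounded_integrable_square_integrable[OF 1 b1])+
  show "square_integrable (\<lambda>x :: 'a. complex_of_real (v_D_laplacian x))" "integrable lebesgue (\<lambda>x :: 'a. complex_of_real (v_D_laplacian x))"
    by (rule bounded_integrable_square_integrable[OF 2 b2])+
qed

lemma fourier_v_D_laplacian:
  "AE \<xi> in lebesgue. fourier_L2 (\<lambda>x :: 'a::euclidean_space. complex_of_real (v_D_laplacian x)) \<xi>
     = complex_of_real (norm \<xi> powr (2 * s)) * fourier_L2 (\<lambda>x. complex_of_real (v_D s \<beta> x)) \<xi>"
  using fourier_L2_eq_fourier_L1[OF v_D_laplacian_square_integrable v_D_laplacian_lebesgue, where 'a = 'a]
    fourier_L2_eq_fourier_L1[OF v_D_square_integrable v_D_lebesgue, where 'a = 'a]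
proof eventually_elim
  case (elim \<xi>)
  show ?case unfolding elim unfolding v_D_laplacian_def v_D_eq_cap of_real_mult fourier_L1_cmult fourier_cap_laplacian[OF s]
    by (simp add: mult_ac)
qed

lemma v_D_admissible: "(v_D s \<beta> :: 'a::euclidean_space \<Rightarrow> real) \<in> admissible s \<beta>"
proof -
  let ?u = "\<lambda>x :: 'a. complex_of_real (v_D s \<beta> x)" and ?w = "\<lambda>x :: 'a. complex_of_real (v_D_laplacian x)"
  have u: "square_integrable (fourier_L2 ?u)" and w: "square_integrable (fourier_L2 ?w)"
    by (intro square_integrable_fourier_L2 v_D_square_integrable v_D_laplacian_square_integrable)+
  have [measurable]: "fourier_L2 ?u \<in> borel_measurable lebesgue" "fourier_L2 ?w \<in> borel_measurable lebesgue" using u w by auto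
  have [measurable]: "(\<lambda>\<xi>::'a. complex_of_real (norm \<xi> powr s)) \<in> borel_measurable lebesgue"
    by (rule borel_imp_lebesgue_measurable) measurable
  \<comment> \<open>|\<xi>|^(2 * s) times the squared transform of \<open>v_D\<close> has the
    modulus of the product of the transforms of \<open>v_D_laplacian\<close> and \<open>v_D\<close>,
    both square integrable: Sobolev regularity follows from the fractional Laplacian being square
    integrable.\<close>
  have "integrable lebesgue (\<lambda>\<xi>. (cmod (complex_of_real (norm \<xi> powr s) * fourier_L2 ?u \<xi>))\<^sup>2)"
  proof (rule Bochner_Integration.integrable_bound)
    show "integrable lebesgue (\<lambda>\<xi>. fourier_L2 ?w \<xi> * fourier_L2 ?u \<xi>)"
      by (rule square_integrable_mult_integrable[OF w u])
    show "AE \<xi> in lebesgue. norm ((cmod (complex_of_real (norm \<xi> powr s) * fourier_L2 ?u \<xi>))\<^sup>2) \<le> norm (fourier_L2 ?w \<xi> * fourier_L2 ?u \<xi>)"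
      using fourier_v_D_laplacian
    proof eventually_elim
      case (elim \<xi>)
      have "norm \<xi> powr (2 * s) = norm \<xi> powr s * norm \<xi> powr s" by (simp add: powr_add[symmetric])
      then show ?case unfolding elim by (simp add: norm_mult power2_eq_square)
    qed
  qed measurable
  then have "square_integrable (\<lambda>\<xi>. complex_of_real (norm \<xi> powr s) * fourier_L2 ?u \<xi>)"
    by (simp add: square_integrable_def)
  then have S: "?u \<in> sobolev_space s" by (rule sobolev_spaceI[OF v_D_square_integrable _ s])
  define t where "t = 1 / (lambda_const s \<beta> DIM('a))\<^sup>2"
  have vm[measurable]: "(v_D s \<beta> :: 'a \<Rightarrow> real) \<in> borel_measurable borel" using v_D_lborel[where 'a = 'a] by auto
  \<comment> \<open>On the support the squared norm is at most \<open>t\<close>, so there the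
    potential is bounded by \<beta> / 2 * t + 1.\<close>
  have "integrable lborel (\<lambda>y :: 'a. (\<beta> / 2 * (norm y)\<^sup>2 - 1) * v_D s \<beta> y)"
  proof (rule Bochner_Integration.integrable_bound)
    show "integrable lborel (\<lambda>y :: 'a. (\<beta> / 2 * t + 1) * v_D s \<beta> y)" by (intro integrable_mult_right v_D_lborel)
    show "AE y :: 'a in lborel. norm ((\<beta> / 2 * (norm y)\<^sup>2 - 1) * v_D s \<beta> y) \<le> norm ((\<beta> / 2 * t + 1) * v_D s \<beta> y)"
    proof (rule AE_I2)
      fix y :: 'a
      show "norm ((\<beta> / 2 * (norm y)\<^sup>2 - 1) * v_D s \<beta> y) \<le> norm ((\<beta> / 2 * t + 1) * v_D s \<beta> y)"
      proof (cases "(norm y)\<^sup>2 \<le> t")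
        case True
        have "\<bar>\<beta> / 2 * (norm y)\<^sup>2 - 1\<bar> \<le> \<beta> / 2 * (norm y)\<^sup>2 + 1" using \<beta> by (auto simp: abs_if)
        also have "\<dots> \<le> \<beta> / 2 * t + 1" using \<beta> True by simp
        also have "\<dots> \<le> \<bar>\<beta> / 2 * t + 1\<bar>" by (rule abs_ge_self)
        finally show ?thesis unfolding real_norm_def abs_mult by (intro mult_right_mono) auto
      next
        case False
        then have "cap t y = 0" by (simp add: cap_def)
        then show ?thesis by (simp add: v_D_eq_cap t_def)
      qed
    qed
  qed measurable
  then have "integrable lebesgue (\<lambda>y :: 'a. (\<beta> / 2 * (norm y)\<^sup>2 - 1) * v_D s \<beta> y)"
    by (subst integrable_completion) auto
  moreover have "0 \<le> v_D s \<beta> y" for y :: 'a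
    unfolding v_D_eq_cap using v_D_coefficient_pos[where 'a = 'a] by (intro mult_nonneg_nonneg) auto
  ultimately show ?thesis using S by (simp add: admissible_def)
qed

lemmas v_D_energy_gap = energy_gap[OF s(1) v_D_admissible _ v_D_laplacian_square_integrable fourier_v_D_laplacian v_D_laplacian_bounds]

lemma v_D_minimal:
  fixes v :: "'a::euclidean_space \<Rightarrow> real"
  assumes v: "v \<in> admissible s \<beta>"
  shows "energy s \<beta> (v_D s \<beta> :: 'a \<Rightarrow> real) \<le> energy s \<beta> v"
  by (rule order_trans[OF _ v_D_energy_gap[OF v]]) simp

text \<open>The quadratic gap forces |\<xi>|^s times the difference of the transforms to vanish
  almost everywhere, and the transform is injective up to null sets.\<close>

lemma v_D_unique:
  fixes v :: "'a::euclidean_space \<Rightarrow> real"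
  assumes v: "v \<in> admissible s \<beta>" and le: "energy s \<beta> v \<le> energy s \<beta> (v_D s \<beta> :: 'a \<Rightarrow> real)"
  shows "AE y in lebesgue. v y = v_D s \<beta> y"
proof -
  let ?u = "\<lambda>x :: 'a. complex_of_real (v_D s \<beta> x)" and ?v = "\<lambda>x. complex_of_real (v x)"
  let ?g = "\<lambda>f \<xi>. complex_of_real (norm \<xi> powr s) * fourier_L2 f \<xi>"
  let ?R = "sq_norm (\<lambda>\<xi>. ?g ?v \<xi> - ?g ?u \<xi>)"
  have v2: "square_integrable ?v" using v by (simp add: admissible_def sobolev_space_def)
  have "1 / (2 * (2 * pi) ^ DIM('a)) * ?R \<le> 0" using v_D_energy_gap[OF v] le by simp
  moreover have "0 < 1 / (2 * (2 * pi) ^ DIM('a))" by simp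
  ultimately have "?R \<le> 0" by (meson mult_pos_pos not_le)
  then have R: "?R = 0" by (simp add: order_antisym)
  have "square_integrable (\<lambda>\<xi>. ?g ?v \<xi> - ?g ?u \<xi>)"
    using v v_D_admissible[where 'a = 'a] s by (intro square_integrable_diff sobolev_space_homogeneous) (auto simp: admissible_def)
  from square_integrable_zero_AE[OF this R] have "AE \<xi> in lebesgue. ?g ?v \<xi> - ?g ?u \<xi> = 0" .
  \<comment> \<open>The multiplier vanishes only at the origin.\<close>
  moreover have "AE \<xi> in lebesgue. \<xi> \<noteq> (0:: 'a)" by (rule AE_completion[OF AE_lborel_singleton])
  ultimately have "AE \<xi> in lebesgue. fourier_L2 ?v \<xi> = fourier_L2 ?u \<xi>" by eventually_elim simp
  from fourier_L2_inject_AE[OF v2 v_D_square_integrable this] show ?thesis by simp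
qed

end

text \<open>The equivalence says more than uniqueness: its converse direction shows that a minimiser
  exists, so that speaking of the minimiser is not vacuous.\<close>

theorem lemma4p4:
  fixes s \<beta> :: real and v_O :: "real ^ 'n \<Rightarrow> real"
  assumes "0 < s" and "s < 1" and "0 < \<beta>"
  shows "is_arg_min (energy s \<beta>) (\<lambda>v. v \<in> admissible s \<beta>) v_O \<longleftrightarrow>
         (AE y in lebesgue. v_O y = v_D s \<beta> y)"
proof
  assume "is_arg_min (energy s \<beta>) (\<lambda>v. v \<in> admissible s \<beta>) v_O"
  then have "v_O \<in> admissible s \<beta>" "energy s \<beta> v_O \<le> energy s \<beta> (v_D s \<beta> :: real ^ 'n \<Rightarrow> real)"
    using v_D_admissible[OF assms, where 'a = "real ^ 'n"] by (auto simp: is_arg_min_def not_less)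
  then show "AE y in lebesgue. v_O y = v_D s \<beta> y" by (rule v_D_unique[OF assms])
next
  assume ae: "AE y in lebesgue. v_O y = v_D s \<beta> y"
  have "v_O \<in> admissible s \<beta>" "energy s \<beta> v_O = energy s \<beta> (v_D s \<beta> :: real ^ 'n \<Rightarrow> real)"
    by (rule admissible_cong_AE[OF v_D_admissible[OF assms] ae assms(1,2)])+
  then show "is_arg_min (energy s \<beta>) (\<lambda>v. v \<in> admissible s \<beta>) v_O"
    using v_D_minimal[OF assms] by (auto simp: is_arg_min_def not_less)
qed

end
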